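(* Let $\alpha\in(0,1)$, $\tau>0$, $\mu>0$, $m=\alpha/(1-\alpha)$, let $(d_n)_{n\ge 1}$ be a queueing discipline, and consider the two buses on the line defined in the context, the first leaving the depot at time $0$ and the second at time $\mu$. Let $$N=\min\{i\ge0: H^{(1)}_i\ge H^{(2)}_i\}\qquad(\min\varnothing=\infty)$$ be the station where the two buses coalesce. Let $d\ge2$ denote an integer. (i) If $d_n=\min(d,n)$ for all $n\ge 1$ and $\varrho(d-2)<1$, then $\mathbf P(N<\infty)=1$. (ii) If $d_n=\min(d,n)$ for all $n\ge 1$ and $\varrho(d-2)>1$, then $\mathbf P(N=\infty)>0$. (iii) If $d_n\to\infty$ as $n\to\infty$, then $\mathbf P(N<\infty)=1$.
   Context: $\mathbb N=\{0,1,2,\dots\}$. Discipline: a sequence of positive integers $(d_i)_{i\ge1}$ with $d_1=1$, $d_2=2$ and $d_i\le d_{i+1}\le d_i+1$ for $i\ge2$. Arrivals: to the stations $i\ge1$ are associated independent Poisson point processes $(T^{(i)}_k:k\ge1)$ on $[0,\infty)$ with intensity $\alpha$ (points listed in increasing order); $T_k^{(i)}$ is the arrival time of the $k$-th customer at station $i$. Buses: each bus takes time $\tau$ to travel from one station to the next and each boarding takes one unit of time. $H^{(k)}_i$ is the time at which bus $k\in\{1,2\}$ leaves station $i$. For bus 1: $H^{(1)}_0=0$ and recursively for $i\ge1$, $F^{(1)}_i=\min\{j\ge1: T^{(i)}_j>H^{(1)}_{i-d_i}\}$; $\mathcal I^{(1)}_i=\{k\in\mathbb N:\ \forall j\in\{0,\dots,k\},\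 T^{(i)}_{F^{(1)}_i+j}\le H^{(1)}_{i-1}+\tau+j\}$; $M^{(1)}_i=F^{(1)}_i-1+\#\mathcal I^{(1)}_i$; $H^{(1)}_i=H^{(1)}_{i-1}+\tau+(M^{(1)}_i-F^{(1)}_i+1)$. For bus 2 (customers may already have been taken by bus 1): $H^{(2)}_0=\mu$ and recursively for $i\ge1$, $F^{(2)}_i=\min\{j>M^{(1)}_i: T^{(i)}_j>H^{(2)}_{i-d_i}\}$; $\mathcal I^{(2)}_i=\{k\in\mathbb N:\ \forall j\in\{0,\dots,k\},\ T^{(i)}_{F^{(2)}_i+j}\le H^{(2)}_{i-1}+\tau+j\}$; $M^{(2)}_i=F^{(2)}_i-1+\#\mathcal I^{(2)}_i$; $H^{(2)}_i=H^{(2)}_{i-1}+\tau+(M^{(2)}_i-F^{(2)}_i+1)$. For an integer $a\ge0$, $\varrho(a)$ denotes the largest (positive real) root of the polynomial $P_a=X^{a+1}-m\sum_{k=0}^aX^k$. *)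

theory Defs
  imports
    "HOL-Probability.Probability"
    "HOL-Computational_Algebra.Polynomial"
    "HOL-Library.Extended_Nat"
begin

text \<open>The value at index \<open>0\<close> is irrelevant.\<close>

definition queueing_discipline :: "(nat \<Rightarrow> nat) \<Rightarrow> bool" where
  "queueing_discipline \<delta> \<longleftrightarrow>
     (\<forall>i\<ge>1. 0 < \<delta> i) \<and> \<delta> 1 = 1 \<and> \<delta> 2 = 2 \<and>
     (\<forall>i\<ge>2. \<delta> i \<le> \<delta> (i + 1) \<and> \<delta> (i + 1) \<le> \<delta> i + 1)"


subsection \<open>Arrivals\<close>

definition point_count :: "(nat \<Rightarrow> real) \<Rightarrow> real set \<Rightarrow> nat" where
  "point_count x B = card {k. 1 \<le> k \<and> x k \<in> B}"

text \<open>
  A homogeneous Poisson point process on the half-line, given by its points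
  \<open>T 1 < T 2 < \<dots>\<close> in increasing order. Divergence of the points means that almost surely
  only finitely many lie in a bounded set, so the convention that infinite sets
  have cardinality \<open>0\<close> does not affect the counts. The Poisson probabilities are written
  out because \<^const>\<open>poisson_pmf\<close> is only meaningful for a positive rate, whereas \<open>B\<close> may be
  a Lebesgue null set.
\<close>

definition poisson_point_process :: "'a measure \<Rightarrow> real \<Rightarrow> (nat \<Rightarrow> 'a \<Rightarrow> real) \<Rightarrow> bool" where
  "poisson_point_process M \<alpha> T \<longleftrightarrow>
     (\<forall>k\<ge>1. T k \<in> borel_measurable M) \<and>
     (AE \<omega> in M. 0 \<le> T 1 \<omega> \<and> (\<forall>k\<ge>1. T k \<omega> < T (k + 1) \<omega>) \<and>
        filterlim (\<lambda>k. T k \<omega>) at_top sequentially) \<and>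
     (\<forall>B n. B \<in> sets borel \<and> bounded B \<and> B \<subseteq> {0..} \<longrightarrow>
        measure M {\<omega> \<in> space M. point_count (\<lambda>k. T k \<omega>) B = n} =
          (\<alpha> * measure lborel B) ^ n / fact n * exp (- (\<alpha> * measure lborel B))) \<and>
     (\<forall>B :: nat \<Rightarrow> real set.
        disjoint_family B \<and> (\<forall>j. B j \<in> sets borel \<and> bounded (B j) \<and> B j \<subseteq> {0..}) \<longrightarrow>
        prob_space.indep_vars M (\<lambda>_. count_space UNIV)
          (\<lambda>j \<omega>. point_count (\<lambda>k. T k \<omega>) (B j)) UNIV)"

text \<open>\<open>T i k\<close> is the arrival time of the \<open>k\<close>-th customer at station \<open>i\<close>, for \<open>i, k \<ge> 1\<close>.\<close>

definition arrivals :: "'a measure \<Rightarrow> real \<Rightarrow> (nat \<Rightarrow> nat \<Rightarrow> 'a \<Rightarrow> real) \<Rightarrow> bool" where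
  "arrivals M \<alpha> T \<longleftrightarrow>
     (\<forall>i\<ge>1. poisson_point_process M \<alpha> (T i)) \<and>
     prob_space.indep_vars M (\<lambda>_. \<Pi>\<^sub>M k\<in>{1..}. borel) (\<lambda>i \<omega>. \<lambda>k\<in>{1..}. T i k \<omega>) {1..}"


subsection \<open>Buses\<close>

text \<open>
  One stop of a bus at a station whose arrival times are \<open>x 1, x 2, \<dots>\<close>: \<open>l\<close> is the last
  customer already taken by an earlier bus (\<open>0\<close> if there is none), \<open>h\<close> the time after which
  customers may use this bus and \<open>s\<close> the time at which the bus reaches the station.
  The set of candidates in \<open>first_customer\<close> is empty, and \<open>boarding_set\<close> is infinite, only on
  null events when the arrivals are Poisson processes of intensity less than \<open>1\<close>.
\<close>

definition first_customer :: "(nat \<Rightarrow> real) \<Rightarrow> nat \<Rightarrow> real \<Rightarrow> nat" where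
  "first_customer x l h = (LEAST j. l < j \<and> h < x j)"

definition boarding_set :: "(nat \<Rightarrow> real) \<Rightarrow> nat \<Rightarrow> real \<Rightarrow> nat set" where
  "boarding_set x f s = {k. \<forall>j\<in>{0..k}. x (f + j) \<le> s + real j}"

definition last_customer :: "(nat \<Rightarrow> real) \<Rightarrow> nat \<Rightarrow> real \<Rightarrow> nat" where
  "last_customer x f s = f - 1 + card (boarding_set x f s)"

text \<open>
  Departure times \<open>H i\<close> of a bus leaving the depot at time \<open>h0\<close>, where \<open>x i\<close> lists the arrivals at
  station \<open>i\<close> and \<open>l i\<close> is the last customer taken there by an earlier bus. For a
  discipline, \<open>1 \<le> \<delta> (Suc i) \<le> Suc i\<close>, so that \<open>i - (\<delta> (Suc i) - 1) = Suc i - \<delta> (Suc i)\<close>; the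
  form used makes the recursion terminate for every \<open>\<delta>\<close>.
\<close>

fun departure ::
  "(nat \<Rightarrow> nat) \<Rightarrow> real \<Rightarrow> real \<Rightarrow> (nat \<Rightarrow> nat \<Rightarrow> real) \<Rightarrow> (nat \<Rightarrow> nat) \<Rightarrow> nat \<Rightarrow> real" where
  "departure \<delta> \<tau> h0 x l 0 = h0"
| "departure \<delta> \<tau> h0 x l (Suc i) =
     (let s = departure \<delta> \<tau> h0 x l i + \<tau>;
          f = first_customer (x (Suc i)) (l (Suc i))
                (departure \<delta> \<tau> h0 x l (i - (\<delta> (Suc i) - 1)));
          m = last_customer (x (Suc i)) f s
      in s + (real m - real f + 1))"

lemma queueing_discipline_bounds:
  assumes "queueing_discipline \<delta>" "1 \<le> i"
  shows "1 \<le> \<delta> i" "\<delta> i \<le> i"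
proof -
  show "1 \<le> \<delta> i"
    using assms by (auto simp: queueing_discipline_def Suc_le_eq)
  have "\<delta> j \<le> j" if "2 \<le> j" for j
    using that
  proof (induction j rule: dec_induct)
    case base
    then show ?case using assms by (simp add: queueing_discipline_def)
  next
    case (step j)
    have "\<delta> (j + 1) \<le> \<delta> j + 1"
      using assms(1) step(1) by (simp add: queueing_discipline_def)
    then show ?case using step by simp
  qed
  moreover have "\<delta> 1 \<le> 1"
    using assms by (simp add: queueing_discipline_def)
  ultimately show "\<delta> i \<le> i"
    using assms(2) by (cases "i = 1") auto
qed

lemma departure_rec:
  fixes \<tau> h0 :: real and x :: "nat \<Rightarrow> nat \<Rightarrow> real" and l :: "nat \<Rightarrow> nat"
  assumes "queueing_discipline \<delta>" "1 \<le> i"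
  defines "H \<equiv> departure \<delta> \<tau> h0 x l"
  defines "f \<equiv> first_customer (x i) (l i) (H (i - \<delta> i))"
  defines "m \<equiv> last_customer (x i) f (H (i - 1) + \<tau>)"
  shows "H i = H (i - 1) + \<tau> + (real m - real f + 1)"
proof -
  obtain j where j: "i = Suc j" using assms(2) by (cases i) auto
  have "j - (\<delta> (Suc j) - 1) = Suc j - \<delta> (Suc j)"
    using queueing_discipline_bounds[OF assms(1,2)] j by simp
  then show ?thesis
    unfolding m_def f_def H_def j by (simp add: Let_def)
qed

definition H1 :: "(nat \<Rightarrow> nat) \<Rightarrow> real \<Rightarrow> (nat \<Rightarrow> nat \<Rightarrow> real) \<Rightarrow> nat \<Rightarrow> real" where
  "H1 \<delta> \<tau> x = departure \<delta> \<tau> 0 x (\<lambda>_. 0)"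

definition F1 :: "(nat \<Rightarrow> nat) \<Rightarrow> real \<Rightarrow> (nat \<Rightarrow> nat \<Rightarrow> real) \<Rightarrow> nat \<Rightarrow> nat" where
  "F1 \<delta> \<tau> x i = first_customer (x i) 0 (H1 \<delta> \<tau> x (i - \<delta> i))"

definition M1 :: "(nat \<Rightarrow> nat) \<Rightarrow> real \<Rightarrow> (nat \<Rightarrow> nat \<Rightarrow> real) \<Rightarrow> nat \<Rightarrow> nat" where
  "M1 \<delta> \<tau> x i = last_customer (x i) (F1 \<delta> \<tau> x i) (H1 \<delta> \<tau> x (i - 1) + \<tau>)"

definition H2 :: "(nat \<Rightarrow> nat) \<Rightarrow> real \<Rightarrow> real \<Rightarrow> (nat \<Rightarrow> nat \<Rightarrow> real) \<Rightarrow> nat \<Rightarrow> real" where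
  "H2 \<delta> \<tau> \<mu> x = departure \<delta> \<tau> \<mu> x (M1 \<delta> \<tau> x)"

text \<open>The infimum of the empty set is \<open>\<infinity>\<close>.\<close>

definition coalescence_station ::
  "(nat \<Rightarrow> nat) \<Rightarrow> real \<Rightarrow> real \<Rightarrow> (nat \<Rightarrow> nat \<Rightarrow> real) \<Rightarrow> enat" where
  "coalescence_station \<delta> \<tau> \<mu> x = (INF i\<in>{i. H1 \<delta> \<tau> x i \<ge> H2 \<delta> \<tau> \<mu> x i}. enat i)"


subsection \<open>The critical parameter\<close>

definition critical_poly :: "real \<Rightarrow> nat \<Rightarrow> real poly" where
  "critical_poly m a = monom 1 (a + 1) - smult m (\<Sum>k=0..a. monom 1 k)"

text \<open>For \<open>m > 0\<close> the set below is finite and, by the intermediate value theorem, nonempty.\<close>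

definition largest_root :: "real \<Rightarrow> nat \<Rightarrow> real" where
  "largest_root m a = Max {r. 0 < r \<and> poly (critical_poly m a) r = 0}"

end

theory Submission
  imports Defs
begin

text \<open>
  Given the stations before \<open>i\<close>, the numbers of customers boarding the two buses at station \<open>i\<close> depend
  on the counts of the arrivals in disjoint intervals with known end points. Hence the pairs of
  boarding numbers form a chain on a countable set of histories: each number is the total progeny of
  a queue fed with Poisson arrivals during a window which the history determines, and the mean of a
  boarding number is \<open>m\<close> times the length of the window. This turns \<open>P(N > n)\<close> into a
  survival probability of this chain.

  If \<open>m (d - 1) < 1\<close>, the second bus is dominated by an independent copy of the first one. A pair
  of independent buses returns to the idle state, where the last \<open>d - 1\<close> boarding numbers vanish, and
  by a zero-one argument it either meets almost surely or survives with probability close to \<open>1\<close> from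
  some idle state. In the latter case, exchanging the two buses shows that their distance stays in
  a bounded interval forever with positive probability, but it leaves this interval at a geometric
  time.

  If \<open>m (d - 1) > 1\<close>, exponential deviation bounds show that boarding numbers growing like \<open>r ^ i\<close>,
  where \<open>r\<close> is the root, keep growing in this way, so that a second bus which is far enough
  behind is never caught up by the first one.

  If the delays are unbounded, the windows of the first bus eventually contain nearly its whole time
  of travel, whereas the second bus only takes customers arriving after the first one left. In units of
  \<open>(1 + m) ^ n\<close>, the mean distance of the buses then loses a fixed fraction of its initial bound at
  each step, which is only possible for finitely many steps.
\<close>

section \<open>Discrete preliminaries\<close>

text \<open>Conditioning on the past is avoided. For a fixed history all end points of windows are
  constants, so the event that the arrivals produce this history is an intersection, over the
  stations, of events about a single Poisson process each. Histories are countable, and what would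
  be a conditional expectation becomes an iterated expectation over pmfs.

  The thresholds come from counting: a boarding number enters the next \<open>d - 1\<close> windows
  and each unit of window contributes \<open>m\<close> in mean, so \<open>m * (d - 1)\<close> is the
  mean offspring, and \<open>r ^ (d - 1) = m * (\<Sum>k<d - 1. r ^ k)\<close> is the characteristic
  equation of the growth.

  In the subcritical case the exchange works because, for two idle buses at distance
  \<open>u\<close>, never reaching 0 and never reaching \<open>2 * u\<close> are equally likely. If
  this probability exceeded 1/2, both would happen together with positive probability.

  With unbounded delays the obstacle is that the time of the first bus is comparable to its mean
  only up to a factor \<open>c\<close>, while the mean distance has the same order. One stop does
  not decide; a number of stops large compared with \<open>1 / c\<close> is needed, during which
  nothing may go wrong.\<close>

lemma expectation_bind_pmf:
  fixes f :: "'b \<Rightarrow> real"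
  assumes "\<And>y. \<bar>f y\<bar> \<le> C"
  shows "measure_pmf.expectation (bind_pmf p g) f =
    measure_pmf.expectation p (\<lambda>x. measure_pmf.expectation (g x) f)"
  unfolding measure_pmf_bind
  by (rule integral_bind[where K = "count_space UNIV" and B = C and B' = 1])
     (use assms in \<open>auto simp: measure_pmf.emeasure_space_1 space_subprob_algebra measure_pmf.subprob_space_axioms
        intro: measure_pmf.finite_measure_axioms\<close>)

lemma integrable_pmf_bounded:
  fixes f :: "'b \<Rightarrow> real"
  assumes "\<And>y. \<bar>f y\<bar> \<le> C"
  shows "integrable (measure_pmf p) f"
  by (rule measure_pmf.integrable_const_bound[where B = C]) (use assms in auto)

lemma expectation_pmf_mono:
  fixes f g :: "'b \<Rightarrow> real"
  assumes "\<And>y. \<bar>f y\<bar> \<le> C" "\<And>y. \<bar>g y\<bar> \<le> D" "\<And>y. y \<in> set_pmf p \<Longrightarrow> f y \<le> g y"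
  shows "measure_pmf.expectation p f \<le> measure_pmf.expectation p g"
  by (intro integral_mono_AE integrable_pmf_bounded[of f C] integrable_pmf_bounded[of g D])
     (use assms in \<open>auto simp: AE_measure_pmf_iff\<close>)

lemma expectation_pmf_bounds:
  fixes f :: "'b \<Rightarrow> real"
  assumes "\<And>y. y \<in> set_pmf p \<Longrightarrow> 0 \<le> f y \<and> f y \<le> c" "0 \<le> c"
  shows "0 \<le> measure_pmf.expectation p f \<and> measure_pmf.expectation p f \<le> c"
proof
  show "0 \<le> measure_pmf.expectation p f"
    by (rule integral_nonneg_AE) (use assms in \<open>auto simp: AE_measure_pmf_iff\<close>)
  have "measure_pmf.expectation p f \<le> measure_pmf.expectation p (\<lambda>_. c)"
    by (rule integral_mono_AE)
       (use assms in \<open>auto simp: AE_measure_pmf_iff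
          intro!: measure_pmf.integrable_const_bound[where B = c]\<close>)
  then show "measure_pmf.expectation p f \<le> c" by simp
qed

lemma prob_bind_pmf:
  "measure_pmf.prob (bind_pmf p g) S = measure_pmf.expectation p (\<lambda>x. measure_pmf.prob (g x) S)"
proof -
  have "measure_pmf.prob (bind_pmf p g) S = measure_pmf.expectation (bind_pmf p g) (indicator S)"
    by simp
  also have "\<dots> = measure_pmf.expectation p (\<lambda>x. measure_pmf.expectation (g x) (indicator S))"
    by (rule expectation_bind_pmf[where C = 1]) (auto simp: indicator_def)
  finally show ?thesis by simp
qed

text \<open>A monotone \<open>f\<close> is \<open>f 0\<close> plus the multiples
  \<open>f (Suc k) - f k\<close> of tail indicators, so an order of the tails passes to
  expectations. In this form a longer window acts on survival probabilities.\<close>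

lemma expectation_pmf_tail_mono:
  fixes f :: "nat \<Rightarrow> real"
  assumes tail: "\<And>k. measure_pmf.prob p {k<..} \<le> measure_pmf.prob p' {k<..}"
    and f: "mono f" "\<And>n. 0 \<le> f n" "\<And>n. f n \<le> 1"
  shows "measure_pmf.expectation p f \<le> measure_pmf.expectation p' f"
proof -
  have eq: "(\<integral>\<^sup>+n. ennreal (f n) \<partial>measure_pmf q) =
      ennreal (f 0) + (\<Sum>k. ennreal (f (Suc k) - f k) * emeasure (measure_pmf q) {k<..})"
    for q :: "nat pmf"
  proof -
    have *: "ennreal (f n) = ennreal (f 0) + (\<Sum>k. ennreal (f (Suc k) - f k) * indicator {k<..} n)" for n
    proof -
      have "(\<Sum>k. ennreal (f (Suc k) - f k) * indicator {k<..} n) =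
          (\<Sum>k<n. ennreal (f (Suc k) - f k) * indicator {k<..} n)"
        by (rule suminf_finite) (auto simp: indicator_def)
      also have "\<dots> = (\<Sum>k<n. ennreal (f (Suc k) - f k))"
        by (intro sum.cong) (auto simp: indicator_def)
      also have "\<dots> = ennreal (\<Sum>k<n. f (Suc k) - f k)"
        by (rule sum_ennreal) (use f(1) in \<open>auto simp: mono_def\<close>)
      also have "\<dots> = ennreal (f n - f 0)"
        by (simp add: sum_lessThan_telescope)
      finally show ?thesis
        using f(1) f(2)[of 0] by (simp add: ennreal_plus[symmetric] mono_def del: ennreal_plus)
    qed
    show ?thesis
      by (subst *) (simp add: nn_integral_add nn_integral_suminf nn_integral_cmult)
  qed
  have "(\<integral>\<^sup>+n. ennreal (f n) \<partial>measure_pmf p) \<le> (\<integral>\<^sup>+n. ennreal (f n) \<partial>measure_pmf p')"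
    unfolding eq
    by (intro add_left_mono suminf_le mult_left_mono)
       (use tail in \<open>auto simp: measure_pmf.emeasure_eq_measure ennreal_leI\<close>)
  then have "ennreal (measure_pmf.expectation p f) \<le> ennreal (measure_pmf.expectation p' f)"
    using f by (simp add: nn_integral_eq_integral integrable_pmf_bounded[where C = 1])
  moreover have "0 \<le> measure_pmf.expectation p' f" 
    using f(2) by (simp add: integral_nonneg_AE)
  ultimately show ?thesis by simp
qed


section \<open>The Poisson law\<close>

text \<open>Rate 0 has to be included, since the second bus may find a window of length 0.\<close>

definition pois :: "real \<Rightarrow> nat pmf" where
  "pois r = (if 0 < r then poisson_pmf r else return_pmf 0)"

lemma pmf_pois: "0 \<le> r \<Longrightarrow> pmf (pois r) k = r ^ k / fact k * exp (- r)"
  by (cases k) (auto simp: pois_def pmf_return)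

lemma pois_0 [simp]: "pois 0 = return_pmf 0"
  by (simp add: pois_def)

lemma nn_integral_pois:
  assumes "0 \<le> r"
  shows "(\<integral>\<^sup>+c. f c \<partial>measure_pmf (pois r)) = (\<Sum>c. ennreal (r ^ c / fact c * exp (- r)) * f c)"
  using assms by (simp add: nn_integral_measure_pmf nn_integral_count_space_nat pmf_pois)

lemma nn_integral_exp_pois:
  assumes "0 \<le> r"
  shows "(\<integral>\<^sup>+c. ennreal (exp (s * real c)) \<partial>measure_pmf (pois r)) = ennreal (exp (r * (exp s - 1)))"
proof -
  have "(\<lambda>c. (r * exp s) ^ c /\<^sub>R fact c) sums exp (r * exp s)"
    by (rule exp_converges)
  then have "(\<lambda>c. exp (- r) * ((r * exp s) ^ c /\<^sub>R fact c)) sums (exp (- r) * exp (r * exp s))"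
    by (rule sums_mult)
  moreover have "exp (- r) * ((r * exp s) ^ c /\<^sub>R fact c) = r ^ c / fact c * exp (- r) * exp (s * real c)" for c
    by (simp add: power_mult_distrib exp_of_nat_mult[symmetric] field_simps)
  ultimately have "(\<lambda>c. r ^ c / fact c * exp (- r) * exp (s * real c)) sums (exp (r * (exp s - 1)))"
    by (simp add: exp_add[symmetric] algebra_simps)
  then have "(\<Sum>c. ennreal (r ^ c / fact c * exp (- r) * exp (s * real c))) = ennreal (exp (r * (exp s - 1)))"
    using assms by (intro sums_unique[symmetric]) (simp add: sums_ennreal)
  then show ?thesis
    using assms by (simp add: nn_integral_pois ennreal_mult[symmetric])
qed

lemma nn_integral_real_pois:
  assumes "0 \<le> r"
  shows "(\<integral>\<^sup>+c. ennreal (real c) \<partial>measure_pmf (pois r)) = ennreal r"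
proof -
  have "(\<lambda>c. r ^ c /\<^sub>R fact c) sums exp r"
    by (rule exp_converges)
  then have "(\<lambda>c. r * exp (- r) * (r ^ c /\<^sub>R fact c)) sums (r * exp (- r) * exp r)"
    by (rule sums_mult)
  moreover have "r * exp (- r) * (r ^ c /\<^sub>R fact c) = r ^ Suc c / fact (Suc c) * exp (- r) * real (Suc c)" for c
    by (simp add: field_simps del: of_nat_Suc)
  ultimately have "(\<lambda>c. r ^ Suc c / fact (Suc c) * exp (- r) * real (Suc c)) sums (r * exp (- r) * exp r)"
    by simp
  also have "r * exp (- r) * exp r = r"
    by (simp add: exp_minus)
  finally have "(\<lambda>c. r ^ c / fact c * exp (- r) * real c) sums r"
    by (subst (asm) sums_Suc_iff) simp
  then have "(\<Sum>c. ennreal (r ^ c / fact c * exp (- r) * real c)) = ennreal r"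
    using assms by (intro sums_unique[symmetric]) (simp add: sums_ennreal)
  then show ?thesis
    using assms by (simp add: nn_integral_pois ennreal_mult[symmetric])
qed

text \<open>Splits the arrivals of a window into those of a shorter window and an independent rest;
  this is the coupling behind \<open>boarding_tail_mono\<close>.\<close>

lemma pois_add:
  assumes "0 \<le> a" "0 \<le> b"
  shows "pois (a + b) = bind_pmf (pois a) (\<lambda>i. map_pmf (\<lambda>j. i + j) (pois b))"
proof (rule pmf_eqI)
  fix n
  have inner: "pmf (map_pmf (\<lambda>j. i + j) (pois b)) n = (if i \<le> n then pmf (pois b) (n - i) else 0)" for i
  proof -
    have "(\<lambda>j. i + j) -` {n} = (if i \<le> n then {n - i} else {})" by auto
    then show ?thesis by (simp add: pmf_map measure_pmf_single)
  qed
  have "pmf (bind_pmf (pois a) (\<lambda>i. map_pmf (\<lambda>j. i + j) (pois b))) n =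
      (\<Sum>i\<le>n. pmf (pois a) i * pmf (pois b) (n - i))"
    unfolding pmf_bind inner
    by (subst integral_measure_pmf_real[where A = "{..n}"]) (auto split: if_splits intro!: sum.cong)
  also have "\<dots> = (\<Sum>i\<le>n. of_nat (n choose i) * a ^ i * b ^ (n - i)) / fact n * exp (- (a + b))"
    unfolding sum_divide_distrib sum_distrib_right
  proof (rule sum.cong)
    fix i assume i: "i \<in> {..n}"
    have "real (n choose i) / fact n = 1 / (fact i * fact (n - i))"
      using i by (simp add: binomial_fact)
    moreover have "real (n choose i) * a ^ i * b ^ (n - i) / fact n = (real (n choose i) / fact n) * (a ^ i * b ^ (n - i))"
      by simp
    ultimately have "real (n choose i) * a ^ i * b ^ (n - i) / fact n = a ^ i * b ^ (n - i) / (fact i * fact (n - i))"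
      by simp
    moreover have "pmf (pois a) i * pmf (pois b) (n - i) =
        a ^ i * b ^ (n - i) / (fact i * fact (n - i)) * (exp (- a) * exp (- b))"
      using assms by (simp add: pmf_pois)
    moreover have "exp (- a) * exp (- b) = exp (- (a + b))"
      by (simp add: exp_add[symmetric])
    ultimately show "pmf (pois a) i * pmf (pois b) (n - i) =
        real (n choose i) * a ^ i * b ^ (n - i) / fact n * exp (- (a + b))"
      by simp
  qed simp
  also have "\<dots> = pmf (pois (a + b)) n"
    using assms by (simp add: pmf_pois binomial_ring atLeast0AtMost)
  finally show "pmf (pois (a + b)) n = pmf (bind_pmf (pois a) (\<lambda>i. map_pmf (\<lambda>j. i + j) (pois b))) n" ..
qed


section \<open>The number of customers boarding at a stop\<close>

text \<open>One customer boards per unit of time; \<open>cs\<close> lists the numbers of arrivals during the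
  successive units. The queue, initially of length \<open>q\<close>, becomes empty exactly after the last one.\<close>

fun empties :: "nat \<Rightarrow> nat list \<Rightarrow> bool" where
  "empties q [] \<longleftrightarrow> q = 0"
| "empties q (c # cs) \<longleftrightarrow> 0 < q \<and> empties (q - 1 + c) cs"

text \<open>The Borel-Tanner law of a busy period with unit service times. Whether it lasts exactly
  \<open>n\<close> units is decided by the first \<open>n\<close> slots, so finitely many
  independent counts define it.\<close>

definition busy_prob :: "real \<Rightarrow> nat \<Rightarrow> nat \<Rightarrow> real" where
  "busy_prob \<alpha> q n = measure_pmf.prob (replicate_pmf n (pois \<alpha>)) {cs. empties q cs}"

definition busy :: "real \<Rightarrow> nat \<Rightarrow> nat pmf" where
  "busy \<alpha> q = embed_pmf (busy_prob \<alpha> q)"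

text \<open>The law of the number of boarding customers when the bus picks up all arrivals of a time
  window of length \<open>w\<close> before it starts boarding.\<close>

definition boarding :: "real \<Rightarrow> real \<Rightarrow> nat pmf" where
  "boarding \<alpha> w = bind_pmf (pois (\<alpha> * w)) (busy \<alpha>)"

context
  fixes \<alpha> :: real
  assumes \<alpha>: "0 < \<alpha>" "\<alpha> < 1"
begin

section \<open>The law of the busy period\<close>

lemma busy_prob_0: "busy_prob \<alpha> q 0 = of_bool (q = 0)"
  by (simp add: busy_prob_def)

lemma busy_prob_0_Suc [simp]: "busy_prob \<alpha> 0 (Suc n) = 0"
proof -
  have "measure_pmf.prob (replicate_pmf (Suc n) (pois \<alpha>)) {cs. empties 0 cs} =
      measure_pmf.prob (replicate_pmf (Suc n) (pois \<alpha>)) {}"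
    by (rule measure_pmf.finite_measure_eq_AE)
       (auto simp: AE_measure_pmf_iff set_replicate_pmf length_Suc_conv simp del: replicate_pmf.simps)
  then show ?thesis by (simp add: busy_prob_def del: replicate_pmf.simps)
qed

lemma busy_prob_Suc_Suc:
  "busy_prob \<alpha> (Suc q) (Suc n) = measure_pmf.expectation (pois \<alpha>) (\<lambda>c. busy_prob \<alpha> (q + c) n)"
proof -
  have *: "(#) c -` {cs. empties (Suc q) cs} = {cs. empties (q + c) cs}" for c
    by auto
  show ?thesis
    by (simp add: busy_prob_def prob_bind_pmf map_pmf_def[symmetric] *)
qed

lemma busy_prob_nonneg: "0 \<le> busy_prob \<alpha> q n"
  by (simp add: busy_prob_def)

lemma busy_prob_le_1: "busy_prob \<alpha> q n \<le> 1"
  by (simp add: busy_prob_def)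

text \<open>The bound on the length is strict, so that one elapsed unit lowers \<open>k\<close> by
  one and the value at \<open>k = 0\<close> is 0.\<close>

definition busy_cdf :: "nat \<Rightarrow> nat \<Rightarrow> real" where
  "busy_cdf k q = (\<Sum>n<k. busy_prob \<alpha> q n)"

lemma busy_cdf_Suc_0: "busy_cdf (Suc k) 0 = 1"
  unfolding busy_cdf_def by (subst sum.lessThan_Suc_shift) (simp add: busy_prob_0)

lemma busy_prob_bounded: "\<bar>busy_prob \<alpha> q n\<bar> \<le> 1"
  using busy_prob_nonneg[of q n] busy_prob_le_1[of q n] by simp

lemma busy_cdf_Suc_Suc:
  "busy_cdf (Suc k) (Suc q) = measure_pmf.expectation (pois \<alpha>) (\<lambda>c. busy_cdf k (q + c))"
proof -
  have "busy_cdf (Suc k) (Suc q) = (\<Sum>n<k. busy_prob \<alpha> (Suc q) (Suc n))"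
    unfolding busy_cdf_def by (subst sum.lessThan_Suc_shift) (simp add: busy_prob_0)
  also have "\<dots> = measure_pmf.expectation (pois \<alpha>) (\<lambda>c. busy_cdf k (q + c))"
    unfolding busy_cdf_def busy_prob_Suc_Suc
    by (rule Bochner_Integration.integral_sum[symmetric])
       (rule integrable_pmf_bounded[OF busy_prob_bounded])
  finally show ?thesis .
qed

lemma busy_cdf_nonneg: "0 \<le> busy_cdf k q"
  by (simp add: busy_cdf_def sum_nonneg busy_prob_nonneg)

lemma busy_cdf_le_1: "busy_cdf k q \<le> 1"
proof (induction k arbitrary: q)
  case 0
  then show ?case by (simp add: busy_cdf_def)
next
  case (Suc k)
  show ?case
  proof (cases q)
    case (Suc q')
    show ?thesis
      unfolding Suc busy_cdf_Suc_Suc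
      by (rule expectation_pmf_bounds[THEN conjunct2]) (use Suc.IH busy_cdf_nonneg in auto)
  qed (simp add: busy_cdf_Suc_0)
qed

lemma busy_cdf_bounded: "\<bar>busy_cdf k q\<bar> \<le> 1"
  using busy_cdf_nonneg[of k q] busy_cdf_le_1[of k q] by simp

lemma integrable_real_pois: "0 \<le> r \<Longrightarrow> integrable (measure_pmf (pois r)) real"
  by (rule integrableI_nonneg) (auto simp: nn_integral_real_pois)

lemma expectation_real_pois: "0 \<le> r \<Longrightarrow> measure_pmf.expectation (pois r) real = r"
  using integrable_real_pois[of r] nn_integral_real_pois[of r]
  by (simp add: nn_integral_eq_integral)

text \<open>The queue length is a supermartingale losing at least \<open>1 - \<alpha>\<close> per unit of time.\<close>

lemma busy_tail_sum: "(\<Sum>k<N. 1 - busy_cdf (Suc k) q) \<le> real q / (1 - \<alpha>)"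
proof (induction N arbitrary: q)
  case 0
  then show ?case using \<alpha> by simp
next
  case (Suc N)
  show ?case
  proof (cases q)
    case 0
    then show ?thesis by (simp add: busy_cdf_Suc_0)
  next
    case (Suc q')
    have int: "integrable (measure_pmf (pois \<alpha>)) (\<lambda>c. busy_cdf k (q' + c))" for k
      by (rule integrable_pmf_bounded[OF busy_cdf_bounded])
    have "(\<Sum>k<Suc N. 1 - busy_cdf (Suc k) q) =
        (\<Sum>k<Suc N. measure_pmf.expectation (pois \<alpha>) (\<lambda>c. 1 - busy_cdf k (q' + c)))"
      unfolding Suc busy_cdf_Suc_Suc using int by simp
    also have "\<dots> = measure_pmf.expectation (pois \<alpha>) (\<lambda>c. \<Sum>k<Suc N. 1 - busy_cdf k (q' + c))"
      by (rule Bochner_Integration.integral_sum[symmetric]) (use int in auto)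
    also have "\<dots> \<le> measure_pmf.expectation (pois \<alpha>) (\<lambda>c. (1 + real q' / (1 - \<alpha>)) + real c / (1 - \<alpha>))"
    proof (rule integral_mono)
      show "integrable (measure_pmf (pois \<alpha>)) (\<lambda>c. \<Sum>k<Suc N. 1 - busy_cdf k (q' + c))"
        using int by (intro Bochner_Integration.integrable_sum) auto
      show "integrable (measure_pmf (pois \<alpha>)) (\<lambda>c. (1 + real q' / (1 - \<alpha>)) + real c / (1 - \<alpha>))"
        using integrable_real_pois[of \<alpha>] \<alpha> by (intro Bochner_Integration.integrable_add) auto
      fix c
      \<comment> \<open>The summand at 0 equals 1 and accounts for the unit of time that has
        passed.\<close>
      have "(\<Sum>k<Suc N. 1 - busy_cdf k (q' + c)) = 1 + (\<Sum>k<N. 1 - busy_cdf (Suc k) (q' + c))"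
        by (subst sum.lessThan_Suc_shift) (simp add: busy_cdf_def)
      also have "\<dots> \<le> 1 + real (q' + c) / (1 - \<alpha>)"
        using Suc.IH[of "q' + c"] by simp
      finally show "(\<Sum>k<Suc N. 1 - busy_cdf k (q' + c)) \<le> (1 + real q' / (1 - \<alpha>)) + real c / (1 - \<alpha>)"
        by (simp add: add_divide_distrib)
    qed
    also have "\<dots> = 1 + real q' / (1 - \<alpha>) + \<alpha> / (1 - \<alpha>)"
      using integrable_real_pois[of \<alpha>] expectation_real_pois[of \<alpha>] \<alpha> by simp
    also have "\<dots> = real q / (1 - \<alpha>)"
      unfolding Suc using \<alpha> by (simp add: divide_simps)
    finally show ?thesis .
  qed
qed

text \<open>By the bounded sum of the tails, these tend to 0, so no mass escapes to infinity: the
  queue empties almost surely. The hypothesis \<alpha> < 1 enters through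
  \<open>busy_tail_sum\<close>.\<close>

lemma busy_prob_sums: "busy_prob \<alpha> q sums 1"
proof -
  have "summable (\<lambda>k. 1 - busy_cdf (Suc k) q)"
    by (rule summableI_nonneg_bounded[OF _ busy_tail_sum]) (simp add: busy_cdf_le_1)
  then have "(\<lambda>k. 1 - busy_cdf (Suc k) q) \<longlonglongrightarrow> 0"
    by (rule summable_LIMSEQ_zero)
  then have "(\<lambda>k. 1 - (1 - busy_cdf (Suc k) q)) \<longlonglongrightarrow> 1 - 0"
    by (intro tendsto_intros)
  then have "(\<lambda>k. busy_cdf (Suc k) q) \<longlonglongrightarrow> 1"
    by simp
  then show ?thesis
    unfolding sums_def busy_cdf_def by (rule LIMSEQ_imp_Suc)
qed

lemma pmf_busy: "pmf (busy \<alpha> q) n = busy_prob \<alpha> q n"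
  unfolding busy_def
proof (rule pmf_embed_pmf)
  show "(\<integral>\<^sup>+ n. ennreal (busy_prob \<alpha> q n) \<partial>count_space UNIV) = 1"
    using busy_prob_sums[of q] busy_prob_nonneg
    by (simp add: nn_integral_count_space_nat sums_ennreal[symmetric] sums_iff)
       (metis busy_prob_sums ennreal_1 sums_ennreal sums_unique zero_le_one)
qed (rule busy_prob_nonneg)

lemma prob_busy_lessThan: "measure_pmf.prob (busy \<alpha> q) {..<k} = busy_cdf k q"
  by (simp add: measure_measure_pmf_finite pmf_busy busy_cdf_def)

lemma prob_busy_tail: "measure_pmf.prob (busy \<alpha> q) {k<..} = 1 - busy_cdf (Suc k) q"
proof -
  have "{k<..} = UNIV - {..<Suc k}" by auto
  then show ?thesis
    using measure_pmf.prob_compl[of "{..<Suc k}" "busy \<alpha> q"] by (simp add: prob_busy_lessThan)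
qed

lemma busy_cdf_antimono:
  "q \<le> q' \<Longrightarrow> busy_cdf k q' \<le> busy_cdf k q"
proof (induction k arbitrary: q q')
  case 0
  then show ?case by (simp add: busy_cdf_def)
next
  case (Suc k)
  show ?case
  proof (cases q)
    case 0
    then show ?thesis by (simp add: busy_cdf_Suc_0 busy_cdf_le_1)
  next
    case q: (Suc p)
    then obtain p' where q': "q' = Suc p'" "p \<le> p'"
      using Suc.prems by (cases q') auto
    show ?thesis
      unfolding q q' busy_cdf_Suc_Suc
      by (rule expectation_pmf_mono[OF busy_cdf_bounded busy_cdf_bounded]) (simp add: Suc.IH q')
  qed
qed

section \<open>Means and stochastic order of the boarding numbers\<close>

lemma nn_integral_nat_tail:
  "(\<integral>\<^sup>+n. ennreal (real n) \<partial>measure_pmf p) = (\<Sum>k. emeasure (measure_pmf p) {k<..})"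
proof -
  have "(\<integral>\<^sup>+n. ennreal (real n) \<partial>measure_pmf p) = (\<integral>\<^sup>+n. of_nat n \<partial>measure_pmf p)"
    by (simp add: ennreal_of_nat_eq_real_of_nat)
  also have "\<dots> = (\<Sum>k. emeasure (measure_pmf p) {k<..})"
    by (subst nn_integral_nat_function) (auto simp: greaterThan_def)
  finally show ?thesis .
qed

lemma nn_integral_busy_le:
  "(\<integral>\<^sup>+n. ennreal (real n) \<partial>measure_pmf (busy \<alpha> q)) \<le> ennreal (real q / (1 - \<alpha>))"
proof -
  have "(\<Sum>k. emeasure (measure_pmf (busy \<alpha> q)) {k<..}) \<le> ennreal (real q / (1 - \<alpha>))"
    unfolding suminf_eq_SUP
  proof (rule SUP_least)
    fix N
    have "(\<Sum>k<N. emeasure (measure_pmf (busy \<alpha> q)) {k<..}) = ennreal (\<Sum>k<N. 1 - busy_cdf (Suc k) q)"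
      by (simp add: measure_pmf.emeasure_eq_measure prob_busy_tail sum_ennreal busy_cdf_le_1)
    also have "\<dots> \<le> ennreal (real q / (1 - \<alpha>))"
      by (intro ennreal_leI busy_tail_sum)
    finally show "(\<Sum>k<N. emeasure (measure_pmf (busy \<alpha> q)) {k<..}) \<le> ennreal (real q / (1 - \<alpha>))" .
  qed
  then show ?thesis by (simp add: nn_integral_nat_tail)
qed

text \<open>On average \<open>\<alpha> * w\<close> customers arrive in the window, and each accounts
  for at most \<open>1 / (1 - \<alpha>)\<close> boardings in mean, itself included.\<close>

lemma nn_integral_boarding_le:
  assumes "0 \<le> w"
  shows "(\<integral>\<^sup>+n. ennreal (real n) \<partial>measure_pmf (boarding \<alpha> w)) \<le> ennreal (\<alpha> / (1 - \<alpha>) * w)"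
proof -
  have "(\<integral>\<^sup>+n. ennreal (real n) \<partial>measure_pmf (boarding \<alpha> w)) \<le>
      (\<integral>\<^sup>+q. ennreal (1 / (1 - \<alpha>)) * ennreal (real q) \<partial>measure_pmf (pois (\<alpha> * w)))"
    unfolding boarding_def nn_integral_bind_pmf
    by (intro nn_integral_mono order.trans[OF nn_integral_busy_le])
       (use \<alpha> in \<open>simp add: ennreal_mult[symmetric]\<close>)
  also have "\<dots> = ennreal (1 / (1 - \<alpha>)) * ennreal (\<alpha> * w)"
    using \<alpha> assms by (simp add: nn_integral_cmult nn_integral_real_pois)
  also have "\<dots> = ennreal (\<alpha> / (1 - \<alpha>) * w)"
    using \<alpha> assms by (simp add: ennreal_mult[symmetric])
  finally show ?thesis .
qed

text \<open>The additional arrivals of the longer window lengthen the initial queue, and a longer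
  queue empties later.\<close>

lemma boarding_tail_mono:
  assumes "0 \<le> w" "w \<le> w'"
  shows "measure_pmf.prob (boarding \<alpha> w) {k<..} \<le> measure_pmf.prob (boarding \<alpha> w') {k<..}"
proof -
  have split: "pois (\<alpha> * w') = bind_pmf (pois (\<alpha> * w)) (\<lambda>i. map_pmf ((+) i) (pois (\<alpha> * (w' - w))))"
    using pois_add[of "\<alpha> * w" "\<alpha> * (w' - w)"] \<alpha> assms by (simp add: algebra_simps)
  have bd: "\<bar>1 - busy_cdf (Suc k) q\<bar> \<le> 1" for q
    using busy_cdf_nonneg[of "Suc k" q] busy_cdf_le_1[of "Suc k" q] by simp
  have "measure_pmf.expectation (pois (\<alpha> * w)) (\<lambda>q. 1 - busy_cdf (Suc k) q) \<le>
      measure_pmf.expectation (pois (\<alpha> * w)) (\<lambda>i. measure_pmf.expectation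
         (map_pmf ((+) i) (pois (\<alpha> * (w' - w)))) (\<lambda>q. 1 - busy_cdf (Suc k) q))"
  proof (rule expectation_pmf_mono[where C = 1 and D = 1])
    show "\<bar>measure_pmf.expectation (map_pmf ((+) i) (pois (\<alpha> * (w' - w)))) (\<lambda>q. 1 - busy_cdf (Suc k) q)\<bar> \<le> 1" for i
      using expectation_pmf_bounds[of "map_pmf ((+) i) (pois (\<alpha> * (w' - w)))" "\<lambda>q. 1 - busy_cdf (Suc k) q" 1]
        busy_cdf_nonneg busy_cdf_le_1 by simp
    fix i
    have "1 - busy_cdf (Suc k) i = measure_pmf.expectation (pois (\<alpha> * (w' - w))) (\<lambda>_. 1 - busy_cdf (Suc k) i)"
      by simp
    also have "\<dots> \<le> measure_pmf.expectation (pois (\<alpha> * (w' - w))) (\<lambda>j. 1 - busy_cdf (Suc k) (i + j))"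
      by (rule expectation_pmf_mono[where C = 1 and D = 1]) (use bd in \<open>auto intro: busy_cdf_antimono\<close>)
    finally show "1 - busy_cdf (Suc k) i \<le> measure_pmf.expectation
        (map_pmf ((+) i) (pois (\<alpha> * (w' - w)))) (\<lambda>q. 1 - busy_cdf (Suc k) q)"
      by simp
  qed (rule bd)
  also have "\<dots> = measure_pmf.expectation (pois (\<alpha> * w')) (\<lambda>q. 1 - busy_cdf (Suc k) q)"
    unfolding split by (rule expectation_bind_pmf[OF bd, symmetric])
  finally show ?thesis
    unfolding boarding_def prob_bind_pmf prob_busy_tail .
qed

lemma boarding_mono:
  assumes "0 \<le> w" "w \<le> w'" "mono f" "\<And>n. 0 \<le> f n" "\<And>n. f n \<le> (1::real)"
  shows "measure_pmf.expectation (boarding \<alpha> w) f \<le> measure_pmf.expectation (boarding \<alpha> w') f"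
  using assms by (intro expectation_pmf_tail_mono boarding_tail_mono)

text \<open>One way to obtain \<open>n\<close> boardings: \<open>n\<close> arrivals in the window
  and none during the \<open>n\<close> units of boarding. Hence every boarding number has positive
  probability if the window has positive length.\<close>

lemma pmf_boarding_ge:
  assumes "0 \<le> w"
  shows "pmf (boarding \<alpha> w) n \<ge> pmf (pois (\<alpha> * w)) n * exp (- \<alpha>) ^ n"
proof -
  have busy: "exp (- \<alpha>) ^ n \<le> busy_prob \<alpha> n n" for n
  proof (induction n)
    case (Suc n)
    have "exp (- \<alpha>) * exp (- \<alpha>) ^ n \<le> exp (- \<alpha>) * busy_prob \<alpha> n n"
      using Suc by simp
    also have "\<dots> = measure_pmf.expectation (pois \<alpha>) (\<lambda>c. busy_prob \<alpha> n n * indicator {0} c)"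
      using \<alpha> by (simp add: measure_pmf_single pmf_pois)
    also have "\<dots> \<le> measure_pmf.expectation (pois \<alpha>) (\<lambda>c. busy_prob \<alpha> (n + c) n)"
      by (rule expectation_pmf_mono[where C = 1 and D = 1])
         (use busy_prob_bounded busy_prob_nonneg in \<open>auto simp: indicator_def\<close>)
    finally show ?case by (simp add: busy_prob_Suc_Suc)
  qed (simp add: busy_prob_0)
  have "pmf (pois (\<alpha> * w)) n * exp (- \<alpha>) ^ n \<le> pmf (pois (\<alpha> * w)) n * busy_prob \<alpha> n n"
    by (intro mult_left_mono busy) simp
  also have "\<dots> = measure_pmf.expectation (pois (\<alpha> * w)) (\<lambda>q. busy_prob \<alpha> n n * indicator {n} q)"
    by (simp add: measure_pmf_single)
  also have "\<dots> \<le> measure_pmf.expectation (pois (\<alpha> * w)) (\<lambda>q. busy_prob \<alpha> q n)"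
    by (rule expectation_pmf_mono[where C = 1 and D = 1])
       (use busy_prob_bounded busy_prob_nonneg in \<open>auto simp: indicator_def\<close>)
  also have "\<dots> = pmf (boarding \<alpha> w) n"
    by (simp add: boarding_def pmf_bind pmf_busy)
  finally show ?thesis .
qed

lemma pmf_boarding_0_ge: "0 \<le> w \<Longrightarrow> pmf (boarding \<alpha> w) 0 \<ge> exp (- (\<alpha> * w))"
  using pmf_boarding_ge[of w 0] \<alpha> by (simp add: pmf_pois)

lemma pmf_boarding_pos: "0 < w \<Longrightarrow> pmf (boarding \<alpha> w) n > 0"
  using pmf_boarding_ge[of w n] \<alpha>
  by (simp add: pmf_pois) (smt (verit) divide_pos_pos exp_gt_zero fact_gt_zero mult_pos_pos zero_less_power)

lemma boarding_0 [simp]: "boarding \<alpha> 0 = return_pmf 0"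
proof -
  have "pmf (busy \<alpha> 0) n = pmf (return_pmf 0) n" for n
    by (cases n) (auto simp: pmf_busy busy_prob_0)
  then have "busy \<alpha> 0 = return_pmf 0" by (intro pmf_eqI)
  then show ?thesis by (simp add: boarding_def bind_return_pmf)
qed

section \<open>Exponential moments and deviations\<close>

text \<open>The exponential martingale of the queue length at the time the queue empties.\<close>

lemma nn_integral_exp_busy_le:
  fixes \<theta> :: real
  defines "\<beta> \<equiv> \<theta> - \<alpha> * (1 - exp (- \<theta>))"
  shows "(\<integral>\<^sup>+n. ennreal (exp (- \<beta> * real n)) \<partial>measure_pmf (busy \<alpha> q)) \<le> ennreal (exp (- \<theta> * real q))"
proof -
  \<comment> \<open>\<beta> is the exponent for which exp (- \<theta> queue - \<beta> time) is a
    martingale: in one unit of time the queue loses one customer and gains a Poisson number.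
    Truncation at \<open>k\<close> replaces optional stopping by an induction.\<close>
  have part: "(\<Sum>n<k. busy_prob \<alpha> q n * exp (- \<beta> * real n)) \<le> exp (- \<theta> * real q)" for k
  proof (induction k arbitrary: q)
    case (Suc k)
    show ?case
    proof (cases q)
      case 0
      then show ?thesis by (subst sum.lessThan_Suc_shift) (simp add: busy_prob_0)
    next
      case (Suc p)
      have int: "integrable (measure_pmf (pois \<alpha>)) (\<lambda>c. busy_prob \<alpha> (p + c) n)" for n
        by (rule integrable_pmf_bounded[OF busy_prob_bounded])
      have nn: "(\<integral>\<^sup>+c. ennreal (exp (- \<theta> * real (p + c))) \<partial>measure_pmf (pois \<alpha>)) =
          ennreal (exp (- \<theta> * real p) * exp (\<alpha> * (exp (- \<theta>) - 1)))"
      proof -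
        have "(\<integral>\<^sup>+c. ennreal (exp (- \<theta> * real (p + c))) \<partial>measure_pmf (pois \<alpha>)) =
          (\<integral>\<^sup>+c. ennreal (exp (- \<theta> * real p)) * ennreal (exp (- \<theta> * real c)) \<partial>measure_pmf (pois \<alpha>))"
          by (intro nn_integral_cong) (simp add: ennreal_mult[symmetric] exp_add[symmetric] algebra_simps)
        then show ?thesis
          using nn_integral_exp_pois[of \<alpha> "- \<theta>"] \<alpha> by (simp add: nn_integral_cmult ennreal_mult)
      qed
      have int': "integrable (measure_pmf (pois \<alpha>)) (\<lambda>c. exp (- \<theta> * real (p + c)))"
        by (rule integrableI_nonneg) (use nn in auto)
      have "(\<Sum>n<Suc k. busy_prob \<alpha> q n * exp (- \<beta> * real n)) =
          (\<Sum>n<k. exp (- \<beta>) * measure_pmf.expectation (pois \<alpha>) (\<lambda>c. busy_prob \<alpha> (p + c) n * exp (- \<beta> * real n)))"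
      proof -
        have ex: "exp (- (\<beta> * real (Suc n))) = exp (- \<beta>) * exp (- (\<beta> * real n))" for n
          by (simp add: exp_add[symmetric] algebra_simps)
        show ?thesis
          unfolding Suc by (subst sum.lessThan_Suc_shift)
            (simp add: busy_prob_0 busy_prob_Suc_Suc ex mult_ac del: of_nat_Suc)
      qed
      also have "\<dots> = exp (- \<beta>) * measure_pmf.expectation (pois \<alpha>)
          (\<lambda>c. \<Sum>n<k. busy_prob \<alpha> (p + c) n * exp (- \<beta> * real n))"
        unfolding sum_distrib_left[symmetric]
        by (subst Bochner_Integration.integral_sum) (use int in auto)
      also have "\<dots> \<le> exp (- \<beta>) * measure_pmf.expectation (pois \<alpha>) (\<lambda>c. exp (- \<theta> * real (p + c)))"
        by (intro mult_left_mono integral_mono int' Bochner_Integration.integrable_sum Suc.IH)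
           (use int in auto)
      also have "measure_pmf.expectation (pois \<alpha>) (\<lambda>c. exp (- \<theta> * real (p + c))) =
          exp (- \<theta> * real p) * exp (\<alpha> * (exp (- \<theta>) - 1))"
        by (rule integral_eq_nn_integral[THEN trans]) (use nn in auto)
      also have "exp (- \<beta>) * (exp (- \<theta> * real p) * exp (\<alpha> * (exp (- \<theta>) - 1))) = exp (- \<theta> * real q)"
        unfolding exp_add[symmetric] \<beta>_def Suc by (simp add: algebra_simps)
      finally show ?thesis .
    qed
  qed simp
  have "(\<integral>\<^sup>+n. ennreal (exp (- \<beta> * real n)) \<partial>measure_pmf (busy \<alpha> q)) =
      (\<Sum>n. ennreal (busy_prob \<alpha> q n * exp (- \<beta> * real n)))"
    by (simp add: nn_integral_measure_pmf nn_integral_count_space_nat pmf_busy ennreal_mult busy_prob_nonneg)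
  also have "\<dots> \<le> ennreal (exp (- \<theta> * real q))"
    unfolding suminf_eq_SUP
    by (rule SUP_least) (use part in \<open>simp add: sum_ennreal busy_prob_nonneg ennreal_leI\<close>)
  finally show ?thesis .
qed

lemma nn_integral_exp_boarding_le:
  fixes \<theta> :: real
  defines "\<beta> \<equiv> \<theta> - \<alpha> * (1 - exp (- \<theta>))"
  assumes "0 \<le> w"
  shows "(\<integral>\<^sup>+n. ennreal (exp (- \<beta> * real n)) \<partial>measure_pmf (boarding \<alpha> w)) \<le>
    ennreal (exp (- \<alpha> * w * (1 - exp (- \<theta>))))"
proof -
  have "(\<integral>\<^sup>+n. ennreal (exp (- \<beta> * real n)) \<partial>measure_pmf (boarding \<alpha> w)) \<le>
      (\<integral>\<^sup>+q. ennreal (exp (- \<theta> * real q)) \<partial>measure_pmf (pois (\<alpha> * w)))"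
    unfolding boarding_def nn_integral_bind_pmf \<beta>_def
    by (intro nn_integral_mono nn_integral_exp_busy_le)
  also have "\<dots> = ennreal (exp (\<alpha> * w * (exp (- \<theta>) - 1)))"
    using \<alpha> assms by (subst nn_integral_exp_pois) auto
  finally show ?thesis by (simp add: algebra_simps)
qed

text \<open>The Chernoff bound, with the sign of \<open>b\<close> left open: negative values serve
  lower tails and positive ones upper tails.\<close>

lemma prob_exp_bound:
  assumes "(\<integral>\<^sup>+n. ennreal (exp (b * real n)) \<partial>measure_pmf p) \<le> ennreal E"
    and "\<And>n. n \<in> S \<Longrightarrow> b * y \<le> b * real n" "0 \<le> E"
  shows "measure_pmf.prob p S \<le> exp (- b * y) * E"
proof -
  have "emeasure (measure_pmf p) S = (\<integral>\<^sup>+n. indicator S n \<partial>measure_pmf p)"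
    by simp
  also have "\<dots> \<le> (\<integral>\<^sup>+n. ennreal (exp (- b * y)) * ennreal (exp (b * real n)) \<partial>measure_pmf p)"
    by (intro nn_integral_mono)
       (use assms(2) in \<open>auto simp: indicator_def ennreal_mult[symmetric] exp_add[symmetric] ennreal_1[symmetric] simp del: ennreal_1 intro!: ennreal_leI\<close>)
  also have "\<dots> \<le> ennreal (exp (- b * y)) * ennreal E"
    using assms(1) by (simp add: nn_integral_cmult mult_left_mono)
  finally show ?thesis
    using assms(3) by (simp add: measure_pmf.emeasure_eq_measure ennreal_mult[symmetric])
qed

text \<open>A second-order expansion of the exponential moment gives a Gaussian exponent. The
  deviation is measured from \<open>m * w0\<close>, because later on a bound of the window may be
  all that is known.\<close>

lemma boarding_lower_tail:
  fixes m w w0 t :: real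
  defines "m \<equiv> \<alpha> / (1 - \<alpha>)"
  assumes "0 < w0" "w0 \<le> w" "0 \<le> t"
  shows "measure_pmf.prob (boarding \<alpha> w) {n. real n \<le> m * w0 - t} \<le>
    exp (- ((1 - \<alpha>)\<^sup>2 / (2 * m)) * t\<^sup>2 / w0)"
proof (cases "t \<le> m * w0")
  case False
  then have "{n. real n \<le> m * w0 - t} = {}" by (auto simp: not_le)
  then show ?thesis by simp
next
  case True
  have m: "0 < m" "\<alpha> * (m + 1) = m" "(1 - \<alpha>) * m = \<alpha>"
    using \<alpha> by (auto simp: m_def field_simps)
  \<comment> \<open>The minimiser of \<open>- \<theta> * (1 - \<alpha>) * t + \<theta>\<^sup>2 / 2 *
    (m * w0)\<close>, to which the exponent is reduced below.\<close>
  define \<theta> where "\<theta> = (1 - \<alpha>) * t / (m * w0)"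
  define \<beta> where "\<beta> = \<theta> - \<alpha> * (1 - exp (- \<theta>))"
  define y where "y = m * w0 - t"
  have \<theta>: "0 \<le> \<theta>" using \<alpha> assms m by (simp add: \<theta>_def)
  have e1: "1 - exp (- \<theta>) \<le> \<theta>" using exp_ge_add_one_self[of "- \<theta>"] by simp
  have e2: "\<theta> - \<theta>\<^sup>2 / 2 \<le> 1 - exp (- \<theta>)"
  proof -
    have "exp (- \<theta>) \<le> 1 - \<theta> + \<theta>\<^sup>2 / 2"
    proof (cases "\<theta> = 0")
      case False
      then obtain s where "exp (- \<theta>) = (\<Sum>k<3. (- \<theta>) ^ k / fact k) + exp s / fact 3 * (- \<theta>) ^ 3"
        using Maclaurin_exp_lt[of "- \<theta>" 3] by auto
      moreover have "exp s / fact 3 * (- \<theta>) ^ 3 \<le> 0"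
        using \<theta> by (simp add: mult_nonneg_nonpos)
      ultimately show ?thesis by (simp add: eval_nat_numeral)
    qed simp
    then show ?thesis by simp
  qed
  have \<beta>: "0 \<le> \<beta>"
    using mult_mono[of \<alpha> 1 "1 - exp (- \<theta>)" \<theta>] \<alpha> \<theta> e1 by (simp add: \<beta>_def)
  have "measure_pmf.prob (boarding \<alpha> w) {n. real n \<le> y} \<le> exp (- (- \<beta>) * y) * exp (- \<alpha> * w * (1 - exp (- \<theta>)))"
  proof (rule prob_exp_bound)
    show "(\<integral>\<^sup>+n. ennreal (exp (- \<beta> * real n)) \<partial>measure_pmf (boarding \<alpha> w)) \<le>
        ennreal (exp (- \<alpha> * w * (1 - exp (- \<theta>))))"
      unfolding \<beta>_def using nn_integral_exp_boarding_le[of w \<theta>] assms by simp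
  qed (use \<beta> in \<open>auto intro: mult_left_mono\<close>)
  also have "\<dots> = exp (\<beta> * y - \<alpha> * w * (1 - exp (- \<theta>)))"
    by (simp add: exp_add[symmetric])
  also have "\<dots> \<le> exp (- ((1 - \<alpha>)\<^sup>2 / (2 * m)) * t\<^sup>2 / w0)"
  proof -
    have y: "0 \<le> y" using True by (simp add: y_def)
    have "\<beta> * y \<le> (\<theta> * (1 - \<alpha>) + \<alpha> * \<theta>\<^sup>2 / 2) * y"
      using mult_left_mono[OF e2, of \<alpha>] \<alpha> y
      by (intro mult_right_mono) (auto simp: \<beta>_def algebra_simps)
    moreover have "\<alpha> * w0 * (\<theta> - \<theta>\<^sup>2 / 2) \<le> \<alpha> * w0 * (1 - exp (- \<theta>))"
      using e2 \<alpha> assms by (intro mult_left_mono) auto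
    moreover have "\<alpha> * w0 * (1 - exp (- \<theta>)) \<le> \<alpha> * w * (1 - exp (- \<theta>))"
      using \<alpha> assms \<theta> by (intro mult_right_mono) auto
    ultimately have "\<beta> * y - \<alpha> * w * (1 - exp (- \<theta>)) \<le>
        (\<theta> * (1 - \<alpha>) + \<alpha> * \<theta>\<^sup>2 / 2) * y - \<alpha> * w0 * (\<theta> - \<theta>\<^sup>2 / 2)"
      by linarith
    \<comment> \<open>Since \<open>(1 - \<alpha>) * m = \<alpha>\<close>, the terms of first order
      in \<theta> that do not contain \<open>t\<close> cancel: deviations are measured from the
      mean.\<close>
    also have "\<dots> = \<theta> * ((1 - \<alpha>) * m * w0 - \<alpha> * w0) - \<theta> * (1 - \<alpha>) * t + \<theta>\<^sup>2 / 2 * (\<alpha> * (m + 1) * w0) - \<alpha> * \<theta>\<^sup>2 / 2 * t"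
      by (simp add: y_def field_simps)
    also have "\<dots> \<le> - \<theta> * (1 - \<alpha>) * t + \<theta>\<^sup>2 / 2 * (m * w0)"
      using \<alpha> assms m by simp
    also have "\<dots> = - ((1 - \<alpha>)\<^sup>2 / (2 * m)) * t\<^sup>2 / w0"
      using m(1) assms(2) by (simp add: \<theta>_def field_simps power2_eq_square)
    finally show ?thesis by simp
  qed
  finally show ?thesis by (simp add: y_def)
qed

lemma boarding_upper_tail:
  fixes m w w0 t :: real
  defines "m \<equiv> \<alpha> / (1 - \<alpha>)"
  assumes "0 < w0" "0 \<le> w" "w \<le> w0" "0 \<le> t" "t \<le> m * w0"
  shows "measure_pmf.prob (boarding \<alpha> w) {n. m * w0 + t \<le> real n} \<le>
    exp (- ((1 - \<alpha>)\<^sup>2 / (4 * \<alpha> * (2 * m + 1))) * t\<^sup>2 / w0)"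
proof -
  have m: "0 < m" "(1 - \<alpha>) * m = \<alpha>"
    using \<alpha> by (auto simp: m_def field_simps)
  \<comment> \<open>The minimiser of \<open>- \<theta> * (1 - \<alpha>) * t + \<alpha> *
    \<theta>\<^sup>2 * ((2 * m + 1) * w0)\<close>. The hypothesis \<open>t \<le> m * w0\<close>
    keeps it small enough for the quadratic bound of \<open>exp \<theta>\<close> and for the sign of
    \<beta>.\<close>
  define \<theta> where "\<theta> = (1 - \<alpha>) * t / (2 * \<alpha> * (2 * m + 1) * w0)"
  define \<beta> where "\<beta> = - \<theta> - \<alpha> * (1 - exp \<theta>)"
  define y where "y = m * w0 + t"
  have \<theta>: "0 \<le> \<theta>" using \<alpha> assms m by (simp add: \<theta>_def)
  have "\<theta> \<le> (1 - \<alpha>) * (m * w0) / (2 * \<alpha> * (2 * m + 1) * w0)"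
    unfolding \<theta>_def using \<alpha> assms m by (intro divide_right_mono mult_left_mono) auto
  also have "\<dots> = 1 / (2 * (2 * m + 1))"
    using \<alpha> assms(2) m by (simp add: mult.assoc[symmetric])
  finally have \<theta>_le: "\<theta> \<le> 1 / (2 * (2 * m + 1))" .
  have "4 * (\<theta> * m) + 2 * \<theta> \<le> 1" using \<theta>_le m by (simp add: field_simps)
  then have \<theta>1: "\<theta> \<le> 1" "\<theta> * m \<le> 1" using \<theta> m mult_nonneg_nonneg[OF \<theta>, of m] by linarith+
  have e: "exp \<theta> \<le> 1 + \<theta> + \<theta>\<^sup>2" by (rule exp_bound) (use \<theta> \<theta>1 in auto)
  have \<alpha>\<theta>: "\<alpha> * \<theta> \<le> 1 - \<alpha>"
  proof -
    have "\<alpha> * \<theta> = ((1 - \<alpha>) * m) * \<theta>" using m(2) by simp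
    also have "\<dots> = (1 - \<alpha>) * (\<theta> * m)" by simp
    also have "\<dots> \<le> (1 - \<alpha>) * 1" using \<alpha> \<theta>1 by (intro mult_left_mono) auto
    finally show ?thesis by simp
  qed
  have "\<alpha> * (exp \<theta> - 1) \<le> \<alpha> * (\<theta> + \<theta>\<^sup>2)" using e \<alpha> by (intro mult_left_mono) auto
  then have b: "- \<beta> \<ge> \<theta> * (1 - \<alpha>) - \<alpha> * \<theta>\<^sup>2" by (simp add: \<beta>_def algebra_simps)
  have \<beta>: "0 \<le> - \<beta>"
  proof -
    have "0 \<le> \<theta> * (1 - \<alpha> - \<alpha> * \<theta>)" using \<theta> \<alpha>\<theta> by simp
    then show ?thesis using b by (simp add: algebra_simps power2_eq_square)
  qed
  have "measure_pmf.prob (boarding \<alpha> w) {n. y \<le> real n} \<le> exp (- (- \<beta>) * y) * exp (- \<alpha> * w * (1 - exp \<theta>))"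
  proof (rule prob_exp_bound)
    show "(\<integral>\<^sup>+n. ennreal (exp (- \<beta> * real n)) \<partial>measure_pmf (boarding \<alpha> w)) \<le>
        ennreal (exp (- \<alpha> * w * (1 - exp \<theta>)))"
      unfolding \<beta>_def using nn_integral_exp_boarding_le[of w "- \<theta>"] assms by simp
  qed (use \<beta> in \<open>auto intro: mult_left_mono_neg\<close>)
  also have "\<dots> = exp (\<alpha> * w * (exp \<theta> - 1) - (- \<beta>) * y)"
    by (simp add: exp_add[symmetric] algebra_simps)
  also have "\<dots> \<le> exp (- ((1 - \<alpha>)\<^sup>2 / (4 * \<alpha> * (2 * m + 1))) * t\<^sup>2 / w0)"
  proof -
    have y: "0 \<le> y" using assms m by (simp add: y_def)
    have 1: "(\<theta> * (1 - \<alpha>) - \<alpha> * \<theta>\<^sup>2) * y \<le> (- \<beta>) * y"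
      using b y by (rule mult_right_mono)
    have 2: "\<alpha> * w * (exp \<theta> - 1) \<le> \<alpha> * w0 * (\<theta> + \<theta>\<^sup>2)"
      using \<alpha> assms \<theta> e by (intro mult_mono) auto
    have "\<alpha> * \<theta>\<^sup>2 * t \<le> \<alpha> * \<theta>\<^sup>2 * (m * w0)"
      using assms(6) \<alpha> by (intro mult_left_mono) auto
    then have "\<alpha> * w * (exp \<theta> - 1) - (- \<beta>) * y \<le>
        \<alpha> * w0 * (\<theta> + \<theta>\<^sup>2) - (\<theta> * (1 - \<alpha>) * y - \<alpha> * \<theta>\<^sup>2 * (m * w0)) + \<alpha> * \<theta>\<^sup>2 * (m * w0)"
      using 1 2 by (simp add: y_def algebra_simps)
    also have "\<dots> = \<theta> * (\<alpha> * w0 - (1 - \<alpha>) * m * w0) - \<theta> * (1 - \<alpha>) * t + \<alpha> * \<theta>\<^sup>2 * ((2 * m + 1) * w0)"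
      by (simp add: y_def algebra_simps)
    also have "\<dots> = - \<theta> * (1 - \<alpha>) * t + \<alpha> * \<theta>\<^sup>2 * ((2 * m + 1) * w0)"
      using m by simp
    also have "\<dots> = - ((1 - \<alpha>)\<^sup>2 / (4 * \<alpha> * (2 * m + 1))) * t\<^sup>2 / w0"
    proof -
      define Z where "Z = \<alpha> * (2 * m + 1) * w0"
      have Z: "Z \<noteq> 0" using m(1) assms(2) \<alpha>(1) by (simp add: Z_def)
      have th: "\<theta> = (1 - \<alpha>) * t / (2 * Z)" by (simp add: \<theta>_def Z_def algebra_simps)
      have "- \<theta> * (1 - \<alpha>) * t + \<alpha> * \<theta>\<^sup>2 * ((2 * m + 1) * w0) = - \<theta> * (1 - \<alpha>) * t + \<theta>\<^sup>2 * Z"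
        by (simp add: Z_def algebra_simps)
      also have "\<dots> = - ((1 - \<alpha>)\<^sup>2 * t\<^sup>2) / (4 * Z)"
        unfolding th using Z by (simp add: field_simps power2_eq_square)
      finally show ?thesis by (simp add: Z_def field_simps)
    qed
    finally show ?thesis by simp
  qed
  finally show ?thesis by (simp add: y_def)
qed

end


section \<open>Stops as functions of the arrival counts\<close>

definition arrived :: "(nat \<Rightarrow> real) \<Rightarrow> real \<Rightarrow> nat" where
  "arrived x t = card {k. 1 \<le> k \<and> x k \<le> t}"

definition regular_arrivals :: "(nat \<Rightarrow> real) \<Rightarrow> bool" where
  "regular_arrivals x \<longleftrightarrow>
     0 \<le> x 1 \<and> (\<forall>k\<ge>1. x k < x (k + 1)) \<and> filterlim x at_top sequentially"

text \<open>Trades arrival times for counts: the points increase to infinity, so the customers who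
  have arrived by \<open>t\<close> form an initial segment.\<close>

lemma le_arrived_iff:
  assumes "regular_arrivals x" "1 \<le> j"
  shows "x j \<le> t \<longleftrightarrow> j \<le> arrived x t"
proof -
  have mono: "x i < x k" if "1 \<le> i" "i < k" for i k
    using that(2,1)
  proof (induction k rule: less_Suc_induct)
    case (1 i)
    then show ?case using assms(1) by (auto simp: regular_arrivals_def)
  next
    case (2 i j k)
    then show ?case by force
  qed
  have "eventually (\<lambda>k. t < x k) sequentially"
    using assms(1) by (auto simp: regular_arrivals_def filterlim_at_top_dense)
  then obtain n0 where n0: "\<And>k. n0 \<le> k \<Longrightarrow> t < x k"
    by (auto simp: eventually_sequentially)
  define S where "S = {k. 1 \<le> k \<and> x k \<le> t}"
  have "S \<subseteq> {..<n0}"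
    using n0 by (force simp: S_def not_le[symmetric])
  then have fin: "finite S"
    by (rule finite_subset) simp
  have down: "i \<in> S" if "k \<in> S" "1 \<le> i" "i \<le> k" for i k
    using that mono[of i k] by (cases "i = k") (auto simp: S_def)
  have eq: "S = {1..card S}"
  proof (cases "S = {}")
    case False
    then have "Max S \<in> S" using fin by simp
    moreover have "1 \<le> i" if "i \<in> S" for i using that by (simp add: S_def)
    ultimately have "i \<in> S \<longleftrightarrow> i \<in> {1..Max S}" for i
      using down[of "Max S" i] Max_ge[OF fin, of i] by auto
    then have "S = {1..Max S}" by blast
    then show ?thesis by (metis card_atLeastAtMost diff_Suc_1)
  qed simp
  have "j \<in> S \<longleftrightarrow> j \<le> card S"
    using assms(2) by (subst eq) auto
  then show ?thesis using assms(2) by (simp add: S_def arrived_def)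
qed

lemma arrived_mono:
  assumes "regular_arrivals x" "s \<le> t"
  shows "arrived x s \<le> arrived x t"
proof (cases "arrived x s")
  case (Suc n)
  then have "x (Suc n) \<le> s" using le_arrived_iff[OF assms(1), of "Suc n" s] by simp
  then show ?thesis using le_arrived_iff[OF assms(1), of "Suc n" t] assms(2) Suc by simp
qed simp

lemma arrived_diff:
  assumes "regular_arrivals x" "a \<le> b"
  shows "arrived x b = arrived x a + point_count x {a<..b}"
proof -
  have "{k. 1 \<le> k \<and> x k \<in> {a<..b}} = {arrived x a<..arrived x b}"
    using le_arrived_iff[OF assms(1)] by (auto simp: not_le[symmetric])
  then show ?thesis
    using arrived_mono[OF assms] by (simp add: point_count_def)
qed

text \<open>The arrivals after time \<open>a\<close> make exactly \<open>n\<close> customers board a bus arriving at time \<open>s\<close>.\<close>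

definition boards :: "(nat \<Rightarrow> real) \<Rightarrow> real \<Rightarrow> real \<Rightarrow> nat \<Rightarrow> bool" where
  "boards x a s n \<longleftrightarrow>
     (\<forall>k<n. arrived x a + k + 1 \<le> arrived x (s + real k)) \<and> arrived x (s + real n) \<le> arrived x a + n"

lemma boards_unique:
  assumes "boards x a s n" "boards x a s n'"
  shows "n = n'"
proof -
  have "\<not> k < k'" if "boards x a s k" "boards x a s k'" for k k'
    using that unfolding boards_def by force
  then show ?thesis using assms by (metis linorder_neqE_nat)
qed

text \<open>Serves both buses: \<open>a\<close> is the time up to which no arrival is available to
  the bus, be it because of \<open>h\<close> or of an earlier bus. For the second bus it will be the
  maximum of two departure times.\<close>

lemma stop_eq:
  assumes x: "regular_arrivals x"
    and l: "\<And>j. 1 \<le> j \<Longrightarrow> l < j \<and> h < x j \<longleftrightarrow> arrived x a < j"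
    and b: "boards x a s n"
  shows "first_customer x l h = arrived x a + 1"
    and "last_customer x (arrived x a + 1) s = arrived x a + n"
proof -
  have "(LEAST j. l < j \<and> h < x j) = arrived x a + 1"
  proof (rule Least_equality)
    show "l < arrived x a + 1 \<and> h < x (arrived x a + 1)"
      using l[of "arrived x a + 1"] by simp
    show "arrived x a + 1 \<le> j" if "l < j \<and> h < x j" for j
      using that l[of j] by (cases j) auto
  qed
  then show "first_customer x l h = arrived x a + 1"
    by (simp add: first_customer_def)
  have "k \<in> boarding_set x (arrived x a + 1) s \<longleftrightarrow> k < n" for k
  proof
    assume k: "k \<in> boarding_set x (arrived x a + 1) s"
    show "k < n"
    proof (rule ccontr)
      assume "\<not> k < n"
      then have "x (arrived x a + 1 + n) \<le> s + real n"
        using k unfolding boarding_set_def by simp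
      then have "arrived x a + 1 + n \<le> arrived x (s + real n)"
        using le_arrived_iff[OF x, of "arrived x a + 1 + n"] by simp
      then show False using b by (simp add: boards_def)
    qed
  next
    assume k: "k < n"
    have "x (arrived x a + 1 + j) \<le> s + real j" if "j \<le> k" for j
    proof -
      have "arrived x a + j + 1 \<le> arrived x (s + real j)"
        using b that k by (simp add: boards_def)
      then show ?thesis using le_arrived_iff[OF x, of "arrived x a + 1 + j"] by simp
    qed
    then show "k \<in> boarding_set x (arrived x a + 1) s"
      by (simp add: boarding_set_def)
  qed
  then have "boarding_set x (arrived x a + 1) s = {..<n}" by auto
  then show "last_customer x (arrived x a + 1) s = arrived x a + n"
    by (simp add: last_customer_def)
qed

lemma empties_iff:
  "empties q cs \<longleftrightarrow>
    (\<forall>k<length cs. k < q + sum_list (take k cs)) \<and> q + sum_list cs \<le> length cs"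
proof (induction cs arbitrary: q)
  case (Cons c cs)
  have "(\<forall>k<length (c # cs). k < q + sum_list (take k (c # cs))) \<longleftrightarrow>
      0 < q \<and> (\<forall>k<length cs. Suc k < q + c + sum_list (take k cs))"
    by (auto simp: less_Suc_eq_0_disj add.assoc)
  also have "\<dots> \<longleftrightarrow> 0 < q \<and> (\<forall>k<length cs. k < (q - 1 + c) + sum_list (take k cs))"
    by (auto; force)
  finally show ?case
    by (simp add: Cons.IH) (auto; linarith)
qed auto

definition slots :: "real \<Rightarrow> nat \<Rightarrow> real set list" where
  "slots s n = map (\<lambda>k. {s + real k<..s + real (Suc k)}) [0..<n]"

text \<open>Expresses a stop by the counts in pairwise disjoint intervals, whose joint law the
  Poisson process prescribes.\<close>

lemma boards_iff_empties:
  assumes x: "regular_arrivals x" and "a \<le> s"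
  shows "boards x a s n \<longleftrightarrow> empties (point_count x {a<..s}) (map (point_count x) (slots s n))"
proof -
  have *: "arrived x a + (point_count x {a<..s} + sum_list (take k (map (point_count x) (slots s n)))) =
      arrived x (s + real k)" if "k \<le> n" for k
    using that
  proof (induction k)
    case 0
    then show ?case using arrived_diff[OF x \<open>a \<le> s\<close>] by simp
  next
    case (Suc k)
    then show ?case
      using arrived_diff[OF x, of "s + real k" "s + real (Suc k)"]
      by (simp add: take_Suc_conv_app_nth slots_def)
  qed
  have **: "sum_list (map (point_count x) (slots s n)) = sum_list (take n (map (point_count x) (slots s n)))"
    by (simp add: slots_def)
  have len: "length (map (point_count x) (slots s n)) = n" by (simp add: slots_def)
  have eq: "k < point_count x {a<..s} + sum_list (take k (map (point_count x) (slots s n))) \<longleftrightarrow>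
      arrived x a + k + 1 \<le> arrived x (s + real k)" if "k < n" for k
    using *[of k] that by linarith
  show ?thesis
    unfolding empties_iff len boards_def ** using *[of n] eq by auto
qed

lemma boards_late:
  assumes "regular_arrivals x" "s < a"
  shows "boards x a s n \<longleftrightarrow> n = 0"
  using arrived_mono[OF assms(1), of s a] assms(2) by (cases n) (force simp: boards_def)+


section \<open>Histories\<close>

text \<open>A history lists the numbers of customers boarding the two buses, most recent station first.\<close>

type_synonym history = "(nat \<times> nat) list"

locale two_buses =
  fixes \<delta> :: "nat \<Rightarrow> nat" and \<tau> \<mu> \<alpha> :: real
  assumes discipline: "queueing_discipline \<delta>"
    and \<tau>: "0 < \<tau>" and \<mu>: "0 < \<mu>" and \<alpha>: "0 < \<alpha>" "\<alpha> < 1"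
begin

definition time1 :: "history \<Rightarrow> real" where
  "time1 xs = \<tau> * real (length xs) + real (sum_list (map fst xs))"

definition time2 :: "history \<Rightarrow> real" where
  "time2 xs = \<mu> + \<tau> * real (length xs) + real (sum_list (map snd xs))"

text \<open>With \<open>i = Suc (length xs)\<close> for the next station, this is the history up to
  station \<open>i - \<delta> i\<close>, whose departure opens the window.\<close>

definition earlier :: "history \<Rightarrow> history" where
  "earlier xs = drop (\<delta> (Suc (length xs)) - 1) xs"

definition window1 :: "history \<Rightarrow> real" where
  "window1 xs = time1 xs + \<tau> - time1 (earlier xs)"

text \<open>Nobody who has arrived when the first bus leaves this station is available to the second
  one, so its window opens at the later of this departure and its own departure from the earlier
  station.\<close>

definition start2 :: "history \<Rightarrow> nat \<Rightarrow> real" where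
  "start2 xs y = max (time1 xs + \<tau> + real y) (time2 (earlier xs))"

text \<open>Truncated at 0: a bus that arrives before its window opens takes nobody, in accordance
  with \<open>boarding_0\<close>.\<close>

definition window2 :: "history \<Rightarrow> nat \<Rightarrow> real" where
  "window2 xs y = max 0 (time2 xs + \<tau> - start2 xs y)"

definition next_stop :: "history \<Rightarrow> (nat \<times> nat) pmf" where
  "next_stop xs = bind_pmf (boarding \<alpha> (window1 xs)) (\<lambda>y. map_pmf (Pair y) (boarding \<alpha> (window2 xs y)))"

fun path :: "nat \<Rightarrow> history \<Rightarrow> history pmf" where
  "path 0 xs = return_pmf xs"
| "path (Suc n) xs = bind_pmf (next_stop xs) (\<lambda>y. path n (y # xs))"

fun alive :: "history \<Rightarrow> bool" where
  "alive [] \<longleftrightarrow> True"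
| "alive (y # xs) \<longleftrightarrow> time1 (y # xs) < time2 (y # xs) \<and> alive xs"

definition survival :: "nat \<Rightarrow> history \<Rightarrow> real" where
  "survival n xs = measure_pmf.prob (path n xs) {zs. alive zs}"

lemma delta_bounds: "1 \<le> \<delta> (Suc n)" "\<delta> (Suc n) \<le> Suc n"
  using queueing_discipline_bounds[OF discipline, of "Suc n"] by auto

lemma time1_simps [simp]: "time1 [] = 0" "time1 (y # xs) = time1 xs + \<tau> + real (fst y)"
  by (simp_all add: time1_def algebra_simps)

lemma time2_simps [simp]: "time2 [] = \<mu>" "time2 (y # xs) = time2 xs + \<tau> + real (snd y)"
  by (simp_all add: time2_def algebra_simps)

lemma time1_nonneg: "0 \<le> time1 xs"
  using \<tau> by (simp add: time1_def)

lemma time1_drop_le: "time1 (drop k xs) \<le> time1 xs"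
proof (induction xs arbitrary: k)
  case (Cons y xs)
  then show ?case using \<tau> by (cases k) (auto intro: order.trans[OF Cons.IH])
qed simp

lemma time2_drop_le: "time2 (drop k xs) \<le> time2 xs"
proof (induction xs arbitrary: k)
  case (Cons y xs)
  then show ?case using \<tau> by (cases k) (auto intro: order.trans[OF Cons.IH])
qed simp

lemma window1_ge: "\<tau> \<le> window1 xs"
  using time1_drop_le[of _ xs] by (simp add: window1_def earlier_def)

lemma window1_nonneg: "0 \<le> window1 xs"
  using window1_ge[of xs] \<tau> by simp

lemma window2_nonneg [simp]: "0 \<le> window2 xs y"
  by (simp add: window2_def)

lemma window2_le: "window2 xs y \<le> time2 xs + \<tau> - time2 (earlier xs)"
  using time2_drop_le[of "\<delta> (Suc (length xs)) - 1" xs] \<tau>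
  by (simp add: window2_def start2_def earlier_def)

definition matches_stop :: "(nat \<Rightarrow> real) \<Rightarrow> history \<Rightarrow> nat \<times> nat \<Rightarrow> bool" where
  "matches_stop x xs y \<longleftrightarrow>
     boards x (time1 (earlier xs)) (time1 xs + \<tau>) (fst y) \<and>
     boards x (start2 xs (fst y)) (time2 xs + \<tau>) (snd y)"

fun matches :: "(nat \<Rightarrow> nat \<Rightarrow> real) \<Rightarrow> history \<Rightarrow> bool" where
  "matches x [] \<longleftrightarrow> True"
| "matches x (y # xs) \<longleftrightarrow> matches_stop (x (Suc (length xs))) xs y \<and> matches x xs"

lemma matches_unique:
  assumes "matches x xs" "matches x ys" "length xs = length ys"
  shows "xs = ys"
  using assms(3,1,2)
proof (induction xs ys rule: list_induct2)
  case (Cons y xs z ys)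
  then have eq: "xs = ys" by simp
  then have "fst y = fst z" using Cons boards_unique by (auto simp: matches_stop_def)
  moreover from this have "snd y = snd z" using Cons eq boards_unique by (auto simp: matches_stop_def)
  ultimately show ?case using eq by (simp add: prod_eq_iff)
qed simp

text \<open>By induction along the history, \<open>stop_eq\<close> turns counts into the customer
  indices of the recursion. What links the buses is that the last customer of the first bus is the
  last arrival up to its departure.\<close>

lemma matches_departure:
  assumes reg: "\<And>i. 1 \<le> i \<Longrightarrow> regular_arrivals (x i)" and "matches x xs"
  shows "k \<le> length xs \<Longrightarrow> H1 \<delta> \<tau> x (length xs - k) = time1 (drop k xs)"
    and "k \<le> length xs \<Longrightarrow> H2 \<delta> \<tau> \<mu> x (length xs - k) = time2 (drop k xs)"
proof -
  have "(\<forall>k\<le>length xs. H1 \<delta> \<tau> x (length xs - k) = time1 (drop k xs)) \<and>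
        (\<forall>k\<le>length xs. H2 \<delta> \<tau> \<mu> x (length xs - k) = time2 (drop k xs))"
    using assms(2)
  proof (induction xs)
    case Nil
    then show ?case by (simp add: H1_def H2_def)
  next
    case (Cons y xs)
    define n where "n = length xs"
    define z where "z = x (Suc n)"
    have z: "regular_arrivals z" using reg by (simp add: z_def)
    obtain y1 y2 where y: "y = (y1, y2)" by fastforce
    have IH1: "H1 \<delta> \<tau> x (n - k) = time1 (drop k xs)" if "k \<le> n" for k
      using Cons that by (simp add: n_def)
    have IH2: "H2 \<delta> \<tau> \<mu> x (n - k) = time2 (drop k xs)" if "k \<le> n" for k
      using Cons that by (simp add: n_def)
    define b where "b = \<delta> (Suc n) - 1"
    have b: "b \<le> n" "Suc n - \<delta> (Suc n) = n - b" "earlier xs = drop b xs"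
      using delta_bounds[of n] by (auto simp: b_def earlier_def n_def)
    have m: "boards z (time1 (earlier xs)) (time1 xs + \<tau>) y1" "boards z (start2 xs y1) (time2 xs + \<tau>) y2"
      using Cons.prems by (auto simp: matches_stop_def y z_def n_def)
    note le = le_arrived_iff[OF z]
    have l1: "0 < j \<and> time1 (earlier xs) < z j \<longleftrightarrow> arrived z (time1 (earlier xs)) < j" if "1 \<le> j" for j
      using le[OF that, of "time1 (earlier xs)"] that by auto
    note s1 = stop_eq[OF z l1 m(1)]
    have F1: "F1 \<delta> \<tau> x (Suc n) = arrived z (time1 (earlier xs)) + 1"
      unfolding F1_def b(2) IH1[OF b(1)] b(3)[symmetric] z_def[symmetric] by (rule s1(1))
    have M1: "M1 \<delta> \<tau> x (Suc n) = arrived z (time1 (earlier xs)) + y1"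
      unfolding M1_def F1 using s1(2) IH1[of 0] by (simp add: z_def)
    have H1: "H1 \<delta> \<tau> x (Suc n) = time1 xs + \<tau> + real y1"
    proof -
      have "H1 \<delta> \<tau> x (Suc n) = H1 \<delta> \<tau> x n + \<tau> + (real (M1 \<delta> \<tau> x (Suc n)) - real (F1 \<delta> \<tau> x (Suc n)) + 1)"
        unfolding H1_def M1_def F1_def using departure_rec[OF discipline, of "Suc n"] by simp
      then show ?thesis using IH1[of 0] by (simp add: M1 F1)
    qed
    \<comment> \<open>\<open>boards\<close> bounds the arrivals up to the departure from above, as
      the queue is then empty, and from below, as the last boarding customer has arrived.\<close>
    have M1': "M1 \<delta> \<tau> x (Suc n) = arrived z (time1 xs + \<tau> + real y1)"
    proof (rule antisym)
      show "arrived z (time1 xs + \<tau> + real y1) \<le> M1 \<delta> \<tau> x (Suc n)"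
        using m(1) by (simp add: boards_def M1)
      show "M1 \<delta> \<tau> x (Suc n) \<le> arrived z (time1 xs + \<tau> + real y1)"
      proof (cases y1)
        case 0
        then show ?thesis
          using arrived_mono[OF z, of "time1 (earlier xs)" "time1 xs + \<tau>"] time1_drop_le[of b xs] \<tau>
          by (simp add: M1 b)
      next
        case (Suc p)
        then have "arrived z (time1 (earlier xs)) + y1 \<le> arrived z (time1 xs + \<tau> + real p)"
          using m(1) by (simp add: boards_def)
        also have "\<dots> \<le> arrived z (time1 xs + \<tau> + real y1)"
          by (rule arrived_mono[OF z]) (simp add: Suc)
        finally show ?thesis by (simp add: M1)
      qed
    qed
    have l2: "M1 \<delta> \<tau> x (Suc n) < j \<and> time2 (earlier xs) < z j \<longleftrightarrow> arrived z (start2 xs y1) < j" if "1 \<le> j" for j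
      using le[OF that, of "time2 (earlier xs)"] le[OF that, of "time1 xs + \<tau> + real y1"] le[OF that, of "start2 xs y1"]
      by (auto simp: M1' start2_def not_le[symmetric])
    note s2 = stop_eq[OF z l2 m(2)]
    have H2: "H2 \<delta> \<tau> \<mu> x (Suc n) = time2 xs + \<tau> + real y2"
    proof -
      have "H2 \<delta> \<tau> \<mu> x (Suc n) = H2 \<delta> \<tau> \<mu> x n + \<tau> +
         (real (last_customer z (first_customer z (M1 \<delta> \<tau> x (Suc n)) (H2 \<delta> \<tau> \<mu> x (n - b))) (H2 \<delta> \<tau> \<mu> x n + \<tau>)) -
          real (first_customer z (M1 \<delta> \<tau> x (Suc n)) (H2 \<delta> \<tau> \<mu> x (n - b))) + 1)"
        unfolding H2_def z_def b(2)[symmetric] using departure_rec[OF discipline, of "Suc n"] by simp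
      moreover have "H2 \<delta> \<tau> \<mu> x n = time2 xs" using IH2[of 0] by simp
      moreover have "H2 \<delta> \<tau> \<mu> x (n - b) = time2 (earlier xs)" using IH2[OF b(1)] b(3) by simp
      ultimately show ?thesis using s2 by simp
    qed
    show ?case
    proof (intro conjI allI impI)
      fix k assume k: "k \<le> length (y # xs)"
      show "H1 \<delta> \<tau> x (length (y # xs) - k) = time1 (drop k (y # xs))"
        using k IH1 H1 by (cases k) (auto simp: n_def y)
      show "H2 \<delta> \<tau> \<mu> x (length (y # xs) - k) = time2 (drop k (y # xs))"
        using k IH2 H2 by (cases k) (auto simp: n_def y)
    qed
  qed
  then show "k \<le> length xs \<Longrightarrow> H1 \<delta> \<tau> x (length xs - k) = time1 (drop k xs)"
    and "k \<le> length xs \<Longrightarrow> H2 \<delta> \<tau> \<mu> x (length xs - k) = time2 (drop k xs)"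
    by auto
qed

lemma alive_iff: "alive xs \<longleftrightarrow> (\<forall>k\<le>length xs. time1 (drop k xs) < time2 (drop k xs))"
proof (induction xs)
  case Nil
  then show ?case using \<mu> by simp
next
  case (Cons y xs)
  have "(\<forall>k\<le>length (y # xs). time1 (drop k (y # xs)) < time2 (drop k (y # xs))) \<longleftrightarrow>
      time1 (y # xs) < time2 (y # xs) \<and> (\<forall>k\<le>length xs. time1 (drop k xs) < time2 (drop k xs))"
  proof -
    have "(\<forall>k\<le>Suc n. P k) \<longleftrightarrow> P 0 \<and> (\<forall>k\<le>n. P (Suc k))" for n P
      by (auto; case_tac k; auto)
    then show ?thesis by (simp del: time1_simps time2_simps)
  qed
  then show ?case using Cons by simp
qed

lemma matches_alive_iff:
  assumes "\<And>i. 1 \<le> i \<Longrightarrow> regular_arrivals (x i)" "matches x xs"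
  shows "alive xs \<longleftrightarrow> (\<forall>i\<le>length xs. H1 \<delta> \<tau> x i < H2 \<delta> \<tau> \<mu> x i)"
proof -
  have "(\<forall>k\<le>length xs. time1 (drop k xs) < time2 (drop k xs)) \<longleftrightarrow>
      (\<forall>k\<le>length xs. H1 \<delta> \<tau> x (length xs - k) < H2 \<delta> \<tau> \<mu> x (length xs - k))"
    using matches_departure[OF assms] by auto
  also have "\<dots> \<longleftrightarrow> (\<forall>i\<le>length xs. H1 \<delta> \<tau> x i < H2 \<delta> \<tau> \<mu> x i)"
    by (metis diff_diff_cancel diff_le_self)
  finally show ?thesis by (simp add: alive_iff)
qed

end

lemma coalescence_station_gt_iff:
  "enat n < coalescence_station \<delta> \<tau> \<mu> x \<longleftrightarrow> (\<forall>i\<le>n. H1 \<delta> \<tau> x i < H2 \<delta> \<tau> \<mu> x i)"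
proof
  assume *: "enat n < coalescence_station \<delta> \<tau> \<mu> x"
  show "\<forall>i\<le>n. H1 \<delta> \<tau> x i < H2 \<delta> \<tau> \<mu> x i"
  proof (rule ccontr)
    assume "\<not> ?thesis"
    then obtain i where "i \<le> n" "H1 \<delta> \<tau> x i \<ge> H2 \<delta> \<tau> \<mu> x i" by (auto simp: not_less)
    then have "coalescence_station \<delta> \<tau> \<mu> x \<le> enat i"
      unfolding coalescence_station_def by (intro INF_lower) auto
    also have "\<dots> \<le> enat n" using \<open>i \<le> n\<close> by simp
    finally show False using * by simp
  qed
next
  assume *: "\<forall>i\<le>n. H1 \<delta> \<tau> x i < H2 \<delta> \<tau> \<mu> x i"
  have "enat (Suc n) \<le> coalescence_station \<delta> \<tau> \<mu> x"
    unfolding coalescence_station_def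
  proof (rule INF_greatest)
    fix i assume "i \<in> {i. H1 \<delta> \<tau> x i \<ge> H2 \<delta> \<tau> \<mu> x i}"
    then have "\<not> i \<le> n" using * by (auto simp: not_less[symmetric])
    then show "enat (Suc n) \<le> enat i" by simp
  qed
  then show "enat n < coalescence_station \<delta> \<tau> \<mu> x"
    by (rule less_le_trans[rotated]) simp
qed


section \<open>Measurability\<close>

lemma departure_Suc_ge: "departure \<delta> \<tau> h x l i + \<tau> \<le> departure \<delta> \<tau> h x l (Suc i)"
  by (simp add: Let_def last_customer_def)

lemma departure_mono:
  assumes "0 \<le> \<tau>" "i \<le> j"
  shows "departure \<delta> \<tau> h x l i \<le> departure \<delta> \<tau> h x l j"
  using assms(2)
proof (induction j rule: dec_induct)
  case (step j)
  then show ?case using departure_Suc_ge[of \<delta> \<tau> h x l j] assms(1) by linarith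
qed simp

lemma first_customer_cong:
  assumes "\<And>k. 1 \<le> k \<Longrightarrow> x k = x' k"
  shows "first_customer x l h = first_customer x' l h"
  unfolding first_customer_def by (rule arg_cong[where f = Least]) (use assms in fastforce)

lemma boarding_set_less_card:
  assumes "n < card (boarding_set x f s)"
  shows "n \<in> boarding_set x f s"
proof (rule ccontr)
  assume "n \<notin> boarding_set x f s"
  then have "boarding_set x f s \<subseteq> {..<n}"
    by (fastforce simp: boarding_set_def)
  then have "card (boarding_set x f s) \<le> n"
    by (metis card_lessThan card_mono finite_lessThan)
  then show False using assms by simp
qed

text \<open>\<open>x 0\<close> is not an arrival time, but it enters \<^const>\<open>boarding_set\<close> when there is no candidate and
  the least element of the empty set happens to be \<open>0\<close>. Under the present hypotheses the set is
  then empty or infinite, so that its cardinality is \<open>0\<close> in both cases.\<close>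

lemma last_customer_cong:
  assumes x: "\<And>k. 1 \<le> k \<Longrightarrow> x k = x' k"
    and "h \<le> s" and l: "\<And>j. 1 \<le> j \<Longrightarrow> j \<le> l \<Longrightarrow> x j \<le> s + real j"
  shows "last_customer x (first_customer x l h) s = last_customer x' (first_customer x l h) s"
proof (cases "first_customer x l h = 0")
  case False
  then have "boarding_set x (first_customer x l h) s = boarding_set x' (first_customer x l h) s"
    using x by (auto simp: boarding_set_def)
  then show ?thesis by (simp add: last_customer_def)
next
  case True
  have none: "\<not> (l < j \<and> h < x j)" for j
  proof
    assume "l < j \<and> h < x j"
    then have "l < first_customer x l h \<and> h < x (first_customer x l h)"
      unfolding first_customer_def by (rule LeastI)
    then show False using True by simp
  qed
  have le: "x j \<le> s + real j" if "1 \<le> j" for j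
    using l[of j] none[of j] that \<open>h \<le> s\<close> by (cases "j \<le> l") (auto simp: not_le not_less)
  have "card (boarding_set z 0 s) = 0" if z: "\<And>k. 1 \<le> k \<Longrightarrow> x k = z k" for z
  proof (cases "z 0 \<le> s")
    case True
    have "z j \<le> s + real j" for j
      using le[of j] z[of j] True by (cases j) auto
    then have "boarding_set z 0 s = UNIV" by (auto simp: boarding_set_def)
    then show ?thesis by simp
  next
    case False
    then have "boarding_set z 0 s = {}" by (force simp: boarding_set_def)
    then show ?thesis by simp
  qed
  then show ?thesis using x True by (simp add: last_customer_def)
qed

text \<open>Either the customer boards the first bus, which gives the bound of
  \<open>boarding_set\<close>, or he arrived before its window opened. This provides the last
  hypothesis of \<open>last_customer_cong\<close> for the second bus.\<close>

lemma M1_arrival_le: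
  assumes "queueing_discipline \<delta>" "0 \<le> \<tau>" "1 \<le> j" "j \<le> M1 \<delta> \<tau> x (Suc i)"
  shows "x (Suc i) j \<le> H1 \<delta> \<tau> x i + \<tau> + real j"
proof -
  define h where "h = H1 \<delta> \<tau> x (Suc i - \<delta> (Suc i))"
  define f where "f = first_customer (x (Suc i)) 0 h"
  define s where "s = H1 \<delta> \<tau> x i + \<tau>"
  show ?thesis
  proof (cases "h < x (Suc i) j")
    case True
    have f: "0 < f \<and> h < x (Suc i) f" "f \<le> j"
      unfolding f_def first_customer_def
      by (rule LeastI[of _ j], use assms True in simp) (rule Least_le, use assms True in simp)
    have "j \<le> f - 1 + card (boarding_set (x (Suc i)) f s)"
      using assms(4) by (simp add: M1_def F1_def h_def[symmetric] f_def[symmetric] s_def[symmetric] last_customer_def)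
    then have "j - f < card (boarding_set (x (Suc i)) f s)" using f by linarith
    from boarding_set_less_card[OF this] have "x (Suc i) (f + (j - f)) \<le> s + real (j - f)"
      by (simp add: boarding_set_def)
    then show ?thesis using f by (simp add: s_def of_nat_diff)
  next
    case False
    have "h \<le> H1 \<delta> \<tau> x i"
      unfolding h_def H1_def
      by (rule departure_mono) (use assms queueing_discipline_bounds[of \<delta> "Suc i"] in auto)
    then show ?thesis using False assms by (auto simp: not_less)
  qed
qed

lemma
  assumes \<delta>: "queueing_discipline \<delta>" and "0 \<le> \<tau>"
    and x: "\<And>i k. 1 \<le> i \<Longrightarrow> 1 \<le> k \<Longrightarrow> x i k = x' i k"
  shows H1_cong: "H1 \<delta> \<tau> x i = H1 \<delta> \<tau> x' i"
    and M1_cong: "M1 \<delta> \<tau> x (Suc i) = M1 \<delta> \<tau> x' (Suc i)"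
proof -
  have M: "M1 \<delta> \<tau> x (Suc i) = M1 \<delta> \<tau> x' (Suc i) \<and> F1 \<delta> \<tau> x (Suc i) = F1 \<delta> \<tau> x' (Suc i)"
    if H: "\<And>j. j \<le> i \<Longrightarrow> H1 \<delta> \<tau> x j = H1 \<delta> \<tau> x' j" for i
  proof -
    have b: "Suc i - \<delta> (Suc i) \<le> i"
      using queueing_discipline_bounds[OF \<delta>, of "Suc i"] by simp
    define h where "h = H1 \<delta> \<tau> x (Suc i - \<delta> (Suc i))"
    have h': "H1 \<delta> \<tau> x' (Suc i - \<delta> (Suc i)) = h" using H[OF b] by (simp add: h_def)
    have F: "first_customer (x (Suc i)) 0 h = first_customer (x' (Suc i)) 0 h"
      by (rule first_customer_cong) (use x in simp)
    have "h \<le> H1 \<delta> \<tau> x i" unfolding h_def H1_def by (rule departure_mono[OF \<open>0 \<le> \<tau>\<close> b])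
    then have "last_customer (x (Suc i)) (first_customer (x (Suc i)) 0 h) (H1 \<delta> \<tau> x i + \<tau>) =
        last_customer (x' (Suc i)) (first_customer (x (Suc i)) 0 h) (H1 \<delta> \<tau> x i + \<tau>)"
      using \<open>0 \<le> \<tau>\<close> x by (intro last_customer_cong) auto
    then show ?thesis
      using H[of i] F by (simp add: M1_def F1_def h_def[symmetric] h')
  qed
  have all: "\<forall>j\<le>i. H1 \<delta> \<tau> x j = H1 \<delta> \<tau> x' j" for i
  proof (induction i)
    case 0
    then show ?case by (simp add: H1_def)
  next
    case (Suc i)
    have "H1 \<delta> \<tau> z (Suc i) = H1 \<delta> \<tau> z i + \<tau> + (real (M1 \<delta> \<tau> z (Suc i)) - real (F1 \<delta> \<tau> z (Suc i)) + 1)" for z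
      unfolding H1_def M1_def F1_def using departure_rec[OF \<delta>, of "Suc i"] by simp
    then show ?case using Suc M[of i] by (auto simp: le_Suc_eq)
  qed
  show "H1 \<delta> \<tau> x i = H1 \<delta> \<tau> x' i" using all by blast
  show "M1 \<delta> \<tau> x (Suc i) = M1 \<delta> \<tau> x' (Suc i)" using M all by blast
qed

text \<open>The bounds of \<open>M1_arrival_le\<close> refer to the first bus and carry over to the
  second one as long as it is not ahead. This suffices for the event that the buses have not
  coalesced.\<close>

lemma H2_cong:
  assumes \<delta>: "queueing_discipline \<delta>" and "0 \<le> \<tau>"
    and x: "\<And>i k. 1 \<le> i \<Longrightarrow> 1 \<le> k \<Longrightarrow> x i k = x' i k"
    and less: "\<And>j. j < i \<Longrightarrow> H1 \<delta> \<tau> x j \<le> H2 \<delta> \<tau> \<mu> x j"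
  shows "H2 \<delta> \<tau> \<mu> x i = H2 \<delta> \<tau> \<mu> x' i"
  using less
proof (induction i rule: less_induct)
  case (less i)
  show ?case
  proof (cases i)
    case 0
    then show ?thesis by (simp add: H2_def)
  next
    case (Suc n)
    have b: "Suc n - \<delta> (Suc n) \<le> n"
      using queueing_discipline_bounds[OF \<delta>, of "Suc n"] by simp
    have H: "H2 \<delta> \<tau> \<mu> x j = H2 \<delta> \<tau> \<mu> x' j" if "j \<le> n" for j
      using less that Suc by simp
    define h where "h = H2 \<delta> \<tau> \<mu> x (Suc n - \<delta> (Suc n))"
    have h': "H2 \<delta> \<tau> \<mu> x' (Suc n - \<delta> (Suc n)) = h" using H[OF b] by (simp add: h_def)
    define l where "l = M1 \<delta> \<tau> x (Suc n)"
    have l': "M1 \<delta> \<tau> x' (Suc n) = l"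
      using M1_cong[OF \<delta> \<open>0 \<le> \<tau>\<close> x] by (simp add: l_def)
    have F: "first_customer (x (Suc n)) l h = first_customer (x' (Suc n)) l h"
      by (rule first_customer_cong) (use x in simp)
    have "h \<le> H2 \<delta> \<tau> \<mu> x n" unfolding h_def H2_def by (rule departure_mono[OF \<open>0 \<le> \<tau>\<close> b])
    moreover have "x (Suc n) j \<le> H2 \<delta> \<tau> \<mu> x n + \<tau> + real j" if "1 \<le> j" "j \<le> l" for j
      using M1_arrival_le[OF \<delta> \<open>0 \<le> \<tau>\<close>, of j x n] that less.prems[of n] Suc by (simp add: l_def)
    ultimately have "last_customer (x (Suc n)) (first_customer (x (Suc n)) l h) (H2 \<delta> \<tau> \<mu> x n + \<tau>) =
        last_customer (x' (Suc n)) (first_customer (x (Suc n)) l h) (H2 \<delta> \<tau> \<mu> x n + \<tau>)"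
      using \<open>0 \<le> \<tau>\<close> x by (intro last_customer_cong) auto
    moreover have "H2 \<delta> \<tau> \<mu> z (Suc n) = H2 \<delta> \<tau> \<mu> z n + \<tau> +
         (real (last_customer (z (Suc n)) (first_customer (z (Suc n)) (M1 \<delta> \<tau> z (Suc n)) (H2 \<delta> \<tau> \<mu> z (Suc n - \<delta> (Suc n)))) (H2 \<delta> \<tau> \<mu> z n + \<tau>)) -
          real (first_customer (z (Suc n)) (M1 \<delta> \<tau> z (Suc n)) (H2 \<delta> \<tau> \<mu> z (Suc n - \<delta> (Suc n)))) + 1)" for z
      unfolding H2_def using departure_rec[OF \<delta>, of "Suc n"] by simp
    ultimately show ?thesis
      using H[of n] F by (simp add: Suc l' l_def[symmetric] h' h_def[symmetric])
  qed
qed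

lemma not_coalesced_cong:
  assumes "queueing_discipline \<delta>" and "0 \<le> \<tau>"
    and "\<And>i k. 1 \<le> i \<Longrightarrow> 1 \<le> k \<Longrightarrow> x i k = x' i k"
  shows "(\<forall>i\<le>n. H1 \<delta> \<tau> x i < H2 \<delta> \<tau> \<mu> x i) \<longleftrightarrow> (\<forall>i\<le>n. H1 \<delta> \<tau> x' i < H2 \<delta> \<tau> \<mu> x' i)"
proof (induction n)
  case 0
  then show ?case by (simp add: H1_def H2_def)
next
  case (Suc n)
  have eq: "(\<forall>i\<le>Suc n. P i) \<longleftrightarrow> (\<forall>i\<le>n. P i) \<and> P (Suc n)" for P
    by (auto simp: le_Suc_eq)
  have "H2 \<delta> \<tau> \<mu> x (Suc n) = H2 \<delta> \<tau> \<mu> x' (Suc n)" if "\<forall>i\<le>n. H1 \<delta> \<tau> x i < H2 \<delta> \<tau> \<mu> x i"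
    using H2_cong[where x = x and x' = x' and i = "Suc n", OF assms] that by (simp add: less_Suc_eq_le order_less_imp_le)
  then show ?case
    unfolding eq using Suc.IH H1_cong[where x = x and x' = x' and i = "Suc n", OF assms] by auto
qed

section \<open>Measurability of the departure times\<close>

context
  fixes M :: "'a measure"
begin

lemma measurable_first_customer:
  fixes x :: "nat \<Rightarrow> 'a \<Rightarrow> real"
  assumes [measurable]: "\<And>k. x k \<in> borel_measurable M" "l \<in> measurable M (count_space UNIV)"
    "h \<in> borel_measurable M"
  shows "(\<lambda>\<omega>. first_customer (\<lambda>k. x k \<omega>) (l \<omega>) (h \<omega>)) \<in> measurable M (count_space UNIV)"
  unfolding first_customer_def by measurable

lemma measurable_last_customer:
  fixes x :: "nat \<Rightarrow> 'a \<Rightarrow> real"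
  assumes x [measurable]: "\<And>k. x k \<in> borel_measurable M" and f [measurable]: "f \<in> measurable M (count_space UNIV)"
    and [measurable]: "s \<in> borel_measurable M"
  shows "(\<lambda>\<omega>. last_customer (\<lambda>k. x k \<omega>) (f \<omega>) (s \<omega>)) \<in> measurable M (count_space UNIV)"
proof -
  have [measurable]: "(\<lambda>\<omega>. x (f \<omega> + j) \<omega>) \<in> borel_measurable M" for j
    by (rule measurable_compose_countable[where f = "\<lambda>i \<omega>. x (i + j) \<omega>" and g = f]) auto
  have [measurable]: "(\<lambda>\<omega>. card (boarding_set (\<lambda>k. x k \<omega>) (f \<omega>) (s \<omega>))) \<in> measurable M (count_space UNIV)"
    unfolding boarding_set_def by (rule measurable_card) simp
  show ?thesis unfolding last_customer_def by measurable
qed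

lemma measurable_departure:
  fixes x :: "nat \<Rightarrow> nat \<Rightarrow> 'a \<Rightarrow> real"
  assumes x: "\<And>i k. 1 \<le> i \<Longrightarrow> x i k \<in> borel_measurable M"
    and l: "\<And>i. 1 \<le> i \<Longrightarrow> l i \<in> measurable M (count_space UNIV)"
  shows "(\<lambda>\<omega>. departure \<delta> \<tau> h (\<lambda>i k. x i k \<omega>) (\<lambda>i. l i \<omega>) n) \<in> borel_measurable M"
proof (induction n rule: less_induct)
  case (less n)
  show ?case
  proof (cases n)
    case (Suc i)
    have [measurable]: "x (Suc i) k \<in> borel_measurable M" "l (Suc i) \<in> measurable M (count_space UNIV)" for k
      using x l by auto
    have [measurable]: "(\<lambda>\<omega>. departure \<delta> \<tau> h (\<lambda>i k. x i k \<omega>) (\<lambda>i. l i \<omega>) i) \<in> borel_measurable M"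
      "(\<lambda>\<omega>. departure \<delta> \<tau> h (\<lambda>i k. x i k \<omega>) (\<lambda>i. l i \<omega>) (i - (\<delta> (Suc i) - 1))) \<in> borel_measurable M"
      using less Suc by auto
    note [measurable] = measurable_first_customer measurable_last_customer
    show ?thesis unfolding Suc departure.simps Let_def by measurable
  qed simp
qed

lemma pred_not_coalesced:
  assumes \<delta>: "queueing_discipline \<delta>" and "0 \<le> \<tau>"
    and T: "\<And>i k. 1 \<le> i \<Longrightarrow> 1 \<le> k \<Longrightarrow> T i k \<in> borel_measurable M"
  shows "Measurable.pred M (\<lambda>\<omega>. \<forall>i\<le>n. H1 \<delta> \<tau> (\<lambda>i k. T i k \<omega>) i < H2 \<delta> \<tau> \<mu> (\<lambda>i k. T i k \<omega>) i)"
proof -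
  \<comment> \<open>The functions \<open>T i 0\<close> are arbitrary, possibly not measurable; they
    are replaced by 0.\<close>
  define x where "x i k \<omega> = (if k = 0 then 0 else T i k \<omega>)" for i k \<omega>
  have x: "x i k \<in> borel_measurable M" if "1 \<le> i" for i k
    using T[of i k] that by (cases k) (auto simp: x_def[abs_def])
  have [measurable]: "(\<lambda>\<omega>. H1 \<delta> \<tau> (\<lambda>i k. x i k \<omega>) i) \<in> borel_measurable M" for i
    unfolding H1_def using measurable_departure[where x = x and l = "\<lambda>_ _. 0", OF x] by simp
  have M1: "(\<lambda>\<omega>. M1 \<delta> \<tau> (\<lambda>i k. x i k \<omega>) i) \<in> measurable M (count_space UNIV)" if "1 \<le> i" for i
    unfolding M1_def F1_def using x[OF that]
    by (intro measurable_last_customer measurable_first_customer) simp_all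
  have [measurable]: "(\<lambda>\<omega>. H2 \<delta> \<tau> \<mu> (\<lambda>i k. x i k \<omega>) i) \<in> borel_measurable M" for i
    unfolding H2_def using measurable_departure[where x = x, OF x M1] by simp
  have "Measurable.pred M (\<lambda>\<omega>. \<forall>i\<le>n. H1 \<delta> \<tau> (\<lambda>i k. x i k \<omega>) i < H2 \<delta> \<tau> \<mu> (\<lambda>i k. x i k \<omega>) i)"
    by measurable
  also have "(\<lambda>\<omega>. \<forall>i\<le>n. H1 \<delta> \<tau> (\<lambda>i k. x i k \<omega>) i < H2 \<delta> \<tau> \<mu> (\<lambda>i k. x i k \<omega>) i) =
      (\<lambda>\<omega>. \<forall>i\<le>n. H1 \<delta> \<tau> (\<lambda>i k. T i k \<omega>) i < H2 \<delta> \<tau> \<mu> (\<lambda>i k. T i k \<omega>) i)"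
    by (intro ext not_coalesced_cong[OF \<delta> \<open>0 \<le> \<tau>\<close>]) (simp add: x_def)
  finally show ?thesis .
qed

end


section \<open>The law of the histories\<close>

fun list_pmf :: "'a pmf list \<Rightarrow> 'a list pmf" where
  "list_pmf [] = return_pmf []"
| "list_pmf (p # ps) = bind_pmf p (\<lambda>x. map_pmf ((#) x) (list_pmf ps))"

lemma pmf_list_pmf_Nil: "pmf (list_pmf (p # ps)) [] = 0"
  by (auto simp: pmf_eq_0_set_pmf)

lemma pmf_list_pmf_Cons: "pmf (list_pmf (p # ps)) (x # xs) = pmf p x * pmf (list_pmf ps) xs"
proof -
  have "list_pmf (p # ps) = map_pmf (\<lambda>(x, xs). x # xs) (pair_pmf p (list_pmf ps))"
    by (simp add: pair_pmf_def map_bind_pmf map_pmf_def bind_assoc_pmf bind_return_pmf)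
  moreover have "pmf (map_pmf (\<lambda>(x, xs). x # xs) (pair_pmf p (list_pmf ps))) ((\<lambda>(x, xs). x # xs) (x, xs)) =
      pmf (pair_pmf p (list_pmf ps)) (x, xs)"
    by (rule pmf_map_inj') (auto simp: inj_on_def)
  ultimately show ?thesis by (simp add: pmf_pair)
qed

lemma pmf_list_pmf:
  "pmf (list_pmf ps) xs = (if length xs = length ps then \<Prod>i<length ps. pmf (ps ! i) (xs ! i) else 0)"
proof (induction ps arbitrary: xs)
  case Nil
  then show ?case by (auto simp: pmf_return)
next
  case (Cons p ps)
  show ?case
  proof (cases xs)
    case Nil
    then show ?thesis using pmf_list_pmf_Nil[of p ps] by simp
  next
    case (Cons y ys)
    then show ?thesis
      using pmf_list_pmf_Cons[of p ps y ys] Cons.IH[of ys]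
      by (simp add: prod.lessThan_Suc_shift del: prod.lessThan_Suc list_pmf.simps)
  qed
qed

lemma length_list_pmf: "xs \<in> set_pmf (list_pmf ps) \<Longrightarrow> length xs = length ps"
  by (metis pmf_list_pmf set_pmf_iff)

lemma list_pmf_append:
  "list_pmf (ps @ qs) = bind_pmf (list_pmf ps) (\<lambda>xs. map_pmf ((@) xs) (list_pmf qs))"
proof (induction ps)
  case Nil
  have "(@) [] = (id :: 'a list \<Rightarrow> 'a list)" by auto
  then show ?case by (simp add: bind_return_pmf)
next
  case (Cons p ps)
  have "(@) (x # xs) = (\<lambda>ys. x # xs @ ys)" for x :: 'a and xs by auto
  with Cons show ?case
    by (simp add: map_bind_pmf bind_assoc_pmf bind_map_pmf pmf.map_comp o_def)
qed

lemma list_pmf_replicate: "list_pmf (replicate n p) = replicate_pmf n p"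
  by (induction n) (simp_all add: map_pmf_def)

lemma prob_list_pmf_append:
  "measure_pmf.prob (list_pmf (ps @ qs)) {zs. take (length ps) zs \<in> S \<and> drop (length ps) zs \<in> S'} =
    measure_pmf.prob (list_pmf ps) S * measure_pmf.prob (list_pmf qs) S'"
proof -
  have "measure_pmf.prob (list_pmf (ps @ qs)) {zs. take (length ps) zs \<in> S \<and> drop (length ps) zs \<in> S'} =
      measure_pmf.expectation (list_pmf ps) (\<lambda>xs. measure_pmf.prob (list_pmf qs)
        {ys. take (length ps) (xs @ ys) \<in> S \<and> drop (length ps) (xs @ ys) \<in> S'})"
    by (simp add: list_pmf_append prob_bind_pmf vimage_def)
  also have "\<dots> = measure_pmf.expectation (list_pmf ps) (\<lambda>xs. indicator S xs * measure_pmf.prob (list_pmf qs) S')"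
  proof (rule integral_cong_AE)
    show "AE xs in measure_pmf (list_pmf ps). measure_pmf.prob (list_pmf qs)
        {ys. take (length ps) (xs @ ys) \<in> S \<and> drop (length ps) (xs @ ys) \<in> S'} =
        indicator S xs * measure_pmf.prob (list_pmf qs) S'"
      by (auto simp: AE_measure_pmf_iff length_list_pmf indicator_def)
  qed auto
  finally show ?thesis by simp
qed

lemma prob_list_pmf_boarding:
  "measure_pmf.prob (list_pmf (pois (\<alpha> * w) # replicate n (pois \<alpha>))) {zs. zs \<noteq> [] \<and> empties (hd zs) (tl zs)} =
    measure_pmf.expectation (pois (\<alpha> * w)) (\<lambda>q. busy_prob \<alpha> q n)"
  by (simp add: prob_bind_pmf vimage_def busy_prob_def list_pmf_replicate)

section \<open>Joint laws of arrival counts\<close>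

context prob_space
begin

lemma countable_law:
  fixes V :: "'a \<Rightarrow> 'b :: countable"
  assumes "\<And>v. {\<omega> \<in> space M. V \<omega> = v} \<in> sets M" "\<And>v. prob {\<omega> \<in> space M. V \<omega> = v} = pmf p v"
  shows "{\<omega> \<in> space M. V \<omega> \<in> S} \<in> sets M" "prob {\<omega> \<in> space M. V \<omega> \<in> S} = measure_pmf.prob p S"
proof -
  have V: "V \<in> measurable M (count_space UNIV)"
    by (subst measurable_count_space_eq2_countable)
       (use assms(1) in \<open>auto simp: vimage_def Int_def conj_commute\<close>)
  have eq: "distr M (count_space UNIV) V = measure_pmf p"
  proof (rule measure_eqI_countable[where A = UNIV])
    fix v :: 'b
    have "emeasure (distr M (count_space UNIV) V) {v} = emeasure M {\<omega> \<in> space M. V \<omega> = v}"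
      using V by (simp add: emeasure_distr vimage_def Int_def conj_commute)
    then show "emeasure (distr M (count_space UNIV) V) {v} = emeasure (measure_pmf p) {v}"
      using assms(2)[of v] by (simp add: emeasure_eq_measure emeasure_pmf_single)
  qed auto
  have "{\<omega> \<in> space M. V \<omega> \<in> S} = V -` S \<inter> space M" by auto
  then show "{\<omega> \<in> space M. V \<omega> \<in> S} \<in> sets M"
    using measurable_sets[OF V, of S] by simp
  show "prob {\<omega> \<in> space M. V \<omega> \<in> S} = measure_pmf.prob p S"
    unfolding eq[symmetric] using V
    by (simp add: measure_distr vimage_def Int_def conj_commute)
qed

lemma point_counts_law:
  fixes X :: "nat \<Rightarrow> 'a \<Rightarrow> real"
  assumes X: "poisson_point_process M \<alpha> X"
    and B: "\<And>B. B \<in> set Bs \<Longrightarrow> B \<in> sets borel \<and> bounded B \<and> B \<subseteq> {0..}"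
    and disj: "sorted_wrt (\<lambda>A B. A \<inter> B = {}) Bs"
    and "0 \<le> \<alpha>"
  defines "V \<equiv> (\<lambda>\<omega>. map (point_count (\<lambda>k. X k \<omega>)) Bs)"
  shows "{\<omega> \<in> space M. V \<omega> \<in> S} \<in> sets M"
    and "prob {\<omega> \<in> space M. V \<omega> \<in> S} = measure_pmf.prob (list_pmf (map (\<lambda>B. pois (\<alpha> * measure lborel B)) Bs)) S"
proof -
  \<comment> \<open>The independence of a Poisson process is stated for sequences of sets, so the
    list is padded with empty sets.\<close>
  define C where "C j = (if j < length Bs then Bs ! j else {})" for j
  define Y where "Y j \<omega> = point_count (\<lambda>k. X k \<omega>) (C j)" for j \<omega>
  have C: "C j \<in> sets borel \<and> bounded (C j) \<and> C j \<subseteq> {0..}" for j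
    using B by (auto simp: C_def)
  have "disjoint_family C"
    unfolding disjoint_family_on_def
  proof (intro ballI impI)
    fix i j :: nat assume "i \<noteq> j"
    then show "C i \<inter> C j = {}"
      using disj by (cases i j rule: linorder_cases) (auto simp: C_def sorted_wrt_iff_nth_less)
  qed
  then have ind: "indep_vars (\<lambda>_. count_space UNIV) Y UNIV"
    using X C unfolding poisson_point_process_def Y_def by blast
  then have meas: "Y j \<in> measurable M (count_space UNIV)" for j
    by (simp add: indep_vars_def)
  have law: "prob {\<omega> \<in> space M. Y j \<omega> = n} = pmf (pois (\<alpha> * measure lborel (C j))) n" for j n
    using X C[of j] \<open>0 \<le> \<alpha>\<close> unfolding poisson_point_process_def Y_def
    by (simp add: pmf_pois)
  have V: "V \<omega> = v \<longleftrightarrow> length v = length Bs \<and> (\<forall>j<length Bs. Y j \<omega> = v ! j)" for \<omega> v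
    by (auto simp: V_def list_eq_iff_nth_eq Y_def C_def)
  have mv: "{\<omega> \<in> space M. V \<omega> = v} \<in> sets M" for v
  proof -
    note [measurable] = meas
    show ?thesis unfolding V by measurable
  qed
  have pv: "prob {\<omega> \<in> space M. V \<omega> = v} = pmf (list_pmf (map (\<lambda>B. pois (\<alpha> * measure lborel B)) Bs)) v" for v
  proof (cases "length v = length Bs")
    case True
    have "prob {\<omega> \<in> space M. V \<omega> = v} = (\<Prod>j<length Bs. prob {\<omega> \<in> space M. Y j \<omega> = v ! j})"
    proof (cases "Bs = []")
      case True
      then show ?thesis using \<open>length v = length Bs\<close> by (simp add: V prob_space)
    next
      case False
      have "{\<omega> \<in> space M. V \<omega> = v} = (\<Inter>j\<in>{..<length Bs}. Y j -` {v ! j} \<inter> space M)"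
        using False True by (auto simp: V)
      also have "prob \<dots> = (\<Prod>j<length Bs. prob (Y j -` {v ! j} \<inter> space M))"
        by (rule indep_varsD[OF ind]) (use False in auto)
      finally show ?thesis by (simp add: vimage_def Int_def conj_commute)
    qed
    also have "\<dots> = (\<Prod>j<length Bs. pmf (pois (\<alpha> * measure lborel (Bs ! j))) (v ! j))"
      unfolding law by (rule prod.cong) (auto simp: C_def)
    finally show ?thesis using True by (simp add: pmf_list_pmf)
  next
    case False
    then show ?thesis by (simp add: V pmf_list_pmf)
  qed
  show "{\<omega> \<in> space M. V \<omega> \<in> S} \<in> sets M"
    and "prob {\<omega> \<in> space M. V \<omega> \<in> S} = measure_pmf.prob (list_pmf (map (\<lambda>B. pois (\<alpha> * measure lborel B)) Bs)) S"
    using countable_law[OF mv pv] by auto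
qed

end

lemma slots_props:
  assumes "0 \<le> s"
  shows "B \<in> set (slots s n) \<Longrightarrow> B \<in> sets borel \<and> bounded B \<and> B \<subseteq> {s<..s + real n}"
    and "sorted_wrt (\<lambda>A B. A \<inter> B = {}) (slots s n)"
    and "map (\<lambda>B. pois (\<alpha> * measure lborel B)) (slots s n) = replicate n (pois \<alpha>)"
    and "length (slots s n) = n"
proof -
  show "sorted_wrt (\<lambda>A B. A \<inter> B = {}) (slots s n)"
    unfolding slots_def sorted_wrt_map
    by (rule sorted_wrt_mono_rel[OF _ sorted_wrt_upt]) (auto simp: not_le)
  show "map (\<lambda>B. pois (\<alpha> * measure lborel B)) (slots s n) = replicate n (pois \<alpha>)"
    by (rule nth_equalityI) (auto simp: slots_def)
  show "B \<in> set (slots s n) \<Longrightarrow> B \<in> sets borel \<and> bounded B \<and> B \<subseteq> {s<..s + real n}"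
  proof -
    assume "B \<in> set (slots s n)"
    then obtain k where "k < n" "B = {s + real k<..s + real (Suc k)}"
      by (auto simp: slots_def)
    then show ?thesis by auto
  qed
qed (simp add: slots_def)

text \<open>The independence of the stations concerns the arrival sequences restricted to positive
  indices.\<close>

lemma boards_restrict:
  "boards (\<lambda>k\<in>{Suc 0..}. x k) a s n \<longleftrightarrow> boards x a s n"
proof -
  have "arrived (\<lambda>k\<in>{Suc 0..}. x k) t = arrived x t" for t
    unfolding arrived_def by (rule arg_cong[where f = card]) auto
  then show ?thesis by (simp add: boards_def)
qed

lemma pred_boards:
  fixes a s :: real
  shows "Measurable.pred (\<Pi>\<^sub>M k\<in>{1..}. borel) (\<lambda>x. boards x a s n)"
proof -
  have "Measurable.pred (\<Pi>\<^sub>M k\<in>{1..}. borel) (\<lambda>x. 1 \<le> k \<and> x k \<le> t)" for k :: nat and t :: real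
  proof (cases "1 \<le> k")
    case True
    then have [measurable]: "(\<lambda>x. x k) \<in> borel_measurable (\<Pi>\<^sub>M k\<in>{1..}. (borel :: real measure))"
      by (intro measurable_component_singleton) auto
    show ?thesis by measurable
  qed simp
  then have [measurable]: "(\<lambda>x. arrived x t) \<in> measurable (\<Pi>\<^sub>M k\<in>{1..}. borel) (count_space UNIV)" for t :: real
    unfolding arrived_def by (intro measurable_card) simp
  show ?thesis unfolding boards_def by measurable
qed

lemma (in prob_space) AE_regular_arrivals:
  assumes "poisson_point_process M \<alpha> X"
  shows "AE \<omega> in M. regular_arrivals (\<lambda>k. X k \<omega>)"
  using assms unfolding poisson_point_process_def regular_arrivals_def by simp

text \<open>By \<open>s1 + real n1 \<le> a2\<close>, the intervals which decide the second stop lie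
  after those of the first one, so all counts are independent and the probability factors. The event
  agrees with one about counts only for regular arrivals; its measurability is therefore a
  hypothesis.\<close>

lemma (in prob_space) prob_boards:
  fixes X :: "nat \<Rightarrow> 'a \<Rightarrow> real"
  assumes \<alpha>: "0 < \<alpha>" "\<alpha> < 1" and X: "poisson_point_process M \<alpha> X"
    and t: "0 \<le> a1" "a1 \<le> s1" "s1 + real n1 \<le> a2"
    and sets: "{\<omega> \<in> space M. boards (\<lambda>k. X k \<omega>) a1 s1 n1 \<and> boards (\<lambda>k. X k \<omega>) a2 s2 n2} \<in> sets M"
  shows "prob {\<omega> \<in> space M. boards (\<lambda>k. X k \<omega>) a1 s1 n1 \<and> boards (\<lambda>k. X k \<omega>) a2 s2 n2} =
    pmf (boarding \<alpha> (s1 - a1)) n1 * pmf (boarding \<alpha> (max 0 (s2 - a2))) n2"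
proof -
  define E where "E = {zs :: nat list. zs \<noteq> [] \<and> empties (hd zs) (tl zs)}"
  define Bs1 where "Bs1 = {a1<..s1} # slots s1 n1"
  have s1: "0 \<le> s1" using t by simp
  note sl1 = slots_props[OF s1, where n = n1]
  have p1: "map (\<lambda>B. pois (\<alpha> * measure lborel B)) Bs1 = pois (\<alpha> * (s1 - a1)) # replicate n1 (pois \<alpha>)"
    using t by (simp add: Bs1_def sl1)
  have B1: "B \<in> sets borel \<and> bounded B \<and> B \<subseteq> {a1<..s1 + real n1}" if "B \<in> set Bs1" for B
    using that sl1(1)[of B] t by (fastforce simp: Bs1_def)
  have d1: "sorted_wrt (\<lambda>A B. A \<inter> B = {}) Bs1"
    using sl1 by (fastforce simp: Bs1_def)
  have q: "measure_pmf.prob (list_pmf (pois (\<alpha> * w) # replicate n (pois \<alpha>))) E = pmf (boarding \<alpha> w) n" for w n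
    unfolding E_def prob_list_pmf_boarding by (simp add: boarding_def pmf_bind pmf_busy[OF \<alpha>])
  note reg = AE_regular_arrivals[OF X]
  show ?thesis
  proof (cases "a2 \<le> s2")
    case True
    define Bs2 where "Bs2 = {a2<..s2} # slots s2 n2"
    have s2: "0 \<le> s2" using t True by simp
    note sl2 = slots_props[OF s2, where n = n2]
    have p2: "map (\<lambda>B. pois (\<alpha> * measure lborel B)) Bs2 = pois (\<alpha> * (s2 - a2)) # replicate n2 (pois \<alpha>)"
      using True by (simp add: Bs2_def sl2)
    have B2: "B \<in> sets borel \<and> bounded B \<and> B \<subseteq> {a2<..s2 + real n2}" if "B \<in> set Bs2" for B
      using that sl2(1)[of B] True by (fastforce simp: Bs2_def)
    have d2: "sorted_wrt (\<lambda>A B. A \<inter> B = {}) Bs2"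
      using sl2 by (fastforce simp: Bs2_def)
    have d: "sorted_wrt (\<lambda>A B. A \<inter> B = {}) (Bs1 @ Bs2)"
      unfolding sorted_wrt_append
    proof (intro conjI ballI d1 d2)
      fix A B assume "A \<in> set Bs1" "B \<in> set Bs2"
      then have "A \<subseteq> {..a2}" "B \<subseteq> {a2<..}" using B1[of A] B2[of B] t by auto
      then show "A \<inter> B = {}" by force
    qed
    have B: "B \<in> sets borel \<and> bounded B \<and> B \<subseteq> {0..}" if "B \<in> set (Bs1 @ Bs2)" for B
    proof -
      have "B \<subseteq> {0..}" using that B1[of B] B2[of B] t by fastforce
      then show ?thesis using that B1[of B] B2[of B] by auto
    qed
    define S where "S = {zs. take (length Bs1) zs \<in> E \<and> drop (length Bs1) zs \<in> E}"
    have iff: "boards x a1 s1 n1 \<and> boards x a2 s2 n2 \<longleftrightarrow> map (point_count x) (Bs1 @ Bs2) \<in> S"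
      if "regular_arrivals x" for x
      using that t True by (simp add: boards_iff_empties S_def E_def Bs1_def Bs2_def)
    note law = point_counts_law[OF X B d, of S]
    have "prob {\<omega> \<in> space M. boards (\<lambda>k. X k \<omega>) a1 s1 n1 \<and> boards (\<lambda>k. X k \<omega>) a2 s2 n2} =
        prob {\<omega> \<in> space M. map (point_count (\<lambda>k. X k \<omega>)) (Bs1 @ Bs2) \<in> S}"
    proof (rule finite_measure_eq_AE)
      show "AE \<omega> in M. (\<omega> \<in> {\<omega> \<in> space M. boards (\<lambda>k. X k \<omega>) a1 s1 n1 \<and> boards (\<lambda>k. X k \<omega>) a2 s2 n2}) =
          (\<omega> \<in> {\<omega> \<in> space M. map (point_count (\<lambda>k. X k \<omega>)) (Bs1 @ Bs2) \<in> S})"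
        using reg by eventually_elim (simp add: iff)
    qed (use law \<alpha> sets in auto)
    also have "\<dots> = measure_pmf.prob (list_pmf (map (\<lambda>B. pois (\<alpha> * measure lborel B)) (Bs1 @ Bs2))) S"
      using law \<alpha> by simp
    also have "\<dots> = measure_pmf.prob (list_pmf (map (\<lambda>B. pois (\<alpha> * measure lborel B)) Bs1)) E *
        measure_pmf.prob (list_pmf (map (\<lambda>B. pois (\<alpha> * measure lborel B)) Bs2)) E"
      unfolding S_def map_append
      using prob_list_pmf_append[of "map (\<lambda>B. pois (\<alpha> * measure lborel B)) Bs1"] by simp
    finally show ?thesis unfolding p1 p2 q using True by simp
  next
    case False
    \<comment> \<open>The second bus arrives before its window opens, so the condition on it reads
      \<open>n2 = 0\<close>.\<close>
    define S where "S = (if n2 = 0 then E else {})"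
    have B: "B \<in> sets borel \<and> bounded B \<and> B \<subseteq> {0..}" if "B \<in> set Bs1" for B
      using that B1[of B] t by fastforce
    have iff: "boards x a1 s1 n1 \<and> boards x a2 s2 n2 \<longleftrightarrow> map (point_count x) Bs1 \<in> S"
      if "regular_arrivals x" for x
      using that t False by (simp add: boards_iff_empties boards_late S_def E_def Bs1_def)
    note law = point_counts_law[OF X B d1, of S]
    have "prob {\<omega> \<in> space M. boards (\<lambda>k. X k \<omega>) a1 s1 n1 \<and> boards (\<lambda>k. X k \<omega>) a2 s2 n2} =
        prob {\<omega> \<in> space M. map (point_count (\<lambda>k. X k \<omega>)) Bs1 \<in> S}"
    proof (rule finite_measure_eq_AE)
      show "AE \<omega> in M. (\<omega> \<in> {\<omega> \<in> space M. boards (\<lambda>k. X k \<omega>) a1 s1 n1 \<and> boards (\<lambda>k. X k \<omega>) a2 s2 n2}) =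
          (\<omega> \<in> {\<omega> \<in> space M. map (point_count (\<lambda>k. X k \<omega>)) Bs1 \<in> S})"
        using reg by eventually_elim (simp add: iff)
    qed (use law \<alpha> sets in auto)
    also have "\<dots> = measure_pmf.prob (list_pmf (map (\<lambda>B. pois (\<alpha> * measure lborel B)) Bs1)) S"
      using law \<alpha> by simp
    also have "\<dots> = pmf (boarding \<alpha> (s1 - a1)) n1 * pmf (return_pmf 0) n2"
      unfolding p1 S_def using q by (simp add: pmf_return)
    also have "return_pmf 0 = boarding \<alpha> (max 0 (s2 - a2))"
      using False boarding_0[OF \<alpha>] by simp
    finally show ?thesis .
  qed
qed

section \<open>The chain of histories as the law of the buses\<close>

context two_buses
begin

text \<open>\<open>path\<close> unfolds the first stop, as suits the Markov property; the weight of
  a given history requires the last stop to be unfolded.\<close>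

lemma path_Suc_snoc:
  "path (Suc n) xs = bind_pmf (path n xs) (\<lambda>zs. map_pmf (\<lambda>y. y # zs) (next_stop zs))"
proof (induction n arbitrary: xs)
  case 0
  then show ?case by (simp add: bind_return_pmf map_pmf_def)
next
  case (Suc n)
  have "path (Suc (Suc n)) xs = bind_pmf (next_stop xs) (\<lambda>y. path (Suc n) (y # xs))"
    by (rule path.simps(2))
  also have "\<dots> = bind_pmf (next_stop xs) (\<lambda>y. bind_pmf (path n (y # xs)) (\<lambda>zs. map_pmf (\<lambda>y. y # zs) (next_stop zs)))"
    by (simp only: Suc.IH)
  also have "\<dots> = bind_pmf (path (Suc n) xs) (\<lambda>zs. map_pmf (\<lambda>y. y # zs) (next_stop zs))"
    by (simp add: bind_assoc_pmf)
  finally show ?case .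
qed

lemma pmf_next_stop:
  "pmf (next_stop xs) y = pmf (boarding \<alpha> (window1 xs)) (fst y) * pmf (boarding \<alpha> (window2 xs (fst y))) (snd y)"
proof -
  have "pmf (map_pmf (Pair y1) (boarding \<alpha> (window2 xs y1))) y =
      pmf (boarding \<alpha> (window2 xs (fst y))) (snd y) * indicator {fst y} y1" for y1
  proof (cases "y1 = fst y")
    case True
    then have "Pair y1 -` {y} = {snd y}" by auto
    then show ?thesis using True by (simp add: pmf_map measure_pmf_single)
  next
    case False
    then have "Pair y1 -` {y} = {}" by auto
    then show ?thesis using False by (simp add: pmf_map)
  qed
  then show ?thesis
    by (simp add: next_stop_def pmf_bind measure_pmf_single)
qed

lemma pmf_path_Cons: "pmf (path (Suc n) zs) (y # xs) = pmf (path n zs) xs * pmf (next_stop xs) y"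
proof -
  have "pmf (map_pmf (\<lambda>y. y # ys) (next_stop ys)) (y # xs) = pmf (next_stop xs) y * indicator {xs} ys" for ys
  proof (cases "ys = xs")
    case True
    then have "(\<lambda>y. y # ys) -` {y # xs} = {y}" by auto
    then show ?thesis using True by (simp add: pmf_map measure_pmf_single)
  next
    case False
    then have "(\<lambda>y. y # ys) -` {y # xs} = {}" by auto
    then show ?thesis using False by (simp add: pmf_map)
  qed
  then show ?thesis
    unfolding path_Suc_snoc pmf_bind by (simp add: measure_pmf_single)
qed

lemma length_path: "zs \<in> set_pmf (path n xs) \<Longrightarrow> length zs = length xs + n"
  by (induction n arbitrary: xs) fastforce+

text \<open>Isolates what \<open>matches\<close> demands of the arrivals at station
  \<open>i\<close>, so that independence of the stations applies. Histories start with the most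
  recent station, hence the index \<open>length xs - i\<close>.\<close>

definition matches_at :: "history \<Rightarrow> nat \<Rightarrow> (nat \<Rightarrow> real) \<Rightarrow> bool" where
  "matches_at xs i x \<longleftrightarrow> matches_stop x (drop (Suc (length xs - i)) xs) (xs ! (length xs - i))"

lemma matches_at_Cons: "i \<le> length xs \<Longrightarrow> matches_at (y # xs) i = matches_at xs i"
  by (simp add: matches_at_def fun_eq_iff Suc_diff_le)

lemma matches_at_Cons_Suc: "matches_at (y # xs) (Suc (length xs)) x \<longleftrightarrow> matches_stop x xs y"
  by (simp add: matches_at_def)

lemma matches_iff: "matches x xs \<longleftrightarrow> (\<forall>i\<in>{1..length xs}. matches_at xs i (x i))"
proof (induction xs)
  case (Cons y xs)
  have "{1..length (y # xs)} = insert (Suc (length xs)) {1..length xs}" by auto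
  then show ?case
    using Cons by (simp add: matches_at_Cons matches_at_Cons_Suc)
qed simp

lemma pred_matches_stop: "Measurable.pred (\<Pi>\<^sub>M k\<in>{1..}. borel) (\<lambda>x. matches_stop x xs y)"
  unfolding matches_stop_def by (intro pred_intros_logic pred_boards)

lemma matches_stop_restrict: "matches_stop (\<lambda>k\<in>{Suc 0..}. x k) xs y \<longleftrightarrow> matches_stop x xs y"
  by (simp add: matches_stop_def boards_restrict)

end

locale two_buses_prob = two_buses \<delta> \<tau> \<mu> \<alpha> + prob_space M
  for \<delta> \<tau> \<mu> \<alpha> and M :: "'a measure" +
  fixes T :: "nat \<Rightarrow> nat \<Rightarrow> 'a \<Rightarrow> real"
  assumes arr: "arrivals M \<alpha> T"
begin

lemma poisson: "1 \<le> i \<Longrightarrow> poisson_point_process M \<alpha> (T i)"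
  using arr by (simp add: arrivals_def)

lemma indep: "indep_vars (\<lambda>_. \<Pi>\<^sub>M k\<in>{1..}. borel) (\<lambda>i \<omega>. \<lambda>k\<in>{1..}. T i k \<omega>) {1..}"
  using arr by (simp add: arrivals_def)

lemma T_measurable: "1 \<le> i \<Longrightarrow> 1 \<le> k \<Longrightarrow> T i k \<in> borel_measurable M"
  using poisson[of i] by (simp add: poisson_point_process_def)

lemma sets_matches_stop:
  assumes "1 \<le> i"
  shows "{\<omega> \<in> space M. matches_stop (\<lambda>k. T i k \<omega>) xs y} \<in> sets M"
proof -
  have "(\<lambda>\<omega>. \<lambda>k\<in>{1..}. T i k \<omega>) \<in> measurable M (\<Pi>\<^sub>M k\<in>{1..}. borel)"
    using indep assms by (auto simp: indep_vars_def)
  from measurable_compose[OF this pred_matches_stop, of xs y]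
  show ?thesis by (simp add: matches_stop_restrict pred_def)
qed

lemma prob_matches_stop:
  assumes "1 \<le> i"
  shows "prob {\<omega> \<in> space M. matches_stop (\<lambda>k. T i k \<omega>) xs y} = pmf (next_stop xs) y"
proof -
  have "0 \<le> time1 (earlier xs)" by (rule time1_nonneg)
  moreover have "time1 (earlier xs) \<le> time1 xs + \<tau>"
    using window1_nonneg[of xs] by (simp add: window1_def)
  moreover have "time1 xs + \<tau> + real (fst y) \<le> start2 xs (fst y)"
    by (simp add: start2_def)
  ultimately show ?thesis
    using prob_boards[OF \<alpha> poisson[OF assms], of "time1 (earlier xs)" "time1 xs + \<tau>" "fst y" "start2 xs (fst y)" "time2 xs + \<tau>" "snd y"]
      sets_matches_stop[OF assms, of xs y]
    unfolding matches_stop_def pmf_next_stop window1_def window2_def by simp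
qed

lemma sets_matches: "{\<omega> \<in> space M. matches (\<lambda>i k. T i k \<omega>) xs} \<in> sets M"
proof (induction xs)
  case (Cons y xs)
  have "{\<omega> \<in> space M. matches (\<lambda>i k. T i k \<omega>) (y # xs)} =
      {\<omega> \<in> space M. matches_stop (\<lambda>k. T (Suc (length xs)) k \<omega>) xs y} \<inter>
      {\<omega> \<in> space M. matches (\<lambda>i k. T i k \<omega>) xs}"
    by auto
  then show ?case using Cons sets_matches_stop[of "Suc (length xs)" xs y] by auto
qed simp

text \<open>The history being fixed, the condition at each station involves constants and the
  arrivals at this station only. Independence turns the probability into a product, which is also
  how \<open>path\<close> assigns its weights.\<close>

lemma prob_matches:
  "prob {\<omega> \<in> space M. matches (\<lambda>i k. T i k \<omega>) xs} = pmf (path (length xs) []) xs"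
proof -
  define P where "P xs = (\<Prod>i\<in>{1..length xs}. prob {\<omega> \<in> space M. matches_at xs i (\<lambda>k. T i k \<omega>)})" for xs
  have "prob {\<omega> \<in> space M. matches (\<lambda>i k. T i k \<omega>) xs} = P xs"
  proof (cases "xs = []")
    case True
    then show ?thesis by (simp add: P_def prob_space)
  next
    case False
    define A where "A i = {x \<in> space (\<Pi>\<^sub>M k\<in>{1..}. (borel :: real measure)). matches_at xs i x}" for i
    have A: "A i \<in> sets (\<Pi>\<^sub>M k\<in>{1..}. borel)" for i
      unfolding A_def matches_at_def using pred_matches_stop by (simp add: pred_def)
    have pre: "(\<lambda>\<omega>. \<lambda>k\<in>{1..}. T i k \<omega>) -` A i \<inter> space M = {\<omega> \<in> space M. matches_at xs i (\<lambda>k. T i k \<omega>)}" for i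
      by (auto simp: A_def matches_at_def matches_stop_restrict space_PiM)
    have "{\<omega> \<in> space M. matches (\<lambda>i k. T i k \<omega>) xs} =
        (\<Inter>i\<in>{1..length xs}. (\<lambda>\<omega>. \<lambda>k\<in>{1..}. T i k \<omega>) -` A i \<inter> space M)"
    proof -
      have "Suc 0 \<in> {Suc 0..length xs}" using False by (simp add: Suc_le_eq)
      then show ?thesis unfolding pre by (auto simp: matches_iff)
    qed
    also have "prob \<dots> = (\<Prod>i\<in>{1..length xs}. prob ((\<lambda>\<omega>. \<lambda>k\<in>{1..}. T i k \<omega>) -` A i \<inter> space M))"
      by (rule indep_varsD[OF indep]) (use False A in \<open>auto simp: Suc_le_eq\<close>)
    finally show ?thesis unfolding pre P_def .
  qed
  also have "P xs = pmf (path (length xs) []) xs"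
  proof (induction xs)
    case Nil
    then show ?case by (simp add: P_def)
  next
    case (Cons y xs)
    have "P (y # xs) = P xs * prob {\<omega> \<in> space M. matches_stop (\<lambda>k. T (Suc (length xs)) k \<omega>) xs y}"
    proof -
      have "(\<Prod>i\<in>{1..length xs}. prob {\<omega> \<in> space M. matches_at (y # xs) i (\<lambda>k. T i k \<omega>)}) = P xs"
        unfolding P_def by (rule prod.cong) (auto simp: matches_at_Cons)
      then show ?thesis
        unfolding P_def[of "y # xs"] by (simp add: matches_at_Cons_Suc)
    qed
    also have "\<dots> = pmf (path (length (y # xs)) []) (y # xs)"
      using Cons prob_matches_stop[of "Suc (length xs)" xs y] pmf_path_Cons[of "length xs" "[]" y xs]
      by (simp del: path.simps)
    finally show ?case .
  qed
  finally show ?thesis .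
qed

lemma sets_not_coalesced:
  "{\<omega> \<in> space M. \<forall>i\<le>n. H1 \<delta> \<tau> (\<lambda>i k. T i k \<omega>) i < H2 \<delta> \<tau> \<mu> (\<lambda>i k. T i k \<omega>) i} \<in> sets M"
proof -
  have "Measurable.pred M (\<lambda>\<omega>. \<forall>i\<le>n. H1 \<delta> \<tau> (\<lambda>i k. T i k \<omega>) i < H2 \<delta> \<tau> \<mu> (\<lambda>i k. T i k \<omega>) i)"
    by (rule pred_not_coalesced) (use discipline \<tau> T_measurable in auto)
  then show ?thesis unfolding pred_def .
qed

text \<open>The matching events of the countably many histories of length \<open>n\<close> are
  disjoint and have the weights of \<open>path\<close>, so probabilities can be summed over
  histories.\<close>

lemma prob_not_coalesced:
  "prob {\<omega> \<in> space M. \<forall>i\<le>n. H1 \<delta> \<tau> (\<lambda>i k. T i k \<omega>) i < H2 \<delta> \<tau> \<mu> (\<lambda>i k. T i k \<omega>) i} = survival n []"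
proof -
  define U where "U S = (\<Union>xs\<in>S \<inter> {xs. length xs = n}. {\<omega> \<in> space M. matches (\<lambda>i k. T i k \<omega>) xs})" for S
  have U: "prob (U S) = measure_pmf.prob (path n []) S" "U S \<in> sets M" for S
  proof -
    have ct: "countable (S \<inter> {xs. length xs = n})" by simp
    have disj: "disjoint_family_on (\<lambda>xs. {\<omega> \<in> space M. matches (\<lambda>i k. T i k \<omega>) xs}) (S \<inter> {xs. length xs = n})"
      by (auto simp: disjoint_family_on_def dest: matches_unique)
    have "emeasure M (U S) = (\<integral>\<^sup>+xs. emeasure M {\<omega> \<in> space M. matches (\<lambda>i k. T i k \<omega>) xs}
        \<partial>count_space (S \<inter> {xs. length xs = n}))"
      unfolding U_def using sets_matches ct disj by (intro emeasure_UN_countable) auto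
    also have "\<dots> = (\<integral>\<^sup>+xs. ennreal (pmf (path n []) xs) \<partial>count_space (S \<inter> {xs. length xs = n}))"
      by (rule nn_integral_cong) (auto simp: emeasure_eq_measure prob_matches)
    also have "\<dots> = emeasure (measure_pmf (path n [])) (S \<inter> {xs. length xs = n})"
      by (rule nn_integral_pmf)
    also have "\<dots> = emeasure (measure_pmf (path n [])) S"
      by (rule emeasure_eq_AE) (auto simp: AE_measure_pmf_iff length_path)
    finally show "prob (U S) = measure_pmf.prob (path n []) S"
      by (simp add: emeasure_eq_measure measure_pmf.emeasure_eq_measure)
    show "U S \<in> sets M"
      unfolding U_def using sets_matches ct by (intro sets.countable_UN') auto
  qed
  \<comment> \<open>As the weights of \<open>path\<close> add up to 1, almost every outcome has a
    matching history. That the boarding sets are almost surely finite is obtained in this way, not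
    path by path.\<close>
  have full: "AE \<omega> in M. \<omega> \<in> U UNIV"
    using U[of UNIV] by (simp add: AE_in_set_eq_1 measure_pmf.prob_space[simplified])
  have reg: "AE \<omega> in M. \<forall>i\<in>{1..}. regular_arrivals (\<lambda>k. T i k \<omega>)"
    by (subst AE_ball_countable) (use AE_regular_arrivals poisson in \<open>force+\<close>)
  have "prob {\<omega> \<in> space M. \<forall>i\<le>n. H1 \<delta> \<tau> (\<lambda>i k. T i k \<omega>) i < H2 \<delta> \<tau> \<mu> (\<lambda>i k. T i k \<omega>) i} = prob (U {xs. alive xs})"
  proof (rule finite_measure_eq_AE)
    show "AE \<omega> in M. (\<omega> \<in> {\<omega> \<in> space M. \<forall>i\<le>n. H1 \<delta> \<tau> (\<lambda>i k. T i k \<omega>) i < H2 \<delta> \<tau> \<mu> (\<lambda>i k. T i k \<omega>) i}) =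
        (\<omega> \<in> U {xs. alive xs})"
      using full reg
    proof eventually_elim
      case (elim \<omega>)
      then obtain xs where xs: "length xs = n" "matches (\<lambda>i k. T i k \<omega>) xs" "\<omega> \<in> space M"
        by (auto simp: U_def)
      have "alive xs \<longleftrightarrow> (\<forall>i\<le>n. H1 \<delta> \<tau> (\<lambda>i k. T i k \<omega>) i < H2 \<delta> \<tau> \<mu> (\<lambda>i k. T i k \<omega>) i)"
        using matches_alive_iff[of "\<lambda>i k. T i k \<omega>" xs] elim xs by simp
      moreover have "\<omega> \<in> U {xs. alive xs} \<longleftrightarrow> alive xs"
        using xs matches_unique by (auto simp: U_def)
      ultimately show ?case using xs by simp
    qed
    show "{\<omega> \<in> space M. \<forall>i\<le>n. H1 \<delta> \<tau> (\<lambda>i k. T i k \<omega>) i < H2 \<delta> \<tau> \<mu> (\<lambda>i k. T i k \<omega>) i} \<in> sets M"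
      by (rule sets_not_coalesced)
  qed (rule U)
  then show ?thesis by (simp add: U survival_def)
qed

lemma coalescence_prob:
  assumes lim: "(\<lambda>n. survival n []) \<longlonglongrightarrow> p" and N: "\<And>\<omega>. N \<omega> = coalescence_station \<delta> \<tau> \<mu> (\<lambda>i k. T i k \<omega>)"
  shows "prob {\<omega> \<in> space M. N \<omega> = \<infinity>} = p" "prob {\<omega> \<in> space M. N \<omega> < \<infinity>} = 1 - p"
proof -
  define A where "A n = {\<omega> \<in> space M. \<forall>i\<le>n. H1 \<delta> \<tau> (\<lambda>i k. T i k \<omega>) i < H2 \<delta> \<tau> \<mu> (\<lambda>i k. T i k \<omega>) i}" for n
  have A: "A n \<in> sets M" for n
    unfolding A_def by (rule sets_not_coalesced)
  have "N \<omega> = \<infinity> \<longleftrightarrow> (\<forall>n. enat n < N \<omega>)" for \<omega>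
    by (cases "N \<omega>") auto
  then have eq: "{\<omega> \<in> space M. N \<omega> = \<infinity>} = (\<Inter>n. A n)"
    by (auto simp: A_def N coalescence_station_gt_iff)
  have "(\<lambda>n. prob (A n)) \<longlonglongrightarrow> prob (\<Inter>n. A n)"
  proof (rule finite_Lim_measure_decseq)
    show "range A \<subseteq> sets M" using A by blast
    show "decseq A" unfolding decseq_def
    proof (intro allI impI subsetI)
      fix k n \<omega> assume "k \<le> n" "\<omega> \<in> A n"
      then show "\<omega> \<in> A k" unfolding A_def using order_trans by blast
    qed
  qed
  moreover have "prob (A n) = survival n []" for n
    unfolding A_def by (rule prob_not_coalesced)
  ultimately show p: "prob {\<omega> \<in> space M. N \<omega> = \<infinity>} = p"
    using lim LIMSEQ_unique unfolding eq by simp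
  have "{\<omega> \<in> space M. N \<omega> < \<infinity>} = space M - {\<omega> \<in> space M. N \<omega> = \<infinity>}"
    by (auto simp: less_top[symmetric] top_enat_def)
  moreover have "{\<omega> \<in> space M. N \<omega> = \<infinity>} \<in> sets M"
    unfolding eq using A by auto
  ultimately show "prob {\<omega> \<in> space M. N \<omega> < \<infinity>} = 1 - p"
    using prob_compl p by simp
qed

end


section \<open>Survival probabilities\<close>

lemma expectation_pair_pmf:
  fixes f :: "'b \<times> 'c \<Rightarrow> real"
  assumes "\<And>z. \<bar>f z\<bar> \<le> C"
  shows "measure_pmf.expectation (pair_pmf p q) f =
    measure_pmf.expectation p (\<lambda>x. measure_pmf.expectation q (\<lambda>y. f (x, y)))"
proof -
  have "pair_pmf p q = bind_pmf p (\<lambda>x. map_pmf (Pair x) q)"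
    by (simp add: pair_pmf_def map_pmf_def)
  then show ?thesis by (simp add: expectation_bind_pmf[where f = f, OF assms])
qed

lemma expectation_pair_pmf_swap:
  "measure_pmf.expectation (pair_pmf p q) (f :: _ \<Rightarrow> real) =
    measure_pmf.expectation (pair_pmf q p) (\<lambda>(y, x). f (x, y))"
  by (subst pair_commute_pmf) (simp add: case_prod_beta')

lemma expectation_pair_pmf_mult:
  fixes f g :: "_ \<Rightarrow> real"
  assumes "\<And>x. \<bar>f x\<bar> \<le> 1" "\<And>y. \<bar>g y\<bar> \<le> 1"
  shows "measure_pmf.expectation (pair_pmf p q) (\<lambda>(x, y). f x * g y) =
    measure_pmf.expectation p f * measure_pmf.expectation q g"
proof -
  have "\<bar>case z of (x, y) \<Rightarrow> f x * g y\<bar> \<le> 1" for z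
    using mult_mono[OF assms(1)[of "fst z"] assms(2)[of "snd z"]] by (auto simp: abs_mult split: prod.split)
  from expectation_pair_pmf[where f = "\<lambda>(x, y). f x * g y", OF this] show ?thesis by simp
qed

lemma expectation_pmf_tendsto:
  fixes f :: "nat \<Rightarrow> 'b \<Rightarrow> real"
  assumes "\<And>n y. \<bar>f n y\<bar> \<le> C" "\<And>y. (\<lambda>n. f n y) \<longlonglongrightarrow> g y"
  shows "(\<lambda>n. measure_pmf.expectation p (f n)) \<longlonglongrightarrow> measure_pmf.expectation p g"
  by (rule integral_dominated_convergence[where w = "\<lambda>_. C"]) (use assms in auto)

lemma pmf_times_le_expectation:
  fixes f :: "'b \<Rightarrow> real"
  assumes "\<And>y. 0 \<le> f y" "\<And>y. f y \<le> C"
  shows "pmf p y * f y \<le> measure_pmf.expectation p f"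
proof -
  have "pmf p y * f y = measure_pmf.expectation p (\<lambda>z. f y * indicator {y} z)"
    by (simp add: measure_pmf_single)
  also have "\<dots> \<le> measure_pmf.expectation p f"
  proof (rule expectation_pmf_mono)
    show "\<bar>f y * indicator {y} z\<bar> \<le> C" for z
      using assms(1)[of y] assms(2)[of y] by (auto simp: indicator_def)
    show "\<bar>f z\<bar> \<le> C" for z using assms[of z] by simp
  qed (use assms in \<open>auto simp: indicator_def\<close>)
  finally show ?thesis .
qed

section \<open>Chains with killing\<close>

text \<open>The probability that a Markov chain with killing, represented by \<open>None\<close>, makes \<open>n\<close> steps.\<close>

fun stay :: "('s \<Rightarrow> 's option pmf) \<Rightarrow> nat \<Rightarrow> 's \<Rightarrow> real" where
  "stay K 0 s = 1"
| "stay K (Suc n) s = measure_pmf.expectation (K s) (case_option 0 (stay K n))"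

definition stay_forever :: "('s \<Rightarrow> 's option pmf) \<Rightarrow> 's \<Rightarrow> real" where
  "stay_forever K s = lim (\<lambda>n. stay K n s)"

lemma stay_bounds: "0 \<le> stay K n s \<and> stay K n s \<le> 1"
proof (induction n arbitrary: s)
  case (Suc n)
  show ?case unfolding stay.simps
    by (rule expectation_pmf_bounds) (use Suc in \<open>auto split: option.split\<close>)
qed simp

lemma stay_nonneg [simp]: "0 \<le> stay K n s" and stay_le_1 [simp]: "stay K n s \<le> 1"
  by (simp_all add: stay_bounds)

lemma stay_option_bounded: "\<bar>case_option 0 (stay K n) z\<bar> \<le> 1"
  by (auto split: option.split)

lemma stay_Suc_le: "stay K (Suc n) s \<le> stay K n s"
proof (induction n arbitrary: s)
  case 0
  then show ?case using stay_bounds[of K "Suc 0" s] by simp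
next
  case (Suc n)
  have "measure_pmf.expectation (K s) (case_option 0 (stay K (Suc n))) \<le>
      measure_pmf.expectation (K s) (case_option 0 (stay K n))"
    by (rule expectation_pmf_mono[OF stay_option_bounded stay_option_bounded])
       (use Suc in \<open>auto split: option.split simp del: stay.simps\<close>)
  then show ?case by simp
qed

lemma stay_tendsto: "(\<lambda>n. stay K n s) \<longlonglongrightarrow> stay_forever K s"
proof -
  have "decseq (\<lambda>n. stay K n s)" using stay_Suc_le by (intro decseq_SucI)
  then obtain L where "(\<lambda>n. stay K n s) \<longlonglongrightarrow> L"
    using decseq_convergent[of "\<lambda>n. stay K n s" 0] stay_bounds by metis
  then show ?thesis unfolding stay_forever_def by (simp add: limI)
qed

lemma stay_forever_le: "stay_forever K s \<le> stay K n s"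
proof -
  have "decseq (\<lambda>n. stay K n s)" using stay_Suc_le by (intro decseq_SucI)
  then show ?thesis by (rule decseq_ge[OF _ stay_tendsto])
qed

lemma stay_forever_nonneg [simp]: "0 \<le> stay_forever K s"
  by (rule LIMSEQ_le_const[OF stay_tendsto]) auto

lemma stay_forever_le_1 [simp]: "stay_forever K s \<le> 1"
  using stay_forever_le[of K s 0] by simp

lemma stay_forever_option_bounded: "\<bar>case_option 0 (stay_forever K) z\<bar> \<le> 1"
  by (auto split: option.split)

lemma stay_forever_eq:
  "stay_forever K s = measure_pmf.expectation (K s) (case_option 0 (stay_forever K))"
proof -
  have "(\<lambda>n. measure_pmf.expectation (K s) (case_option 0 (stay K n))) \<longlonglongrightarrow>
      measure_pmf.expectation (K s) (case_option 0 (stay_forever K))"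
    by (rule expectation_pmf_tendsto[OF stay_option_bounded])
       (auto split: option.split intro: stay_tendsto)
  moreover have "(\<lambda>n. measure_pmf.expectation (K s) (case_option 0 (stay K n))) \<longlonglongrightarrow> stay_forever K s"
    using LIMSEQ_Suc[OF stay_tendsto[of K s]] by simp
  ultimately show ?thesis using LIMSEQ_unique by blast
qed

text \<open>Zero-one law: if \<open>c\<close> bounds the probability \<open>f\<close> of never being killed, the Markov property gives
  \<open>f \<le> c f\<close>.\<close>

lemma stay_forever_zero:
  assumes closed: "\<And>z z'. z \<in> Z \<Longrightarrow> Some z' \<in> set_pmf (K z) \<Longrightarrow> z' \<in> Z"
    and c: "0 \<le> c" "c < 1" and le: "\<And>z. z \<in> Z \<Longrightarrow> stay_forever K z \<le> c" and s: "s \<in> Z"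
  shows "stay_forever K s = 0"
proof -
  have "stay_forever K z \<le> c * stay K n z" if "z \<in> Z" for n z
    using that
  proof (induction n arbitrary: z)
    case (Suc n)
    have "stay_forever K z = measure_pmf.expectation (K z) (case_option 0 (stay_forever K))"
      by (rule stay_forever_eq)
    also have "\<dots> \<le> measure_pmf.expectation (K z) (\<lambda>z'. c * case_option 0 (stay K n) z')"
    proof (rule expectation_pmf_mono[OF stay_forever_option_bounded])
      show "\<bar>c * case_option 0 (stay K n) z'\<bar> \<le> 1" for z'
        using mult_mono[of "\<bar>c\<bar>" 1 "\<bar>case_option 0 (stay K n) z'\<bar>" 1] c stay_option_bounded[of K n z']
        by (simp add: abs_mult)
      show "case_option 0 (stay_forever K) y \<le> c * case_option 0 (stay K n) y" if "y \<in> set_pmf (K z)" for y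
        using that Suc.IH closed[OF Suc.prems] by (auto split: option.split)
    qed
    also have "\<dots> = c * stay K (Suc n) z" by simp
    finally show ?case .
  qed (use le in simp)
  then have "stay_forever K s \<le> c * stay_forever K s"
    using s by (intro LIMSEQ_le_const[OF tendsto_mult_left[OF stay_tendsto]]) auto
  then have "stay_forever K s * (1 - c) \<le> 0" by (simp add: algebra_simps)
  then show ?thesis
    using c stay_forever_nonneg[of K s] by (simp add: mult_le_0_iff)
qed

context
  fixes \<alpha> :: real
  assumes \<alpha>: "0 < \<alpha>" "\<alpha> < 1"
begin

lemma expectation_boarding_le:
  assumes "0 \<le> w"
  shows "integrable (measure_pmf (boarding \<alpha> w)) real"
    and "measure_pmf.expectation (boarding \<alpha> w) real \<le> \<alpha> / (1 - \<alpha>) * w"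
proof -
  note le = nn_integral_boarding_le[OF \<alpha> assms]
  show int: "integrable (measure_pmf (boarding \<alpha> w)) real"
    by (rule integrableI_nonneg) (use le in \<open>auto intro: order.strict_trans1[OF le]\<close>)
  have "ennreal (measure_pmf.expectation (boarding \<alpha> w) real) \<le> ennreal (\<alpha> / (1 - \<alpha>) * w)"
    using le int by (simp add: nn_integral_eq_integral)
  then show "measure_pmf.expectation (boarding \<alpha> w) real \<le> \<alpha> / (1 - \<alpha>) * w"
    using assms \<alpha> by (simp add: ennreal_le_iff)
qed

end

section \<open>Survival of the two buses\<close>

context two_buses
begin

lemma survival_bounds: "0 \<le> survival n xs \<and> survival n xs \<le> 1"
  by (simp add: survival_def)

lemma survival_bounded: "\<bar>survival n xs\<bar> \<le> 1"
  using survival_bounds[of n xs] by simp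

lemma survival_0: "survival 0 xs = of_bool (alive xs)"
  by (simp add: survival_def)

lemma survival_Suc: "survival (Suc n) xs = measure_pmf.expectation (next_stop xs) (\<lambda>y. survival n (y # xs))"
  by (simp add: survival_def prob_bind_pmf)

lemma expectation_next_stop:
  assumes "\<And>y. \<bar>f y\<bar> \<le> (C :: real)"
  shows "measure_pmf.expectation (next_stop xs) f =
    measure_pmf.expectation (boarding \<alpha> (window1 xs)) (\<lambda>y1.
      measure_pmf.expectation (boarding \<alpha> (window2 xs y1)) (\<lambda>y2. f (y1, y2)))"
  unfolding next_stop_def by (simp add: expectation_bind_pmf[where f = f, OF assms])

lemma survival_not_alive: "\<not> alive xs \<Longrightarrow> survival n xs = 0"
proof (induction n arbitrary: xs)
  case (Suc n)
  then have "survival n (y # xs) = 0" for y by simp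
  then show ?case by (simp add: survival_Suc)
qed (simp add: survival_0)

lemma survival_add: "survival (k + n) xs = measure_pmf.expectation (path k xs) (survival n)"
proof (induction k arbitrary: xs)
  case (Suc k)
  then show ?case
    by (simp add: survival_Suc expectation_bind_pmf[OF survival_bounded])
qed simp

lemma survival_Suc_le: "survival (Suc n) xs \<le> survival n xs"
proof (induction n arbitrary: xs)
  case 0
  then show ?case
    using survival_bounds[of "Suc 0" xs] survival_not_alive[of xs "Suc 0"] by (auto simp: survival_0)
next
  case (Suc n)
  show ?case unfolding survival_Suc[of _ xs]
    by (rule expectation_pmf_mono[OF survival_bounded survival_bounded]) (rule Suc)
qed

lemma survival_decseq: "decseq (\<lambda>n. survival n xs)"
  using survival_Suc_le by (intro decseq_SucI)

lemma time1_drop_diff: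
  "k \<le> length xs \<Longrightarrow> time1 xs - time1 (drop k xs) = \<tau> * real k + real (sum_list (take k (map fst xs)))"
proof (induction xs arbitrary: k)
  case (Cons y xs)
  then show ?case by (cases k) (auto simp: algebra_simps)
qed simp

lemma time2_drop_diff:
  "k \<le> length xs \<Longrightarrow> time2 xs - time2 (drop k xs) = \<tau> * real k + real (sum_list (take k (map snd xs)))"
proof (induction xs arbitrary: k)
  case (Cons y xs)
  then show ?case by (cases k) (auto simp: algebra_simps)
qed simp


section \<open>The subcritical case\<close>

text \<open>Here the second bus is compared with an independent copy of the first one: its windows can
  only become shorter through the first bus. \<open>hs\<close> lists the boarding numbers of one bus.\<close>

definition full_window :: "nat \<Rightarrow> nat list \<Rightarrow> real" where
  "full_window d hs = \<tau> * real d + real (sum_list (take (d - 1) hs))"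

text \<open>In the states below, \<open>u\<close> is the distance of the two buses.\<close>

definition independent_buses ::
  "nat \<Rightarrow> ereal \<Rightarrow> nat list \<times> nat list \<times> real \<Rightarrow> (nat list \<times> nat list \<times> real) option pmf" where
  "independent_buses d C = (\<lambda>(hs, ks, u).
     map_pmf (\<lambda>(y, z). let u' = u + real z - real y in
         if 0 < u' \<and> ereal u' < C then Some (y # hs, z # ks, u') else None)
       (pair_pmf (boarding \<alpha> (full_window d hs)) (boarding \<alpha> (full_window d ks))))"

text \<open>The probability of the idle state after \<open>t\<close> further stops. In this state
  the window has length \<open>\<tau> * d\<close> whatever the past; lists shorter than
  \<open>d - 1\<close> do not count as idle.\<close>

fun idle :: "nat \<Rightarrow> nat \<Rightarrow> nat list \<Rightarrow> real" where
  "idle d 0 hs = of_bool (take (d - 1) hs = replicate (d - 1) 0)"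
| "idle d (Suc t) hs = measure_pmf.expectation (boarding \<alpha> (full_window d hs)) (\<lambda>y. idle d t (y # hs))"

section \<open>Return to the idle state\<close>

lemma full_window_pos: "0 < d \<Longrightarrow> 0 < full_window d hs"
  using \<tau> by (simp add: full_window_def add_pos_nonneg)

lemma idle_bounds: "0 \<le> idle d t hs \<and> idle d t hs \<le> 1"
proof (induction t arbitrary: hs)
  case (Suc t)
  show ?case unfolding idle.simps
    by (rule expectation_pmf_bounds) (use Suc in auto)
qed simp

lemma idle_bounded: "\<bar>idle d t hs\<bar> \<le> 1"
  using idle_bounds[of d t hs] by simp

text \<open>Each boarding number is weighted by the number of coming windows that contain it. Hence
  one stop subtracts exactly the content of the present window, see
  \<open>potential_Cons\<close>.\<close>

definition potential :: "nat \<Rightarrow> nat list \<Rightarrow> real" where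
  "potential d hs = (\<Sum>j=1..d - 1. real (sum_list (take j hs)))"

lemma potential_nonneg: "0 \<le> potential d hs"
  by (simp add: potential_def sum_nonneg)

lemma sum_list_take_mono: "i \<le> j \<Longrightarrow> sum_list (take i hs) \<le> sum_list (take j (hs :: nat list))"
proof -
  assume "i \<le> j"
  then have "take j hs = take i hs @ take (j - i) (drop i hs)"
    by (metis le_add_diff_inverse take_add)
  then show ?thesis by simp
qed

context
  fixes d :: nat
  assumes d: "2 \<le> d"
begin

lemma full_window_le_potential: "full_window d hs \<le> \<tau> * real d + potential d hs"
proof -
  have "real (sum_list (take (d - 1) hs)) \<le> (\<Sum>j=1..d - 1. real (sum_list (take j hs)))"
    by (rule member_le_sum[where i = "d - 1" and f = "\<lambda>j. real (sum_list (take j hs))"]) (use d in auto)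
  then show ?thesis by (simp add: full_window_def potential_def)
qed

lemma potential_Cons:
  "potential d (y # hs) = real (d - 1) * real y + potential d hs - real (sum_list (take (d - 1) hs))"
proof -
  obtain e where e: "d - 1 = Suc e" using d by (cases "d - 1") auto
  have "potential d (y # hs) = (\<Sum>j=0..e. real (sum_list (take (Suc j) (y # hs))))"
    unfolding potential_def e by (simp only: One_nat_def sum.shift_bounds_cl_Suc_ivl)
  also have "\<dots> = real (Suc e) * real y + (\<Sum>j=0..e. real (sum_list (take j hs)))"
    by (simp add: sum.distrib)
  also have "(\<Sum>j=0..e. real (sum_list (take j hs))) = (\<Sum>j=1..Suc e. real (sum_list (take j hs))) - real (sum_list (take (Suc e) hs))"
    by (simp add: sum.atLeast_Suc_atMost)
  finally show ?thesis unfolding potential_def e by simp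
qed

text \<open>Nobody boards at \<open>j\<close> stops in a row. Empty stops do not enlarge the window,
  so one bound \<open>w\<close> serves all of them.\<close>

lemma idle_run:
  "j \<le> d - 1 \<Longrightarrow> take (d - 1 - j) hs = replicate (d - 1 - j) 0 \<Longrightarrow> full_window d hs \<le> w \<Longrightarrow>
    idle d j hs \<ge> exp (- \<alpha> * w) ^ j"
proof (induction j arbitrary: hs)
  case (Suc j)
  have e: "d - 1 - j = Suc (d - 1 - Suc j)" using Suc.prems(1) by simp
  have "full_window d (0 # hs) \<le> full_window d hs"
    using sum_list_take_mono[of "d - 1 - 1" "d - 1" hs] d by (simp add: full_window_def take_Cons')
  moreover have "take (d - 1 - j) (0 # hs) = replicate (d - 1 - j) 0"
    by (simp only: e take_Suc_Cons replicate_Suc Suc.prems(2))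
  ultimately have "exp (- \<alpha> * w) ^ j \<le> idle d j (0 # hs)"
    using Suc.prems by (intro Suc.IH) auto
  moreover have "exp (- \<alpha> * w) \<le> pmf (boarding \<alpha> (full_window d hs)) 0"
  proof -
    have "exp (- \<alpha> * w) \<le> exp (- (\<alpha> * full_window d hs))"
      using \<alpha> Suc.prems by simp
    also have "\<dots> \<le> pmf (boarding \<alpha> (full_window d hs)) 0"
      using full_window_pos[of d hs] d by (intro pmf_boarding_0_ge[OF \<alpha>]) simp
    finally show ?thesis .
  qed
  ultimately have "exp (- \<alpha> * w) ^ Suc j \<le> pmf (boarding \<alpha> (full_window d hs)) 0 * idle d j (0 # hs)"
    by (simp add: mult_mono)
  also have "\<dots> \<le> idle d (Suc j) hs"
    unfolding idle.simps by (rule pmf_times_le_expectation[where C = 1]) (use idle_bounds in auto)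
  finally show ?case .
qed simp

text \<open>A Lyapunov argument: the mean potential contracts up to a constant, so the mean window
  is eventually at most \<open>C\<close>. By Markov's inequality it is then below
  \<open>2 * C\<close> with probability at least 1/2, and from there \<open>d - 1\<close> empty
  stops have probability at least \<open>c0\<close>. The bound does not depend on \<open>hs\<close>,
  the time \<open>t0\<close> does.\<close>

lemma idle_eventually:
  assumes sub: "\<alpha> / (1 - \<alpha>) * real (d - 1) < 1"
  shows "\<exists>c>0. \<forall>hs. \<exists>t0. \<forall>t\<ge>t0. c \<le> idle d t hs"
proof -
  define m where "m = \<alpha> / (1 - \<alpha>)"
  define b where "b = m * real (d - 1)"
  \<comment> \<open>A stop lowers the mean potential by \<open>1 - b\<close> times the content of
    the window, which is at least \<open>potential d hs / (d - 1)\<close>; \<open>k\<close> collects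
    the customers due to the travel times.\<close>
  define r where "r = 1 - (1 - b) / real (d - 1)"
  define k where "k = b * (\<tau> * real d)"
  have m: "0 < m" using \<alpha> by (simp add: m_def)
  have d1: "1 \<le> real (d - 1)" using d by simp
  have b: "0 < b" "b < 1" using m d1 sub by (simp add: b_def, simp add: b_def m_def)
  have r: "0 \<le> r" "r < 1"
    using b d1 by (auto simp: r_def field_simps)
  have k: "0 \<le> k" using b \<tau> by (simp add: k_def)
  \<comment> \<open>The eventual bound of the mean window, with 1 added for the transient term
    \<open>r ^ t * potential d hs\<close>.\<close>
  define C where "C = \<tau> * real d + k / (1 - r) + 1"
  define c0 where "c0 = exp (- \<alpha> * (2 * C)) ^ (d - 1)"
  have C: "0 < C" using \<tau> k r d by (simp add: C_def add_nonneg_pos)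
  have c0: "0 < c0" by (simp add: c0_def)
  have drift: "integrable (measure_pmf (boarding \<alpha> (full_window d hs))) (\<lambda>y. potential d (y # hs))"
    "measure_pmf.expectation (boarding \<alpha> (full_window d hs)) (\<lambda>y. potential d (y # hs)) \<le> r * potential d hs + k" for hs
  proof -
    define S where "S = real (sum_list (take (d - 1) hs))"
    have w: "0 \<le> full_window d hs" using full_window_pos[of d hs] d by simp
    note E = expectation_boarding_le[OF \<alpha> w]
    show "integrable (measure_pmf (boarding \<alpha> (full_window d hs))) (\<lambda>y. potential d (y # hs))"
      unfolding potential_Cons using E by auto
    have "measure_pmf.expectation (boarding \<alpha> (full_window d hs)) (\<lambda>y. potential d (y # hs)) =
        real (d - 1) * measure_pmf.expectation (boarding \<alpha> (full_window d hs)) real + potential d hs - S"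
      unfolding potential_Cons S_def using E by simp
    also have "\<dots> \<le> real (d - 1) * (m * full_window d hs) + potential d hs - S"
      using mult_left_mono[OF E(2), of "real (d - 1)"] by (simp add: m_def)
    also have "\<dots> = k + potential d hs - (1 - b) * S"
      by (simp add: k_def b_def full_window_def S_def algebra_simps)
    also have "\<dots> \<le> k + potential d hs - (1 - b) * (potential d hs / real (d - 1))"
    proof -
      have "potential d hs \<le> (\<Sum>j=1..d - 1. S)"
        unfolding potential_def S_def by (intro sum_mono) (simp add: sum_list_take_mono)
      then have "potential d hs / real (d - 1) \<le> S" using d1 by (simp add: field_simps)
      then show ?thesis using b by (intro diff_left_mono mult_left_mono) auto
    qed
    also have "\<dots> = r * potential d hs + k" by (simp add: r_def algebra_simps)
    finally show "measure_pmf.expectation (boarding \<alpha> (full_window d hs)) (\<lambda>y. potential d (y # hs)) \<le> r * potential d hs + k" .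
  qed
  \<comment> \<open>Markov's inequality in a form affine in the potential, so that the drift
    inequality can be iterated under the expectation.\<close>
  have lower: "idle d (t + (d - 1)) hs \<ge> c0 * (1 - (\<tau> * real d + r ^ t * potential d hs + k * (\<Sum>s<t. r ^ s)) / (2 * C))" for t hs
  proof (induction t arbitrary: hs)
    case 0
    show ?case
    proof (cases "full_window d hs \<le> 2 * C")
      case True
      have "c0 * (1 - (\<tau> * real d + potential d hs) / (2 * C)) \<le> c0 * 1"
        using c0 C \<tau> potential_nonneg[of d hs] by (intro mult_left_mono) auto
      also have "\<dots> \<le> idle d (d - 1) hs"
        using idle_run[of "d - 1" hs "2 * C"] True by (simp add: c0_def)
      finally show ?thesis by simp
    next
      case False
      then have "1 - (\<tau> * real d + potential d hs) / (2 * C) \<le> 0"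
        using full_window_le_potential[of hs] C by (simp add: field_simps)
      then have "c0 * (1 - (\<tau> * real d + potential d hs) / (2 * C)) \<le> 0"
        using c0 by (simp add: mult_le_0_iff)
      then show ?thesis using idle_bounds[of d "d - 1" hs] by simp
    qed
  next
    case (Suc t)
    define G where "G = \<tau> * real d + k * (\<Sum>s<t. r ^ s)"
    let ?E = "measure_pmf.expectation (boarding \<alpha> (full_window d hs))"
    have "c0 * (1 - (\<tau> * real d + r ^ Suc t * potential d hs + k * (\<Sum>s<Suc t. r ^ s)) / (2 * C)) =
        c0 * (1 - (G + r ^ t * (r * potential d hs + k)) / (2 * C))"
      by (simp add: G_def algebra_simps)
    also have "\<dots> \<le> c0 * (1 - (G + r ^ t * ?E (\<lambda>y. potential d (y # hs))) / (2 * C))"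
      using c0 C r drift(2)[of hs] by (intro mult_left_mono diff_left_mono divide_right_mono add_left_mono) auto
    also have "\<dots> = ?E (\<lambda>y. c0 * (1 - (G + r ^ t * potential d (y # hs)) / (2 * C)))"
      using drift(1)[of hs] by simp
    also have "\<dots> \<le> ?E (\<lambda>y. idle d (t + (d - 1)) (y # hs))"
    proof (rule integral_mono)
      show "integrable (measure_pmf (boarding \<alpha> (full_window d hs))) (\<lambda>y. c0 * (1 - (G + r ^ t * potential d (y # hs)) / (2 * C)))"
        using drift(1)[of hs] by auto
      show "integrable (measure_pmf (boarding \<alpha> (full_window d hs))) (\<lambda>y. idle d (t + (d - 1)) (y # hs))"
        by (rule integrable_pmf_bounded[OF idle_bounded])
      show "c0 * (1 - (G + r ^ t * potential d (y # hs)) / (2 * C)) \<le> idle d (t + (d - 1)) (y # hs)" for y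
        using Suc.IH[of "y # hs"] by (simp add: G_def algebra_simps)
    qed
    finally show ?case by simp
  qed
  show ?thesis
  proof (intro exI[of _ "c0 / 2"] conjI allI)
    fix hs
    have "(\<lambda>t. r ^ t * potential d hs) \<longlonglongrightarrow> 0 * potential d hs"
      using r by (intro tendsto_intros LIMSEQ_realpow_zero) auto
    then have "eventually (\<lambda>t. r ^ t * potential d hs < 1) sequentially"
      by (rule order_tendstoD) simp
    then obtain t1 where t1: "\<And>t. t1 \<le> t \<Longrightarrow> r ^ t * potential d hs < 1"
      by (auto simp: eventually_sequentially)
    show "\<exists>t0. \<forall>t\<ge>t0. c0 / 2 \<le> idle d t hs"
    proof (intro exI[of _ "t1 + (d - 1)"] allI impI)
      fix t assume t: "t1 + (d - 1) \<le> t"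
      define t' where "t' = t - (d - 1)"
      have t': "t = t' + (d - 1)" "t1 \<le> t'" using t by (auto simp: t'_def)
      have "(\<Sum>s<t'. r ^ s) \<le> 1 / (1 - r)"
        using r by (auto simp: sum_gp_strict intro!: divide_right_mono)
      then have "k * (\<Sum>s<t'. r ^ s) \<le> k / (1 - r)"
        using mult_left_mono[OF _ k] by fastforce
      then have "\<tau> * real d + r ^ t' * potential d hs + k * (\<Sum>s<t'. r ^ s) \<le> C"
        using t1[OF t'(2)] unfolding C_def by linarith
      then have "(\<tau> * real d + r ^ t' * potential d hs + k * (\<Sum>s<t'. r ^ s)) / (2 * C) \<le> 1 / 2"
        using C by (simp add: pos_divide_le_eq)
      then have "c0 * (1 / 2) \<le> c0 * (1 - (\<tau> * real d + r ^ t' * potential d hs + k * (\<Sum>s<t'. r ^ s)) / (2 * C))"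
        using c0 by (intro mult_left_mono) auto
      also have "\<dots> \<le> idle d t hs" unfolding t' by (rule lower)
      finally show "c0 / 2 \<le> idle d t hs" by simp
    qed
  qed (use c0 in simp)
qed

section \<open>Meeting of independent buses\<close>

lemma stay_forever_independent_eq:
  "stay_forever (independent_buses d C) (hs, ks, u) =
    measure_pmf.expectation (pair_pmf (boarding \<alpha> (full_window d hs)) (boarding \<alpha> (full_window d ks)))
      (\<lambda>(y, z). let u' = u + real z - real y in if 0 < u' \<and> ereal u' < C
        then stay_forever (independent_buses d C) (y # hs, z # ks, u') else 0)"
  by (subst stay_forever_eq)
     (auto simp: independent_buses_def Let_def case_prod_beta' intro!: Bochner_Integration.integral_cong)

lemma stay_independent_Suc:
  "stay (independent_buses d C) (Suc n) (hs, ks, u) =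
    measure_pmf.expectation (pair_pmf (boarding \<alpha> (full_window d hs)) (boarding \<alpha> (full_window d ks)))
      (\<lambda>(y, z). let u' = u + real z - real y in if 0 < u' \<and> ereal u' < C
        then stay (independent_buses d C) n (y # hs, z # ks, u') else 0)"
  by (auto simp: independent_buses_def Let_def case_prod_beta' intro!: Bochner_Integration.integral_cong)

text \<open>By independence both buses are idle at the same late stop with probability at least
  \<open>c\<^sup>2\<close>, and if the chain has been killed before, so much the better. The bound
  for idle states thus becomes the uniform bound \<open>1 - \<epsilon> * c\<^sup>2\<close>, to which
  the zero-one law applies.\<close>

lemma independent_buses_zero:
  assumes sub: "\<alpha> / (1 - \<alpha>) * real (d - 1) < 1" and \<epsilon>: "0 < \<epsilon>" "\<epsilon> \<le> 1"
    and idle: "\<And>hs ks u. idle d 0 hs = 1 \<Longrightarrow> idle d 0 ks = 1 \<Longrightarrow> 0 < u \<Longrightarrow> ereal u < C \<Longrightarrow>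
      stay_forever (independent_buses d C) (hs, ks, u) \<le> 1 - \<epsilon>"
    and u: "0 < u" "ereal u < C"
  shows "stay_forever (independent_buses d C) (hs, ks, u) = 0"
proof -
  obtain c where c: "0 < c" "\<And>hs. \<exists>t0. \<forall>t\<ge>t0. c \<le> idle d t hs"
    using idle_eventually[OF sub] by blast
  have claim: "stay_forever (independent_buses d C) (hs, ks, u) \<le> 1 - \<epsilon> * (idle d t hs * idle d t ks)"
    if "0 < u" "ereal u < C" for t hs ks u
    using that
  proof (induction t arbitrary: hs ks u)
    case 0
    show ?case
    proof (cases "idle d 0 hs = 1 \<and> idle d 0 ks = 1")
      case True
      then show ?thesis using idle[of hs ks u] 0 by (simp del: idle.simps)
    next
      case False
      then have *: "idle d 0 hs * idle d 0 ks = 0" by auto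
      show ?thesis unfolding * by simp
    qed
  next
    case (Suc t)
    let ?p = "pair_pmf (boarding \<alpha> (full_window d hs)) (boarding \<alpha> (full_window d ks))"
    define g where "g = (\<lambda>(y, z). idle d t (y # hs) * idle d t (z # ks))"
    have g: "0 \<le> g y" "g y \<le> 1" for y
      using idle_bounds by (auto simp: g_def split: prod.split intro!: mult_le_one)
    then have eg: "0 \<le> \<epsilon> * g y" "\<epsilon> * g y \<le> 1" for y
      using \<epsilon> mult_le_one[of \<epsilon> "g y"] g[of y] by simp_all
    have "stay_forever (independent_buses d C) (hs, ks, u) \<le> measure_pmf.expectation ?p (\<lambda>y. 1 - \<epsilon> * g y)"
    proof (subst stay_forever_independent_eq, rule expectation_pmf_mono)
      show "\<bar>(\<lambda>(y, z). let u' = u + real z - real y in if 0 < u' \<and> ereal u' < C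
          then stay_forever (independent_buses d C) (y # hs, z # ks, u') else 0) y\<bar> \<le> 1" for y
        by (auto simp: Let_def split: prod.split)
      show "\<bar>1 - \<epsilon> * g y\<bar> \<le> 1" for y using eg[of y] by simp
      show "(\<lambda>(y, z). let u' = u + real z - real y in if 0 < u' \<and> ereal u' < C
          then stay_forever (independent_buses d C) (y # hs, z # ks, u') else 0) y \<le> 1 - \<epsilon> * g y" for y
        using Suc.IH eg[of y] by (auto simp: Let_def g_def split: prod.split)
    qed
    also have "\<dots> = 1 - \<epsilon> * measure_pmf.expectation ?p g"
      using integrable_pmf_bounded[of g 1 ?p] g by simp
    also have "measure_pmf.expectation ?p g = idle d (Suc t) hs * idle d (Suc t) ks"
      unfolding g_def idle.simps by (rule expectation_pair_pmf_mult) (rule idle_bounded)+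
    finally show ?case .
  qed
  have bound: "stay_forever (independent_buses d C) (hs, ks, u) \<le> 1 - \<epsilon> * c\<^sup>2"
    if u: "0 < u" "ereal u < C" for hs ks u
  proof -
    obtain t1 t2 where "\<forall>t\<ge>t1. c \<le> idle d t hs" "\<forall>t\<ge>t2. c \<le> idle d t ks" using c(2) by blast
    then have "c * c \<le> idle d (max t1 t2) hs * idle d (max t1 t2) ks"
      using c(1) by (intro mult_mono) (auto simp: idle_bounds)
    then have "\<epsilon> * c\<^sup>2 \<le> \<epsilon> * (idle d (max t1 t2) hs * idle d (max t1 t2) ks)"
      using \<epsilon> by (simp add: power2_eq_square)
    then show ?thesis using claim[OF u, of hs ks "max t1 t2"] by linarith
  qed
  have "0 \<le> 1 - \<epsilon> * c\<^sup>2"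
    using bound[OF u] stay_forever_nonneg[of "independent_buses d C"] order_trans by blast
  then show ?thesis
  proof (rule stay_forever_zero[where Z = "{(hs, ks, u). 0 < u \<and> ereal u < C}", rotated])
    show "1 - \<epsilon> * c\<^sup>2 < 1" using \<epsilon> c by simp
    show "stay_forever (independent_buses d C) z \<le> 1 - \<epsilon> * c\<^sup>2" if "z \<in> {(hs, ks, u). 0 < u \<and> ereal u < C}" for z
      using that bound by auto
    show "z' \<in> {(hs, ks, u). 0 < u \<and> ereal u < C}" if "Some z' \<in> set_pmf (independent_buses d C z)" for z z'
      using that by (auto simp: independent_buses_def Let_def split: prod.splits if_splits)
  qed (use u in simp)
qed

lemma full_window_idle: "idle d 0 hs = 1 \<Longrightarrow> full_window d hs = \<tau> * real d"
  by (auto simp: full_window_def sum_list_replicate)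

text \<open>From two idle buses, \<open>n\<close> boardings of the first bus and none of the second
  one kill the chain, as \<open>n\<close> is at least the width of the band. The probability
  \<open>q\<close> of this stop is the same for all idle states.\<close>

lemma independent_buses_band:
  assumes sub: "\<alpha> / (1 - \<alpha>) * real (d - 1) < 1" and u: "0 < u" "u < c"
  shows "stay_forever (independent_buses d (ereal c)) (hs, ks, u) = 0"
proof -
  define n where "n = nat \<lceil>c\<rceil>"
  have n: "c \<le> real n" by (simp add: n_def real_nat_ceiling_ge)
  define q where "q = pmf (boarding \<alpha> (\<tau> * real d)) n * pmf (boarding \<alpha> (\<tau> * real d)) 0"
  have pos: "0 < \<tau> * real d" using \<tau> d by simp
  have q: "0 < q" "q \<le> 1"
    using pmf_boarding_pos[OF \<alpha> pos] by (auto simp: q_def pmf_le_1 intro: mult_le_one)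
  show ?thesis
  proof (rule independent_buses_zero[OF sub q])
    fix hs ks u assume idle: "idle d 0 hs = 1" "idle d 0 ks = 1" and u: "0 < u" "ereal u < ereal c"
    let ?p = "pair_pmf (boarding \<alpha> (\<tau> * real d)) (boarding \<alpha> (\<tau> * real d))"
    note eq = stay_forever_independent_eq[of "ereal c" hs ks u,
        unfolded full_window_idle[OF idle(1)] full_window_idle[OF idle(2)]]
    have "stay_forever (independent_buses d (ereal c)) (hs, ks, u) \<le>
        measure_pmf.expectation ?p (\<lambda>y. 1 - indicator {(n, 0)} y)"
      unfolding eq
    proof (rule expectation_pmf_mono)
      show "\<bar>(\<lambda>(y, z). let u' = u + real z - real y in if 0 < u' \<and> ereal u' < ereal c
          then stay_forever (independent_buses d (ereal c)) (y # hs, z # ks, u') else 0) y\<bar> \<le> 1" for y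
        by (auto simp: Let_def split: prod.split)
      show "\<bar>1 - indicator {(n, 0)} y\<bar> \<le> (1 :: real)" for y :: "nat \<times> nat" by (simp add: indicator_def)
      show "(\<lambda>(y, z). let u' = u + real z - real y in if 0 < u' \<and> ereal u' < ereal c
          then stay_forever (independent_buses d (ereal c)) (y # hs, z # ks, u') else 0) y \<le> 1 - indicator {(n, 0)} y" for y
        using stay_forever_le_1 u n by (auto simp: Let_def indicator_def split: prod.split)
    qed
    also have "\<dots> = 1 - q"
      by (subst Bochner_Integration.integral_diff)
         (auto simp: q_def measure_pmf_single pmf_pair intro!: integrable_pmf_bounded[where C = 1])
    finally show "stay_forever (independent_buses d (ereal c)) (hs, ks, u) \<le> 1 - q" .
  qed (use u in auto)
qed

text \<open>Identifies all idle states, whose older entries and lengths may differ.\<close>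

lemma stay_independent_idle_cong:
  "take (d - 1) hs = take (d - 1) hs' \<Longrightarrow> take (d - 1) ks = take (d - 1) ks' \<Longrightarrow>
    stay (independent_buses d C) n (hs, ks, u) = stay (independent_buses d C) n (hs', ks', u)"
proof (induction n arbitrary: hs hs' ks ks' u)
  case (Suc n)
  have "take (d - 1) (y # hs) = take (d - 1) (y # hs')" "take (d - 1) (y # ks) = take (d - 1) (y # ks')" for y
    using Suc.prems by (metis diff_le_self take_Cons' min.absorb1 take_take)+
  then have *: "stay (independent_buses d C) n (y # hs, z # ks, u) = stay (independent_buses d C) n (y # hs', z # ks', u)" for y z u
    by (intro Suc.IH)
  show ?case
    unfolding stay_independent_Suc full_window_def Suc.prems * ..
qed simp

text \<open>With the buses exchanged, \<open>c - u\<close> is a distance too, and staying in the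
  band means that both distances stay positive. The bound is
  \<open>P(A \<and> B) \<ge> P(A) + P(B) - 1\<close>, carried through the recursion.\<close>

lemma stay_independent_band_ge:
  "stay (independent_buses d \<infinity>) n (hs, ks, u) + stay (independent_buses d \<infinity>) n (ks, hs, c - u) - 1 \<le>
    stay (independent_buses d (ereal c)) n (hs, ks, u)"
proof (induction n arbitrary: hs ks u)
  case (Suc n)
  let ?p = "boarding \<alpha> (full_window d hs)" and ?q = "boarding \<alpha> (full_window d ks)"
  define f where "f = (\<lambda>(y, z). let u' = u + real z - real y in if 0 < u' \<and> ereal u' < \<infinity>
        then stay (independent_buses d \<infinity>) n (y # hs, z # ks, u') else 0)"
  define g where "g = (\<lambda>(y, z). let u' = c - u + real y - real z in if 0 < u' \<and> ereal u' < \<infinity>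
        then stay (independent_buses d \<infinity>) n (z # ks, y # hs, u') else 0)"
  define b where "b = (\<lambda>(y, z). let u' = u + real z - real y in if 0 < u' \<and> ereal u' < ereal c
        then stay (independent_buses d (ereal c)) n (y # hs, z # ks, u') else 0)"
  have bounds: "\<bar>f y\<bar> \<le> 1" "\<bar>g y\<bar> \<le> 1" "\<bar>b y\<bar> \<le> 1" "0 \<le> f y" "0 \<le> g y" "0 \<le> b y" for y
    by (auto simp: f_def g_def b_def Let_def split: prod.split)
  have "stay (independent_buses d \<infinity>) (Suc n) (ks, hs, c - u) =
      measure_pmf.expectation (pair_pmf ?q ?p) (\<lambda>(z, y). g (y, z))"
    unfolding stay_independent_Suc g_def by simp
  also have "\<dots> = measure_pmf.expectation (pair_pmf ?p ?q) g"
    by (rule expectation_pair_pmf_swap[symmetric])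
  finally have "stay (independent_buses d \<infinity>) (Suc n) (hs, ks, u) + stay (independent_buses d \<infinity>) (Suc n) (ks, hs, c - u) - 1 =
      measure_pmf.expectation (pair_pmf ?p ?q) f + measure_pmf.expectation (pair_pmf ?p ?q) g - 1"
    unfolding stay_independent_Suc f_def by simp
  also have "\<dots> = measure_pmf.expectation (pair_pmf ?p ?q) (\<lambda>y. f y + g y - 1)"
    using integrable_pmf_bounded[of f 1] integrable_pmf_bounded[of g 1] bounds by simp
  also have "\<dots> \<le> measure_pmf.expectation (pair_pmf ?p ?q) b"
  proof (rule expectation_pmf_mono)
    show "\<bar>f y + g y - 1\<bar> \<le> 3" for y using bounds(1)[of y] bounds(2)[of y] by linarith
    show "\<bar>b y\<bar> \<le> 1" for y by (rule bounds)
    show "f y + g y - 1 \<le> b y" for y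
    proof (cases y)
      case (Pair y z)
      define u' where "u' = u + real z - real y"
      have e: "c - u + real y - real z = c - u'" by (simp add: u'_def)
      have "f (y, z) = (if 0 < u' then stay (independent_buses d \<infinity>) n (y # hs, z # ks, u') else 0)"
        unfolding f_def prod.case Let_def u'_def[symmetric] by simp
      moreover have "g (y, z) = (if u' < c then stay (independent_buses d \<infinity>) n (z # ks, y # hs, c - u') else 0)"
        unfolding g_def prod.case Let_def e by simp
      moreover have "b (y, z) = (if 0 < u' \<and> u' < c then stay (independent_buses d (ereal c)) n (y # hs, z # ks, u') else 0)"
        unfolding b_def prod.case Let_def u'_def[symmetric] by simp
      ultimately show ?thesis
        using Suc.IH[of "y # hs" "z # ks" u'] unfolding Pair by (auto simp: algebra_simps)
    qed
  qed
  finally show ?case unfolding stay_independent_Suc b_def .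
qed simp

text \<open>For idle buses at distance \<open>u\<close> the band of width \<open>2 * u\<close> is
  symmetric about \<open>u\<close>, so the two probabilities of the preceding bound agree. As the
  band is left almost surely, each is at most 1/2, which is below 1 - 1/4.\<close>

lemma independent_buses_meet:
  assumes sub: "\<alpha> / (1 - \<alpha>) * real (d - 1) < 1" and u: "0 < u"
  shows "stay_forever (independent_buses d \<infinity>) (hs, ks, u) = 0"
proof (rule independent_buses_zero[OF sub, of "1 / 4"])
  fix hs ks u assume idle: "idle d 0 hs = 1" "idle d 0 ks = 1" and u: "0 < (u :: real)"
  then have tk: "take (d - 1) hs = take (d - 1) ks" by simp
  then have "stay (independent_buses d \<infinity>) n (ks, hs, u) = stay (independent_buses d \<infinity>) n (hs, ks, u)" for n
    using stay_independent_idle_cong[of ks hs hs ks] by simp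
  then have "2 * stay (independent_buses d \<infinity>) n (hs, ks, u) - 1 \<le> stay (independent_buses d (ereal (2 * u))) n (hs, ks, u)" for n
    using stay_independent_band_ge[of n hs ks u "2 * u"] by simp
  moreover have "(\<lambda>n. 2 * stay (independent_buses d \<infinity>) n (hs, ks, u) - 1) \<longlonglongrightarrow>
      2 * stay_forever (independent_buses d \<infinity>) (hs, ks, u) - 1"
    by (intro tendsto_intros stay_tendsto)
  ultimately have "2 * stay_forever (independent_buses d \<infinity>) (hs, ks, u) - 1 \<le>
      stay_forever (independent_buses d (ereal (2 * u))) (hs, ks, u)"
    by (intro LIMSEQ_le[OF _ stay_tendsto]) auto
  also have "\<dots> = 0" using u by (intro independent_buses_band[OF sub]) auto
  finally show "stay_forever (independent_buses d \<infinity>) (hs, ks, u) \<le> 1 - 1 / 4" by simp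
qed (use u in auto)

section \<open>Comparison of the two buses with independent ones\<close>

lemma list_all2_sum_list_take:
  assumes "list_all2 (\<le>) ks (ks' :: nat list)"
  shows "sum_list (take k ks) \<le> sum_list (take k ks')"
  using assms
proof (induction arbitrary: k rule: list_all2_induct)
  case (Cons y ys z zs)
  then show ?case by (cases k) (auto intro: add_mono)
qed simp

text \<open>More boardings of the second bus lengthen its later windows as well as the distance.
  This propagates the stochastic order of a single stop through all remaining stops.\<close>

lemma stay_independent_mono:
  "list_all2 (\<le>) ks ks' \<Longrightarrow> u \<le> u' \<Longrightarrow>
    stay (independent_buses d \<infinity>) n (hs, ks, u) \<le> stay (independent_buses d \<infinity>) n (hs, ks', u')"
proof (induction n arbitrary: hs ks ks' u u')
  case (Suc n)
  define F where "F ks u y z = (if 0 < u + real z - real y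
      then stay (independent_buses d \<infinity>) n (y # hs, z # ks, u + real z - real y) else 0)" for ks u y z
  have eq: "stay (independent_buses d \<infinity>) (Suc n) (hs, ks, u) =
      measure_pmf.expectation (boarding \<alpha> (full_window d hs)) (\<lambda>y.
        measure_pmf.expectation (boarding \<alpha> (full_window d ks)) (F ks u y))" for ks u
    unfolding stay_independent_Suc
    by (subst expectation_pair_pmf[where C = 1])
       (auto simp: Let_def F_def[abs_def] split: prod.split)
  have F: "0 \<le> F ks u y z" "F ks u y z \<le> 1" for ks u y z
    by (auto simp: F_def)
  then have Fb: "\<bar>F ks u y z\<bar> \<le> 1" for ks u y z by (simp add: abs_le_iff)
  have EF: "\<bar>measure_pmf.expectation p (F ks u y)\<bar> \<le> 1" for p ks u y
    using expectation_pmf_bounds[of p "F ks u y" 1] F by simp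
  have mono: "F ks u y z \<le> F ks' u' y z'" if "list_all2 (\<le>) ks ks'" "u \<le> u'" "z \<le> z'" for ks ks' u u' y z z'
    using that stay_bounds[of "independent_buses d \<infinity>" n] by (auto simp: F_def intro!: Suc.IH)
  have refl: "list_all2 (\<le>) ks ks" for ks :: "nat list" by (simp add: list_all2_refl)
  have w: "0 \<le> full_window d ks" "full_window d ks \<le> full_window d ks'"
    using full_window_pos[of d ks] d list_all2_sum_list_take[OF Suc.prems(1)]
    by (auto simp: full_window_def)
  show ?case unfolding eq
  proof (rule expectation_pmf_mono[OF EF EF])
    fix y
    have "measure_pmf.expectation (boarding \<alpha> (full_window d ks)) (F ks u y) \<le>
        measure_pmf.expectation (boarding \<alpha> (full_window d ks')) (F ks u y)"
      by (rule boarding_mono[OF \<alpha> w]) (use F mono[OF refl order_refl] in \<open>auto simp: mono_def\<close>)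
    also have "\<dots> \<le> measure_pmf.expectation (boarding \<alpha> (full_window d ks')) (F ks' u' y)"
      by (rule expectation_pmf_mono[OF Fb Fb]) (rule mono[OF Suc.prems order_refl])
    finally show "measure_pmf.expectation (boarding \<alpha> (full_window d ks)) (F ks u y) \<le>
        measure_pmf.expectation (boarding \<alpha> (full_window d ks')) (F ks' u' y)" .
  qed
qed simp

text \<open>Replacing the window of the second bus by the full one makes its boarding number
  stochastically larger and independent of the first bus. From \<open>d - 1\<close> entries on, the
  delay is \<open>d\<close> and the window of the first bus is exactly the full one.\<close>

lemma survival_le_independent:
  assumes \<delta>: "\<And>n. 1 \<le> n \<Longrightarrow> \<delta> n = min d n"
  shows "d - 1 \<le> length xs \<Longrightarrow>
    survival n xs \<le> stay (independent_buses d \<infinity>) n (map fst xs, map snd xs, time2 xs - time1 xs)"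
proof (induction n arbitrary: xs)
  case 0
  then show ?case by (simp add: survival_0)
next
  case (Suc n)
  define hs ks u where "hs = map fst xs" and "ks = map snd xs" and "u = time2 xs - time1 xs"
  have e: "earlier xs = drop (d - 1) xs" using \<delta>[of "Suc (length xs)"] Suc.prems by (simp add: earlier_def)
  have w1: "window1 xs = full_window d hs"
    using time1_drop_diff[OF Suc.prems] d
    by (simp add: window1_def e full_window_def hs_def of_nat_diff algebra_simps)
  have w2: "window2 xs y \<le> full_window d ks" for y
    using time2_drop_diff[OF Suc.prems] d window2_le[of xs y]
    by (simp add: e full_window_def ks_def of_nat_diff algebra_simps)
  define F where "F y z = (if 0 < u + real z - real y
      then stay (independent_buses d \<infinity>) n (y # hs, z # ks, u + real z - real y) else 0)" for y z
  have F: "0 \<le> F y z" "F y z \<le> 1" for y z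
    by (auto simp: F_def)
  then have Fb: "\<bar>F y z\<bar> \<le> 1" for y z by (simp add: abs_le_iff)
  have mono: "mono (F y)" for y
  proof (rule monoI)
    fix z z' :: nat assume "z \<le> z'"
    then show "F y z \<le> F y z'"
      using stay_bounds[of "independent_buses d \<infinity>" n]
      by (auto simp: F_def list_all2_refl intro!: stay_independent_mono)
  qed
  have le: "survival n ((y, z) # xs) \<le> F y z" for y z
  proof (cases "0 < u + real z - real y")
    case True
    have eq: "time2 ((y, z) # xs) - time1 ((y, z) # xs) = u + real z - real y" by (simp add: u_def)
    have "survival n ((y, z) # xs) \<le> stay (independent_buses d \<infinity>) n
        (map fst ((y, z) # xs), map snd ((y, z) # xs), u + real z - real y)"
      using Suc.IH[of "(y, z) # xs"] Suc.prems unfolding eq by simp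
    then show ?thesis using True by (simp add: F_def hs_def ks_def)
  next
    case False
    then have "\<not> alive ((y, z) # xs)" by (simp add: u_def)
    then show ?thesis using survival_not_alive False by (simp add: F_def)
  qed
  have "survival (Suc n) xs = measure_pmf.expectation (boarding \<alpha> (full_window d hs)) (\<lambda>y.
      measure_pmf.expectation (boarding \<alpha> (window2 xs y)) (\<lambda>z. survival n ((y, z) # xs)))"
    unfolding survival_Suc w1[symmetric] by (rule expectation_next_stop[OF survival_bounded])
  also have "\<dots> \<le> measure_pmf.expectation (boarding \<alpha> (full_window d hs)) (\<lambda>y.
      measure_pmf.expectation (boarding \<alpha> (full_window d ks)) (F y))"
  proof (rule expectation_pmf_mono[where C = 1 and D = 1])
    show "\<bar>measure_pmf.expectation (boarding \<alpha> (window2 xs y)) (\<lambda>z. survival n ((y, z) # xs))\<bar> \<le> 1" for y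
      using expectation_pmf_bounds[of "boarding \<alpha> (window2 xs y)" "\<lambda>z. survival n ((y, z) # xs)" 1] survival_bounds by simp
    show "\<bar>measure_pmf.expectation (boarding \<alpha> (full_window d ks)) (F y)\<bar> \<le> 1" for y
      using expectation_pmf_bounds[of "boarding \<alpha> (full_window d ks)" "F y" 1] F by simp
    fix y
    have "measure_pmf.expectation (boarding \<alpha> (window2 xs y)) (\<lambda>z. survival n ((y, z) # xs)) \<le>
        measure_pmf.expectation (boarding \<alpha> (window2 xs y)) (F y)"
      by (rule expectation_pmf_mono[OF survival_bounded Fb]) (rule le)
    also have "\<dots> \<le> measure_pmf.expectation (boarding \<alpha> (full_window d ks)) (F y)"
      by (rule boarding_mono[OF \<alpha> window2_nonneg w2 mono]) (rule F)+
    finally show "measure_pmf.expectation (boarding \<alpha> (window2 xs y)) (\<lambda>z. survival n ((y, z) # xs)) \<le>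
        measure_pmf.expectation (boarding \<alpha> (full_window d ks)) (F y)" .
  qed
  also have "\<dots> = stay (independent_buses d \<infinity>) (Suc n) (hs, ks, u)"
    unfolding stay_independent_Suc
    by (subst expectation_pair_pmf[where C = 1])
       (auto simp: Let_def F_def[abs_def] split: prod.split)
  finally show ?case by (simp add: hs_def ks_def u_def)
qed

lemma subcritical_survival:
  assumes sub: "\<alpha> / (1 - \<alpha>) * real (d - 1) < 1" and \<delta>: "\<And>n. 1 \<le> n \<Longrightarrow> \<delta> n = min d n"
  shows "(\<lambda>n. survival n []) \<longlonglongrightarrow> 0"
proof -
  \<comment> \<open>The first \<open>d\<close> stops, with their shorter delays, are passed by
    conditioning on the history at station \<open>d\<close>.\<close>
  have zero: "(\<lambda>n. survival n xs) \<longlonglongrightarrow> 0" if xs: "xs \<in> set_pmf (path d [])" for xs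
  proof (cases "alive xs")
    case True
    have len: "length xs = d" using length_path[OF xs] by simp
    then have "0 < time2 xs - time1 xs" using True d by (cases xs) auto
    then have "(\<lambda>n. stay (independent_buses d \<infinity>) n (map fst xs, map snd xs, time2 xs - time1 xs)) \<longlonglongrightarrow> 0"
      using stay_tendsto independent_buses_meet[OF sub] by metis
    then show ?thesis
      by (rule tendsto_sandwich[rotated -1])
         (use survival_bounds survival_le_independent[OF \<delta>] len in auto)
  qed (simp add: survival_not_alive)
  have "(\<lambda>n. measure_pmf.expectation (path d []) (survival n)) \<longlonglongrightarrow> measure_pmf.expectation (path d []) (\<lambda>_. 0)"
    by (rule integral_dominated_convergence[where w = "\<lambda>_. 1"])
       (use zero survival_bounded in \<open>auto simp: AE_measure_pmf_iff\<close>)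
  then have "(\<lambda>n. survival (n + d) []) \<longlonglongrightarrow> 0"
    by (simp add: survival_add[symmetric] add.commute)
  then show ?thesis by (rule LIMSEQ_offset)
qed

end

end


section \<open>The supercritical case\<close>

lemma exp_minus_le_inverse:
  fixes x :: real
  assumes "0 < x"
  shows "exp (- x) \<le> 1 / x"
proof -
  have "x \<le> exp x" using exp_ge_add_one_self[of x] by linarith
  then have "inverse (exp x) \<le> inverse x" using assms by (intro le_imp_inverse_le)
  then show ?thesis by (simp add: exp_minus inverse_eq_divide)
qed

text \<open>A bound \<open>1 / x\<close> is crude, but \<open>x\<close> will grow geometrically with
  the station, so the failures remain summable.\<close>

lemma deviation_bound:
  fixes \<kappa> c x w t :: real
  assumes "0 < \<kappa>" "0 < c" "0 < x" "0 < w" and le: "c * x * w \<le> t\<^sup>2"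
  shows "exp (- \<kappa> * t\<^sup>2 / w) \<le> 1 / (\<kappa> * c * x)"
proof -
  have "\<kappa> * (c * x) \<le> \<kappa> * (t\<^sup>2 / w)"
    using assms by (intro mult_left_mono) (auto simp: field_simps)
  then have "exp (- \<kappa> * t\<^sup>2 / w) \<le> exp (- (\<kappa> * c * x))" by simp
  also have "\<dots> \<le> 1 / (\<kappa> * c * x)" using assms by (intro exp_minus_le_inverse) simp
  finally show ?thesis .
qed

context two_buses
begin

text \<open>A union bound in which the second bus is only judged after a good stop of the first one,
  because its window depends on it.\<close>

lemma prob_next_stop_le:
  assumes "measure_pmf.prob (boarding \<alpha> (window1 xs)) {y. \<not> P y} \<le> a"
    and "\<And>y. P y \<Longrightarrow> measure_pmf.prob (boarding \<alpha> (window2 xs y)) {z. \<not> R z} \<le> b" "0 \<le> b"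
  shows "measure_pmf.prob (next_stop xs) {(y, z). \<not> (P y \<and> R z)} \<le> a + b"
proof -
  let ?q = "\<lambda>y. measure_pmf.prob (boarding \<alpha> (window2 xs y)) (Pair y -` {(y, z). \<not> (P y \<and> R z)})"
  have "measure_pmf.prob (next_stop xs) {(y, z). \<not> (P y \<and> R z)} = measure_pmf.expectation (boarding \<alpha> (window1 xs)) ?q"
    by (simp add: next_stop_def prob_bind_pmf)
  also have "\<dots> \<le> measure_pmf.expectation (boarding \<alpha> (window1 xs)) (\<lambda>y. indicator {y. \<not> P y} y + b)"
  proof (rule expectation_pmf_mono[where C = 1 and D = "1 + b"])
    show "\<bar>?q y\<bar> \<le> 1" for y by simp
    show "\<bar>indicator {y. \<not> P y} y + b\<bar> \<le> 1 + b" for y using assms(3) by (simp add: indicator_def)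
    show "?q y \<le> indicator {y. \<not> P y} y + b" for y
    proof (cases "P y")
      case True
      then have "Pair y -` {(y, z). \<not> (P y \<and> R z)} = {z. \<not> R z}" by auto
      then show ?thesis using assms(2)[OF True] True by simp
    next
      case False
      then show ?thesis using assms(3) by (simp add: add_increasing2)
    qed
  qed
  also have "\<dots> = measure_pmf.prob (boarding \<alpha> (window1 xs)) {y. \<not> P y} + b"
    by (subst Bochner_Integration.integral_add) (auto intro!: integrable_pmf_bounded[where C = 1])
  finally show ?thesis using assms(1) by simp
qed

lemma pmf_next_stop_pos:
  assumes "alive xs"
  shows "0 < pmf (next_stop xs) (0, k)"
proof -
  have "time1 xs < time2 xs" using assms \<mu> by (cases xs) auto
  moreover have "time2 (earlier xs) < time2 xs + \<tau>"
    using time2_drop_le[of _ xs] \<tau> by (metis add_strict_increasing2 earlier_def less_add_same_cancel1 order_le_less_trans)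
  ultimately have "0 < window2 xs 0" by (simp add: window2_def start2_def)
  moreover have "0 < window1 xs" using window1_ge[of xs] \<tau> by simp
  ultimately show ?thesis
    unfolding pmf_next_stop by (simp add: pmf_boarding_pos[OF \<alpha>])
qed

lemma survival_Suc_ge: "pmf (next_stop xs) y * survival n (y # xs) \<le> survival (Suc n) xs"
  unfolding survival_Suc by (rule pmf_times_le_expectation[where C = 1]) (use survival_bounds in auto)

lemma alive_replicate: "alive (replicate j (0, k))"
proof (induction j)
  case (Suc j)
  have "time1 (replicate j (0, k)) < time2 (replicate j (0, k))"
    using \<mu> by (simp add: time1_def time2_def sum_list_replicate add_pos_nonneg)
  then show ?case using Suc by (simp add: add_strict_increasing2)
qed simp

text \<open>A start with a large separation has positive probability: at each of the first
  \<open>j\<close> stops nobody boards the first bus and \<open>k\<close> customers board the second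
  one.\<close>

lemma survival_replicate: "\<exists>c>0. \<forall>n. c * survival n (replicate j (0, k)) \<le> survival (j + n) []"
proof (induction j)
  case 0
  show ?case by (rule exI[of _ 1]) simp
next
  case (Suc j)
  then obtain c where c: "0 < c" "\<And>n. c * survival n (replicate j (0, k)) \<le> survival (j + n) []" by blast
  let ?p = "pmf (next_stop (replicate j (0, k))) (0, k)"
  show ?case
  proof (intro exI[of _ "c * ?p"] conjI allI)
    show "0 < c * ?p" using c pmf_next_stop_pos[OF alive_replicate] by simp
    fix n
    have "c * ?p * survival n (replicate (Suc j) (0, k)) \<le> c * survival (Suc n) (replicate j (0, k))"
      using survival_Suc_ge[of "replicate j (0, k)" "(0, k)" n] c(1) by simp
    also have "\<dots> \<le> survival (Suc j + n) []" using c(2)[of "Suc n"] by simp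
    finally show "c * ?p * survival n (replicate (Suc j) (0, k)) \<le> survival (Suc j + n) []" .
  qed
qed

text \<open>If the boarding numbers of both buses grow like \<open>r ^ i\<close>, those of the second one with a much
  larger prefactor, the buses never meet. The factors \<open>2 - s ^ i\<close> and \<open>1 + s ^ i\<close> leave room for
  the fluctuations, which are of the order of the square root.\<close>

fun separated :: "real \<Rightarrow> real \<Rightarrow> real \<Rightarrow> real \<Rightarrow> history \<Rightarrow> bool" where
  "separated r s B K [] \<longleftrightarrow> True"
| "separated r s B K (y # xs) \<longleftrightarrow>
     real (fst y) \<le> B * (2 - s ^ length (y # xs)) * r ^ length (y # xs) \<and>
     K * (1 + s ^ length (y # xs)) * r ^ length (y # xs) \<le> real (snd y) \<and> separated r s B K xs"

text \<open>As \<open>s ^ i\<close> decreases, the factors of older stations are at least as good as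
  those of the latest one, so the latest can be taken out of the sum.\<close>

lemma separated_sums:
  assumes s: "0 < s" "s < 1" and r: "1 < r" and BK: "0 \<le> B" "0 \<le> K"
  shows "separated r s B K xs \<Longrightarrow> k \<le> length xs \<Longrightarrow>
      real (sum_list (take k (map fst xs))) \<le> B * (2 - s ^ length xs) * (\<Sum>j<k. r ^ (length xs - j)) \<and>
      K * (1 + s ^ length xs) * (\<Sum>j<k. r ^ (length xs - j)) \<le> real (sum_list (take k (map snd xs)))"
proof (induction xs arbitrary: k)
  case (Cons y xs)
  show ?case
  proof (cases k)
    case (Suc l)
    let ?n = "length xs"
    have sn: "s ^ Suc ?n \<le> s ^ ?n" using s by (simp add: mult_left_le_one_le)
    have sum: "(\<Sum>j<k. r ^ (length (y # xs) - j)) = r ^ Suc ?n + (\<Sum>j<l. r ^ (?n - j))"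
      unfolding Suc by (subst sum.lessThan_Suc_shift) simp
    have pos: "0 \<le> (\<Sum>j<l. r ^ (?n - j))" using r by (simp add: sum_nonneg)
    have IH: "real (sum_list (take l (map fst xs))) \<le> B * (2 - s ^ ?n) * (\<Sum>j<l. r ^ (?n - j))"
      "K * (1 + s ^ ?n) * (\<Sum>j<l. r ^ (?n - j)) \<le> real (sum_list (take l (map snd xs)))"
      using Cons Suc by auto
    have "real (sum_list (take l (map fst xs))) \<le> B * (2 - s ^ Suc ?n) * (\<Sum>j<l. r ^ (?n - j))"
      by (rule order.trans[OF IH(1)]) (use sn pos BK in \<open>intro mult_right_mono mult_left_mono; simp\<close>)
    moreover have "K * (1 + s ^ Suc ?n) * (\<Sum>j<l. r ^ (?n - j)) \<le> real (sum_list (take l (map snd xs)))"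
      by (rule order.trans[OF _ IH(2)]) (use sn pos BK in \<open>intro mult_right_mono mult_left_mono; simp\<close>)
    ultimately show ?thesis
      using Cons.prems unfolding sum by (simp add: Suc distrib_left)
  qed simp
qed simp

lemma supercritical_survival:
  fixes m :: real
  assumes d: "2 \<le> d" and \<delta>: "\<And>n. 1 \<le> n \<Longrightarrow> \<delta> n = min d n" and m_def: "m = \<alpha> / (1 - \<alpha>)"
    and r: "1 < r" "r ^ (d - 1) = m * (\<Sum>k<d - 1. r ^ k)"
  shows "\<exists>c>0. \<forall>n. c \<le> survival n []"
proof -
  have m: "0 < m" using \<alpha> by (simp add: m_def)
  \<comment> \<open>At station \<open>n\<close> the room for fluctuations is of order
    \<open>s ^ n * r ^ n\<close> and their variance of order \<open>r ^ n\<close>. The quotient of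
    squared room and variance is \<open>p ^ n\<close>, so \<open>p = s\<^sup>2 * r\<close> has to
    exceed 1; here it is the square root of \<open>r\<close>.\<close>
  define s where "s = 1 / sqrt (sqrt r)"
  define p where "p = s\<^sup>2 * r"
  have s: "0 < s" "s < 1" using r(1) by (auto simp: s_def)
  have "s\<^sup>2 = 1 / sqrt r" using r(1) by (simp add: s_def power_divide)
  then have p_eq: "p = sqrt r" using r(1) by (simp add: p_def real_div_sqrt)
  have p: "1 < p" unfolding p_eq using r(1) by simp
  have sr: "1 < s * r"
  proof -
    have "p \<le> s * r" using s r(1) by (simp add: p_def power2_eq_square mult_left_le_one_le)
    then show ?thesis using p by simp
  qed
  define \<kappa>1 where "\<kappa>1 = (1 - \<alpha>)\<^sup>2 / (4 * \<alpha> * (2 * m + 1))"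
  define \<kappa>2 where "\<kappa>2 = (1 - \<alpha>)\<^sup>2 / (2 * m)"
  have \<kappa>: "0 < \<kappa>1" "0 < \<kappa>2" using \<alpha> m by (auto simp: \<kappa>1_def \<kappa>2_def)
  \<comment> \<open>The constants of the two estimates by \<open>deviation_bound\<close>: 12 is 4
    for the loss of half the room and 3 from \<open>m * W1 \<le> 3 * B * R\<close>; 2 comes from
    \<open>m * W2 \<le> 2 * K * R\<close>.\<close>
  define c1 where "c1 = m * (1 - s)\<^sup>2 / 12"
  define c2 where "c2 = m * (1 - s)\<^sup>2 / 2"
  have c: "0 < c1" "0 < c2" using m s by (auto simp: c1_def c2_def)
  define C where "C = 1 / (\<kappa>1 * c1) + 1 / (\<kappa>2 * c2)"
  have C: "0 < C" using \<kappa> c by (simp add: C_def add_pos_pos)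
  \<comment> \<open>The first term makes the travel times in a window small against the room, the
    second one makes the sum of all failure probabilities at most 1/2.\<close>
  define B where "B = max (2 * m * (real d * \<tau>) / (1 - s)) (2 * C / (1 - 1 / p))"
  have B: "0 < B" "2 * m * (real d * \<tau>) \<le> B * (1 - s)" "C / B * (1 / (1 - 1 / p)) \<le> 1 / 2"
  proof -
    have pp: "0 < 1 - 1 / p" using p by simp
    have B1: "2 * C / (1 - 1 / p) \<le> B" by (simp add: B_def)
    moreover have "0 < 2 * C / (1 - 1 / p)" using C pp by simp
    ultimately show B0: "0 < B" by linarith
    show "2 * m * (real d * \<tau>) \<le> B * (1 - s)"
      using s by (simp add: B_def pos_divide_le_eq[symmetric])
    have "2 * C \<le> B * (1 - 1 / p)" using B1 pp by (simp only: pos_divide_le_eq)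
    then have "C / (B * (1 - 1 / p)) \<le> 1 / 2" using B0 pp by (simp add: pos_divide_le_eq)
    then show "C / B * (1 / (1 - 1 / p)) \<le> 1 / 2" by simp
  qed
  \<comment> \<open>Makes \<open>K * r ^ (n - (d - 1))\<close> an upper bound for all customers of
    the first bus up to the next station.\<close>
  define K where "K = 2 * B * r ^ (d + 1) / (r - 1)"
  have KB: "B \<le> K" "0 < K"
  proof -
    have "r - 1 \<le> 2 * r ^ (d + 1)"
    proof -
      have "r ^ 1 \<le> r ^ (d + 1)" using r(1) by (intro power_increasing) auto
      then show ?thesis using r(1) unfolding power_one_right by linarith
    qed
    then have "B * (r - 1) \<le> B * (2 * r ^ (d + 1))" using B by simp
    then show "B \<le> K" using r(1) by (simp add: K_def field_simps)
    then show "0 < K" using B by simp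
  qed
  \<comment> \<open>The equation for \<open>r\<close>: boarding numbers \<open>r ^ i\<close> in a
    window reproduce themselves in mean at the next station.\<close>
  have geom: "(\<Sum>j<d - 1. r ^ (n - j)) = r ^ Suc n / m" if "d - 1 \<le> n" for n
  proof -
    have "(\<Sum>j<d - 1. r ^ (n - j)) = (\<Sum>k<d - 1. r ^ (n - (d - 1 - Suc k)))"
      by (rule sum.nat_diff_reindex[symmetric])
    also have "\<dots> = (\<Sum>k<d - 1. r ^ (Suc n - (d - 1)) * r ^ k)"
      using that by (intro sum.cong) (auto simp: power_add[symmetric])
    also have "\<dots> = r ^ (Suc n - (d - 1)) * (r ^ (d - 1) / m)"
    proof -
      have "(\<Sum>k<d - 1. r ^ k) = r ^ (d - 1) / m" using m by (simp only: r(2)) simp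
      then show ?thesis by (simp only: sum_distrib_left[symmetric])
    qed
    also have "\<dots> = r ^ Suc n / m"
      using that by (simp add: power_add[symmetric])
    finally show ?thesis .
  qed
  define good where "good n y z \<longleftrightarrow> real y \<le> B * (2 - s ^ Suc n) * r ^ Suc n \<and>
      K * (1 + s ^ Suc n) * r ^ Suc n \<le> real z" for n and y z :: nat
  have step: "measure_pmf.prob (next_stop xs) {(y, z). \<not> good (length xs) y z} \<le> C / B * (1 / p) ^ length xs"
      "\<And>y z. good (length xs) y z \<Longrightarrow> alive ((y, z) # xs)"
    if inv: "separated r s B K xs" and xs: "d \<le> length xs" and al: "alive xs" for xs
  proof -
    define n where "n = length xs"
    define R where "R = r ^ Suc n"
    have R: "1 \<le> R" unfolding R_def using r(1) by (intro one_le_power) simp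
    have n: "d \<le> n" "d - 1 \<le> n" using xs by (auto simp: n_def)
    have sn: "0 < s ^ n" "s ^ n \<le> 1" using s by (auto simp: power_le_one)
    have pn: "p ^ n \<le> (s ^ n)\<^sup>2 * R"
    proof -
      have "p ^ n = (s ^ n)\<^sup>2 * r ^ n" by (simp add: p_def power_mult_distrib power_mult[symmetric] mult.commute)
      also have "\<dots> \<le> (s ^ n)\<^sup>2 * R" using r(1) by (intro mult_left_mono) (auto simp: R_def)
      finally show ?thesis .
    qed
    have snR: "1 \<le> s ^ n * R"
    proof -
      have "1 \<le> (s * r) ^ n * r" using sr r(1) by (simp add: one_le_mult_iff mult_ge1_I one_le_power)
      then show ?thesis by (simp add: R_def power_mult_distrib mult_ac)
    qed
    have S: "real (sum_list (take k (map fst xs))) \<le> B * (2 - s ^ n) * (\<Sum>j<k. r ^ (n - j))"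
      "K * (1 + s ^ n) * (\<Sum>j<k. r ^ (n - j)) \<le> real (sum_list (take k (map snd xs)))" if "k \<le> n" for k
      using separated_sums[OF s r(1) _ _ inv, of k] B KB that by (auto simp: n_def)
    have e: "earlier xs = drop (d - 1) xs" using \<delta>[of "Suc n"] n d by (simp add: earlier_def n_def)
    \<comment> \<open>The target minus the largest possible mean \<open>m * W1\<close>. The factor
      \<open>1 - s\<close> is the increase of \<open>2 - s ^ n\<close> in one stop, divided by
      \<open>s ^ n\<close>.\<close>
    define t1 where "t1 = B * (s ^ n * (1 - s)) * R - m * (real d * \<tau>)"
    define W1 where "W1 = real d * \<tau> + B * (2 - s ^ n) * (R / m)"
    have gR: "(\<Sum>j<d - 1. r ^ (n - j)) = R / m" using geom[OF n(2)] by (simp add: R_def)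
    have w1_eq: "window1 xs = real d * \<tau> + real (sum_list (take (d - 1) (map fst xs)))"
      using time1_drop_diff[of "d - 1" xs] n d by (simp add: window1_def e n_def of_nat_diff algebra_simps)
    have w1: "window1 xs \<le> W1"
      unfolding w1_eq W1_def using S(1)[of "d - 1"] n unfolding gR by simp
    have mW1: "m * W1 = m * (real d * \<tau>) + B * (2 - s ^ n) * R" using m by (simp add: W1_def field_simps)
    have g1: "m * W1 + t1 = B * (2 - s ^ Suc n) * R"
      unfolding mW1 by (simp add: t1_def algebra_simps)
    have big: "2 * (m * (real d * \<tau>)) \<le> B * (s ^ n * (1 - s)) * R"
    proof -
      have "2 * (m * (real d * \<tau>)) \<le> B * (1 - s) * 1" using B(2) by simp
      also have "\<dots> \<le> B * (1 - s) * (s ^ n * R)" using B s snR by (intro mult_left_mono) auto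
      finally show ?thesis by (simp add: mult_ac)
    qed
    have t1: "B * (s ^ n * (1 - s)) * R / 2 \<le> t1" unfolding t1_def using big by linarith
    have t1_nonneg: "0 \<le> t1" by (rule order.trans[OF _ t1]) (use B s R in simp)
    have md: "0 \<le> m * (real d * \<tau>)" using m \<tau> by simp
    have s1: "s ^ n * (1 - s) \<le> 1" using sn s by (intro mult_le_one) auto
    have BR: "B * (s ^ n * (1 - s)) * R \<le> B * R"
      using B R s1 by (simp add: mult_left_le)
    have t1_le: "t1 \<le> m * W1"
    proof -
      have "B * R * 1 \<le> B * R * (2 - s ^ n)" using B R sn by (intro mult_left_mono) auto
      then show ?thesis using BR md unfolding mW1 t1_def by (simp add: algebra_simps)
    qed
    have W1_pos: "0 < W1" using \<tau> d B R m sn by (simp add: W1_def add_pos_nonneg)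
    have W1_le: "m * W1 \<le> 3 * B * R"
    proof -
      have "m * (real d * \<tau>) \<le> B * R" using big BR md by linarith
      moreover have "B * R * (2 - s ^ n) \<le> B * R * 2" using B R sn by (intro mult_left_mono) auto
      ultimately show ?thesis unfolding mW1 by (simp add: algebra_simps)
    qed
    have dev1: "c1 * (B * p ^ n) * W1 \<le> t1\<^sup>2"
    proof -
      have "c1 * (B * p ^ n) * W1 = (1 - s)\<^sup>2 / 12 * B * p ^ n * (m * W1)" by (simp add: c1_def)
      also have "\<dots> \<le> (1 - s)\<^sup>2 / 12 * B * ((s ^ n)\<^sup>2 * R) * (3 * B * R)"
      proof -
        have "p ^ n * (m * W1) \<le> ((s ^ n)\<^sup>2 * R) * (3 * B * R)"
          by (rule mult_mono[OF pn W1_le]) (use R m W1_pos in auto)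
        then show ?thesis unfolding mult.assoc using B by (intro mult_left_mono) (auto simp: mult_ac)
      qed
      also have "\<dots> = (B * (s ^ n * (1 - s)) * R / 2)\<^sup>2"
        by (simp add: power2_eq_square field_simps)
      also have "\<dots> \<le> t1\<^sup>2" using t1 B s R sn by (intro power_mono) auto
      finally show ?thesis .
    qed
    have fail1: "measure_pmf.prob (boarding \<alpha> (window1 xs)) {y. \<not> real y \<le> B * (2 - s ^ Suc n) * R} \<le> 1 / (\<kappa>1 * c1 * (B * p ^ n))"
    proof -
      have "measure_pmf.prob (boarding \<alpha> (window1 xs)) {y. \<not> real y \<le> B * (2 - s ^ Suc n) * R} \<le>
          measure_pmf.prob (boarding \<alpha> (window1 xs)) {y. m * W1 + t1 \<le> real y}"
        unfolding g1 by (intro measure_pmf.finite_measure_mono) auto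
      also have "\<dots> \<le> exp (- \<kappa>1 * t1\<^sup>2 / W1)"
        using boarding_upper_tail[OF \<alpha> W1_pos window1_nonneg w1 t1_nonneg] t1_le
        unfolding m_def \<kappa>1_def by simp
      also have "\<dots> \<le> 1 / (\<kappa>1 * c1 * (B * p ^ n))"
        using \<kappa> c B p W1_pos dev1 by (intro deviation_bound) auto
      finally show ?thesis .
    qed
    define W2 where "W2 = K * (1 + s ^ n) * (R / m)"
    define t2 where "t2 = K * (s ^ n * (1 - s)) * R"
    have W2_pos: "0 < W2" using KB sn R m by (simp add: W2_def add_pos_pos)
    have mW2: "m * W2 = K * (1 + s ^ n) * R" using m by (simp add: W2_def)
    have g2: "m * W2 - t2 = K * (1 + s ^ Suc n) * R" unfolding mW2 by (simp add: t2_def algebra_simps)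
    \<comment> \<open>The window of the second bus may also be limited by the departure of the first
      one, so its lead has to exceed \<open>W2\<close> too.\<close>
    have gap: "W2 \<le> time2 xs - time1 xs - real y" if y: "real y \<le> B * (2 - s ^ Suc n) * R" for y :: nat
    proof -
      have "real (sum_list (map fst xs)) \<le> B * (2 - s ^ n) * (\<Sum>j<n. r ^ (n - j))"
        using S(1)[of n] by (simp add: n_def)
      also have "(\<Sum>j<n. r ^ (n - j)) = (\<Sum>j<n. r ^ Suc j)"
        by (subst sum.nat_diff_reindex[symmetric]) (auto intro!: sum.cong)
      also have "\<dots> = r * ((r ^ n - 1) / (r - 1))"
        using r(1) by (simp add: sum_distrib_left[symmetric] geometric_sum)
      also have "\<dots> \<le> R / (r - 1)" using r(1) by (simp add: R_def divide_right_mono algebra_simps)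
      finally have "real (sum_list (map fst xs)) \<le> B * (2 - s ^ n) * (R / (r - 1))"
        using B sn by (simp add: mult_left_mono)
      also have "\<dots> \<le> B * 2 * (R / (r - 1))" using B sn R r(1) by (intro mult_right_mono mult_left_mono) auto
      finally have f: "real (sum_list (map fst xs)) \<le> 2 * B * R / (r - 1)" by (simp add: mult_ac)
      have "B * (2 - s ^ Suc n) * R \<le> B * 2 * R" using B s R by (intro mult_right_mono mult_left_mono) auto
      then have y2: "real y \<le> 2 * B * R" using y by simp
      have fy: "real (sum_list (map fst xs)) + real y \<le> K * r ^ (n - (d - 1))"
      proof -
        have "2 * B * R / (r - 1) + 2 * B * R = 2 * B * (R * r) / (r - 1)" using r(1) by (simp add: field_simps)
        also have "R * r = r ^ (d + 1) * r ^ (n - (d - 1))"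
        proof -
          have e: "Suc n + 1 = (d + 1) + (n - (d - 1))" using n d by simp
          have "R * r = r ^ (Suc n + 1)" by (simp add: R_def mult.commute)
          then show ?thesis unfolding e power_add .
        qed
        also have "2 * B * (r ^ (d + 1) * r ^ (n - (d - 1))) / (r - 1) = K * r ^ (n - (d - 1))" by (simp add: K_def)
        finally show ?thesis using f y2 by simp
      qed
      \<comment> \<open>The sum over \<open>d\<close> instead of \<open>d - 1\<close> stops has one
        more term, and it pays for all customers of the first bus.\<close>
      have "W2 + K * r ^ (n - (d - 1)) \<le> K * (1 + s ^ n) * (\<Sum>j<d. r ^ (n - j))"
      proof -
        have "(\<Sum>j<d. r ^ (n - j)) = R / m + r ^ (n - (d - 1))"
          using geom[OF n(2)] d sum.lessThan_Suc[of "\<lambda>j. r ^ (n - j)" "d - 1"] by (simp add: R_def)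
        moreover have "K * 1 * r ^ (n - (d - 1)) \<le> K * (1 + s ^ n) * r ^ (n - (d - 1))"
          using KB sn r(1) by (intro mult_right_mono mult_left_mono) auto
        ultimately show ?thesis by (simp add: W2_def distrib_left)
      qed
      also have "\<dots> \<le> real (sum_list (take d (map snd xs)))" by (rule S(2)[OF n(1)])
      also have "\<dots> \<le> real (sum_list (map snd xs))"
        using sum_list_take_mono[of d n "map snd xs"] n by (simp add: n_def)
      finally show ?thesis using fy \<mu> by (simp add: time1_def time2_def)
    qed
    have w2: "W2 \<le> window2 xs y" if y: "real y \<le> B * (2 - s ^ Suc n) * R" for y :: nat
    proof -
      have "W2 \<le> time2 xs + \<tau> - time2 (earlier xs)"
      proof -
        have "time2 xs + \<tau> - time2 (earlier xs) = real d * \<tau> + real (sum_list (take (d - 1) (map snd xs)))"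
          using time2_drop_diff[of "d - 1" xs] n d by (simp add: e n_def of_nat_diff algebra_simps)
        moreover have "W2 \<le> real (sum_list (take (d - 1) (map snd xs)))"
          using S(2)[of "d - 1"] n unfolding gR W2_def by simp
        moreover have "0 \<le> real d * \<tau>" using \<tau> by simp
        ultimately show ?thesis by linarith
      qed
      then show ?thesis using gap[OF y] by (simp add: window2_def start2_def)
    qed
    have dev2: "c2 * (B * p ^ n) * W2 \<le> t2\<^sup>2"
    proof -
      have "m * W2 \<le> 2 * K * R"
      proof -
        have "K * R * (1 + s ^ n) \<le> K * R * 2" using KB R sn by (intro mult_left_mono) auto
        then show ?thesis unfolding mW2 by (simp add: mult_ac)
      qed
      have "(1 - s)\<^sup>2 / 2 * B * p ^ n * (m * W2) \<le> (1 - s)\<^sup>2 / 2 * K * ((s ^ n)\<^sup>2 * R) * (2 * K * R)"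
      proof -
        have le: "p ^ n * (m * W2) \<le> ((s ^ n)\<^sup>2 * R) * (2 * K * R)"
          by (rule mult_mono[OF pn \<open>m * W2 \<le> 2 * K * R\<close>]) (use R m W2_pos in auto)
        have "B * (p ^ n * (m * W2)) \<le> K * (((s ^ n)\<^sup>2 * R) * (2 * K * R))"
          by (rule mult_mono[OF KB(1) le]) (use KB B p m W2_pos in auto)
        then have "(1 - s)\<^sup>2 / 2 * (B * (p ^ n * (m * W2))) \<le> (1 - s)\<^sup>2 / 2 * (K * (((s ^ n)\<^sup>2 * R) * (2 * K * R)))"
          by (intro mult_left_mono) auto
        then show ?thesis by (simp only: mult.assoc)
      qed
      also have "\<dots> = t2\<^sup>2" by (simp add: t2_def power2_eq_square field_simps)
      finally show ?thesis by (simp add: c2_def mult_ac)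
    qed
    have fail2: "measure_pmf.prob (boarding \<alpha> (window2 xs y)) {z. \<not> K * (1 + s ^ Suc n) * R \<le> real z} \<le> 1 / (\<kappa>2 * c2 * (B * p ^ n))"
      if y: "real y \<le> B * (2 - s ^ Suc n) * R" for y :: nat
    proof -
      have t2: "0 \<le> t2" using KB sn s R by (simp add: t2_def)
      have "measure_pmf.prob (boarding \<alpha> (window2 xs y)) {z. \<not> K * (1 + s ^ Suc n) * R \<le> real z} \<le>
          measure_pmf.prob (boarding \<alpha> (window2 xs y)) {z. real z \<le> m * W2 - t2}"
        unfolding g2 by (intro measure_pmf.finite_measure_mono) auto
      also have "\<dots> \<le> exp (- \<kappa>2 * t2\<^sup>2 / W2)"
        using boarding_lower_tail[OF \<alpha> W2_pos w2[OF y] t2] unfolding m_def \<kappa>2_def by simp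
      also have "\<dots> \<le> 1 / (\<kappa>2 * c2 * (B * p ^ n))"
        using \<kappa> c B p W2_pos dev2 by (intro deviation_bound) auto
      finally show ?thesis .
    qed
    have "measure_pmf.prob (next_stop xs) {(y, z). \<not> (real y \<le> B * (2 - s ^ Suc n) * R \<and> K * (1 + s ^ Suc n) * R \<le> real z)} \<le>
        1 / (\<kappa>1 * c1 * (B * p ^ n)) + 1 / (\<kappa>2 * c2 * (B * p ^ n))"
      by (rule prob_next_stop_le[OF fail1 fail2]) (use \<kappa> c B p in auto)
    also have "\<dots> = C / B * (1 / p) ^ n"
      by (simp add: C_def add_divide_distrib power_one_over mult_ac)
    finally show "measure_pmf.prob (next_stop xs) {(y, z). \<not> good (length xs) y z} \<le> C / B * (1 / p) ^ length xs"
      by (simp add: good_def R_def n_def)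
    show "alive ((y, z) # xs)" if "good (length xs) y z" for y z
    proof -
      have "W2 \<le> time2 xs - time1 xs - real y" using that by (intro gap) (simp add: good_def n_def R_def)
      then show ?thesis using W2_pos al by simp
    qed
  qed
  \<comment> \<open>A union bound over the stops at which the separation may break down.\<close>
  have surv: "survival N xs \<ge> 1 - (\<Sum>j<N. C / B * (1 / p) ^ (length xs + j))"
    if "separated r s B K xs" "d \<le> length xs" "alive xs" for N xs
    using that
  proof (induction N arbitrary: xs)
    case 0
    then show ?case by (simp add: survival_0)
  next
    case (Suc N)
    define n where "n = length xs"
    define S where "S = (\<Sum>j<N. C / B * (1 / p) ^ (Suc n + j))"
    have S: "0 \<le> S" unfolding S_def using C B p by (intro sum_nonneg) simp
    let ?G = "{(y, z). \<not> good n y z}"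
    have "1 - C / B * (1 / p) ^ n - S \<le> 1 - measure_pmf.prob (next_stop xs) ?G - S"
      using step(1)[OF Suc.prems] by (simp add: n_def)
    also have "\<dots> = measure_pmf.expectation (next_stop xs) (\<lambda>y. 1 - indicator ?G y - S)"
      by (subst Bochner_Integration.integral_diff Bochner_Integration.integral_diff,
          (auto intro!: integrable_pmf_bounded[where C = 1] Bochner_Integration.integrable_diff)[2])+
         simp
    also have "\<dots> \<le> measure_pmf.expectation (next_stop xs) (\<lambda>y. survival N (y # xs))"
    proof (rule expectation_pmf_mono[OF _ survival_bounded])
      show "\<bar>1 - indicator ?G y - S\<bar> \<le> 1 + S" for y using S by (auto simp: indicator_def abs_le_iff)
      fix y :: "nat \<times> nat"
      show "1 - indicator ?G y - S \<le> survival N (y # xs)"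
      proof (cases "y \<in> ?G")
        case True
        then show ?thesis using S survival_bounds[of N "y # xs"] by simp
      next
        case False
        then have g: "good n (fst y) (snd y)" by (simp add: case_prod_beta')
        then have "separated r s B K (y # xs)" using Suc.prems(1) by (simp add: good_def n_def)
        moreover have "alive (y # xs)"
          using step(2)[OF Suc.prems, of "fst y" "snd y"] g by (simp add: n_def)
        ultimately show ?thesis
          using Suc.IH[of "y # xs"] Suc.prems False by (simp add: S_def n_def)
      qed
    qed
    also have "\<dots> = survival (Suc N) xs" by (simp add: survival_Suc)
    finally show ?case
      unfolding sum.lessThan_Suc_shift by (simp add: S_def n_def)
  qed
  have half: "1 / 2 \<le> survival N xs" if "separated r s B K xs" "d \<le> length xs" "alive xs" for N xs
  proof -
    have q: "0 \<le> 1 / p" "1 / p < 1" using p by auto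
    have "(\<Sum>j<N. C / B * (1 / p) ^ (length xs + j)) \<le> (\<Sum>j<N. C / B * (1 / p) ^ j)"
      using C B q by (intro sum_mono mult_left_mono power_decreasing) auto
    also have "\<dots> = C / B * ((1 - (1 / p) ^ N) / (1 - 1 / p))"
      unfolding sum_distrib_left[symmetric] sum_gp_strict using p by auto
    also have "\<dots> \<le> C / B * (1 / (1 - 1 / p))"
      using C B q by (intro mult_left_mono divide_right_mono) auto
    also have "\<dots> \<le> 1 / 2" by (rule B(3))
    finally show ?thesis using surv[OF that, of N] by linarith
  qed
  \<comment> \<open>Large enough for the separation at each of the first \<open>d\<close> stations,
    where \<open>1 + s ^ j \<le> 2\<close> and \<open>r ^ j \<le> r ^ d\<close>.\<close>
  define k where "k = nat \<lceil>2 * K * r ^ d\<rceil>"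
  have k: "2 * K * r ^ d \<le> real k" by (simp add: k_def real_nat_ceiling_ge)
  have sep: "j \<le> d \<Longrightarrow> separated r s B K (replicate j (0, k))" for j
  proof (induction j)
    case (Suc j)
    have sj: "0 < s ^ Suc j" "s ^ Suc j \<le> 1" using s power_le_one[of s "Suc j"] by auto
    have "K * (1 + s ^ Suc j) * r ^ Suc j \<le> K * 2 * r ^ d"
      using KB r(1) sj Suc.prems by (intro mult_mono power_increasing) auto
    then have "K * (1 + s ^ Suc j) * r ^ Suc j \<le> real k" using k by simp
    moreover have "0 \<le> B * (2 - s ^ Suc j) * r ^ Suc j" using B sj r(1) by simp
    ultimately show ?case using Suc by simp
  qed simp
  obtain c where c: "0 < c" "\<And>n. c * survival n (replicate d (0, k)) \<le> survival (d + n) []"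
    using survival_replicate[of d k] by blast
  show ?thesis
  proof (intro exI[of _ "c / 2"] conjI allI)
    fix n
    have "c * (1 / 2) \<le> c * survival n (replicate d (0, k))"
      using c(1) half[OF sep _ alive_replicate] by (intro mult_left_mono) auto
    also have "\<dots> \<le> survival (d + n) []" by (rule c(2))
    also have "\<dots> \<le> survival n []" using survival_decseq by (rule decseqD) simp
    finally show "c / 2 \<le> survival n []" by simp
  qed (use c in simp)
qed

end


section \<open>Disciplines with unbounded delay\<close>

text \<open>The solution of the recursion satisfied by the mean departure times of the first bus.\<close>

fun mean_time :: "(nat \<Rightarrow> nat) \<Rightarrow> real \<Rightarrow> real \<Rightarrow> nat \<Rightarrow> real" where
  "mean_time \<delta> \<tau> m 0 = 0"
| "mean_time \<delta> \<tau> m (Suc n) = mean_time \<delta> \<tau> m n + \<tau> +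
     m * (\<tau> + mean_time \<delta> \<tau> m n - mean_time \<delta> \<tau> m (n - (\<delta> (Suc n) - 1)))"

text \<open>The delayed term enters negatively, so values cannot be compared by induction.
  Increments can, because \<open>a n - a (n - b n)\<close> is a sum of earlier increments.\<close>

lemma delayed_recursion_le:
  fixes a h :: "nat \<Rightarrow> real"
  assumes "0 \<le> m"
    and a: "\<And>n. a (Suc n) \<le> a n + \<tau> + m * (\<tau> + a n - a (n - b n))"
    and h: "\<And>n. h (Suc n) = h n + \<tau> + m * (\<tau> + h n - h (n - b n))"
    and "i \<le> j"
  shows "a j - a i \<le> h j - h i"
proof -
  have inc: "a (Suc n) - a n \<le> h (Suc n) - h n" for n
  proof (induction n rule: less_induct)
    case (less n)
    have "a n - a (n - b n) = (\<Sum>k=n - b n..<n. a (Suc k) - a k)"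
      by (simp add: sum_Suc_diff')
    also have "\<dots> \<le> (\<Sum>k=n - b n..<n. h (Suc k) - h k)"
      using less by (intro sum_mono) auto
    also have "\<dots> = h n - h (n - b n)" by (simp add: sum_Suc_diff')
    finally have "m * (\<tau> + a n - a (n - b n)) \<le> m * (\<tau> + h n - h (n - b n))"
      using \<open>0 \<le> m\<close> by (intro mult_left_mono) auto
    then show ?case using a[of n] h[of n] by linarith
  qed
  have "a j - a i = (\<Sum>k=i..<j. a (Suc k) - a k)" using \<open>i \<le> j\<close> by (simp add: sum_Suc_diff')
  also have "\<dots> \<le> (\<Sum>k=i..<j. h (Suc k) - h k)" using inc by (intro sum_mono)
  also have "\<dots> = h j - h i" using \<open>i \<le> j\<close> by (simp add: sum_Suc_diff')
  finally show ?thesis .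
qed

text \<open>The relative losses telescope into \<open>l\<close>. Since \<open>l\<close> decreases,
  the factors of earlier increments may be lowered to \<open>l n\<close>, and
  \<open>c * l n \<le> 1\<close> takes care of the inhomogeneous term.\<close>

lemma delayed_recursion_ge:
  fixes a h l :: "nat \<Rightarrow> real"
  assumes "0 \<le> m" "0 \<le> \<tau>" "0 \<le> c"
    and a: "\<And>n. n0 \<le> n \<Longrightarrow> n < N \<Longrightarrow> l (Suc n) / l n * (\<tau> + m * (\<tau> + a n - a (n - b n))) \<le> a (Suc n) - a n"
    and h: "\<And>n. h (Suc n) = h n + \<tau> + m * (\<tau> + h n - h (n - b n))"
    and l: "\<And>n. 0 < l n" "\<And>n. l (Suc n) \<le> l n" "\<And>n. c * l n \<le> 1"
    and start: "\<And>n. n < n0 \<Longrightarrow> n < N \<Longrightarrow> c * l (Suc n) * (h (Suc n) - h n) \<le> a (Suc n) - a n"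
  shows "n < N \<Longrightarrow> c * l (Suc n) * (h (Suc n) - h n) \<le> a (Suc n) - a n"
proof (induction n rule: less_induct)
  case (less n)
  have l_anti: "l j \<le> l i" if "i \<le> j" for i j
    using that by (induction rule: dec_induct) (auto intro: order.trans[OF l(2)])
  have h_Suc: "h k \<le> h (Suc k)" for k
  proof (induction k rule: less_induct)
    case (less k)
    have "0 \<le> (\<Sum>i=k - b k..<k. h (Suc i) - h i)" using less by (intro sum_nonneg) auto
    then have "0 \<le> h k - h (k - b k)" by (simp add: sum_Suc_diff')
    then show ?case using h[of k] assms(1,2) by (simp add: add_increasing2)
  qed
  show ?case
  proof (cases "n < n0")
    case True
    then show ?thesis using start less.prems by simp
  next
    case False
    have "c * l n * (h n - h (n - b n)) = (\<Sum>k=n - b n..<n. c * l n * (h (Suc k) - h k))"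
      by (simp add: sum_distrib_left[symmetric] sum_Suc_diff')
    also have "\<dots> \<le> (\<Sum>k=n - b n..<n. a (Suc k) - a k)"
    proof (rule sum_mono)
      fix k assume k: "k \<in> {n - b n..<n}"
      have "c * l n * (h (Suc k) - h k) \<le> c * l (Suc k) * (h (Suc k) - h k)"
        using k l_anti[of "Suc k" n] h_Suc[of k] assms(3) by (intro mult_right_mono mult_left_mono) auto
      also have "\<dots> \<le> a (Suc k) - a k" using less k by simp
      finally show "c * l n * (h (Suc k) - h k) \<le> a (Suc k) - a k" .
    qed
    also have "\<dots> = a n - a (n - b n)" by (simp add: sum_Suc_diff')
    finally have A: "c * l n * (h n - h (n - b n)) \<le> a n - a (n - b n)" .
    have T: "c * l n * \<tau> \<le> \<tau>" using l(3)[of n] assms(2) mult_right_mono[of "c * l n" 1 \<tau>] by simp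
    have "c * l (Suc n) * (h (Suc n) - h n) = l (Suc n) / l n * (c * l n * \<tau> + m * (c * l n * \<tau> + c * l n * (h n - h (n - b n))))"
    proof -
      have e: "h (Suc n) - h n = \<tau> + m * (\<tau> + (h n - h (n - b n)))"
        using h[of n] by (simp add: algebra_simps)
      show ?thesis unfolding e using l(1)[of n] by (simp add: field_simps)
    qed
    also have "\<dots> \<le> l (Suc n) / l n * (\<tau> + m * (\<tau> + (a n - a (n - b n))))"
      using A T assms(1) l(1)[of n] l(1)[of "Suc n"] by (intro mult_left_mono add_mono) auto
    also have "\<dots> \<le> a (Suc n) - a n" using a[of n] False less.prems by (simp add: algebra_simps)
    finally show ?thesis .
  qed
qed

context two_buses
begin

section \<open>Mean departure times\<close>

definition m where "m = \<alpha> / (1 - \<alpha>)"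

abbreviation h where "h \<equiv> mean_time \<delta> \<tau> m"

abbreviation delay where "delay n \<equiv> \<delta> (Suc n) - 1"

lemma m_pos: "0 < m" using \<alpha> by (simp add: m_def)

lemma h_Suc: "h (Suc n) = h n + \<tau> + m * (\<tau> + h n - h (n - delay n))"
  by simp

lemma delay_le: "delay n \<le> n"
  using delta_bounds[of n] by simp

lemma h_increase: "h n + \<tau> \<le> h (Suc n)"
proof -
  have "0 - 0 \<le> h n - h (n - delay n)"
    by (rule delayed_recursion_le[of m "\<lambda>_. 0" \<tau> "\<lambda>n. delay n"]) (use m_pos \<tau> h_Suc in auto)
  then show ?thesis using m_pos \<tau> by (simp add: add_nonneg_nonneg)
qed

lemma h_mono: "i \<le> j \<Longrightarrow> h i \<le> h j"
proof (induction rule: dec_induct)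
  case (step n)
  then show ?case using h_increase[of n] \<tau> by linarith
qed simp

lemma h_ge: "\<tau> * real n \<le> h n"
proof (induction n)
  case (Suc n)
  then show ?case using h_increase[of n] by (simp add: algebra_simps)
qed simp

lemma h_nonneg: "0 \<le> h n"
  using h_mono[of 0 n] by simp

lemma earlier_eq: "earlier xs = drop (delay (length xs)) xs"
  by (simp add: earlier_def)

text \<open>Makes the mean departure time at an earlier station a value of the same sequence, so
  that the recursion of the means closes.\<close>

lemma map_drop_path: "k \<le> n \<Longrightarrow> map_pmf (drop k) (path n []) = path (n - k) []"
proof (induction k)
  case (Suc k)
  obtain j where j: "n - k = Suc j" using Suc.prems by (cases "n - k") auto
  have "map_pmf (drop (Suc k)) (path n []) = map_pmf tl (map_pmf (drop k) (path n []))"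
  proof -
    have "drop (Suc k) = (\<lambda>xs :: history. tl (drop k xs))" by (simp add: fun_eq_iff drop_Suc tl_drop)
    then show ?thesis by (simp add: pmf.map_comp comp_def)
  qed
  also have "\<dots> = map_pmf tl (path (Suc j) [])" using Suc j by simp
  also have "\<dots> = path j []"
    unfolding path_Suc_snoc by (simp add: map_bind_pmf pmf.map_comp comp_def bind_return_pmf')
  also have "j = n - Suc k" using j by simp
  finally show ?case .
qed (simp add: drop_0 map_pmf_ident)

text \<open>For the second bus the customers taken by the first one are ignored, which can only
  increase the window.\<close>

lemma nn_integral_time_next:
  "(\<integral>\<^sup>+y. ennreal (time1 (y # xs)) \<partial>measure_pmf (next_stop xs)) \<le>
     ennreal (time1 xs + \<tau> + m * (time1 xs + \<tau> - time1 (earlier xs)))"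
  "(\<integral>\<^sup>+y. ennreal (time2 (y # xs)) \<partial>measure_pmf (next_stop xs)) \<le>
     ennreal (time2 xs + \<tau> + m * (time2 xs + \<tau> - time2 (earlier xs)))"
proof -
  have t1: "0 \<le> time1 xs + \<tau>" using time1_nonneg[of xs] \<tau> by simp
  have t2: "0 \<le> time2 xs + \<tau>" using \<mu> \<tau> by (simp add: time2_def add_nonneg_nonneg)
  have "(\<integral>\<^sup>+y. ennreal (time1 (y # xs)) \<partial>measure_pmf (next_stop xs)) =
      (\<integral>\<^sup>+y. ennreal (time1 xs + \<tau>) + ennreal (real y) \<partial>measure_pmf (boarding \<alpha> (window1 xs)))"
    unfolding next_stop_def using t1 by (simp add: nn_integral_bind_pmf ennreal_plus[symmetric] del: ennreal_plus)
  also have "\<dots> \<le> ennreal (time1 xs + \<tau>) + ennreal (m * window1 xs)"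
    using nn_integral_boarding_le[OF \<alpha> window1_nonneg, of xs] by (simp add: nn_integral_add m_def add_left_mono)
  also have "\<dots> = ennreal (time1 xs + \<tau> + m * (time1 xs + \<tau> - time1 (earlier xs)))"
    using t1 m_pos window1_nonneg[of xs] by (simp add: ennreal_plus[symmetric] window1_def del: ennreal_plus)
  finally show "(\<integral>\<^sup>+y. ennreal (time1 (y # xs)) \<partial>measure_pmf (next_stop xs)) \<le>
     ennreal (time1 xs + \<tau> + m * (time1 xs + \<tau> - time1 (earlier xs)))" .
  have w: "0 \<le> time2 xs + \<tau> - time2 (earlier xs)"
    using time2_drop_le[of _ xs] \<tau> by (simp add: earlier_def add_increasing2)
  have "(\<integral>\<^sup>+y. ennreal (time2 (y # xs)) \<partial>measure_pmf (next_stop xs)) =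
      (\<integral>\<^sup>+y. \<integral>\<^sup>+z. ennreal (time2 xs + \<tau>) + ennreal (real z) \<partial>measure_pmf (boarding \<alpha> (window2 xs y))
        \<partial>measure_pmf (boarding \<alpha> (window1 xs)))"
    unfolding next_stop_def using t2 by (simp add: nn_integral_bind_pmf ennreal_plus[symmetric] del: ennreal_plus)
  also have "\<dots> \<le> (\<integral>\<^sup>+y. ennreal (time2 xs + \<tau>) + ennreal (m * (time2 xs + \<tau> - time2 (earlier xs)))
        \<partial>measure_pmf (boarding \<alpha> (window1 xs)))"
  proof (intro nn_integral_mono)
    fix y
    have "(\<integral>\<^sup>+z. ennreal (real z) \<partial>measure_pmf (boarding \<alpha> (window2 xs y))) \<le> ennreal (m * window2 xs y)"
      using nn_integral_boarding_le[OF \<alpha>, of "window2 xs y"] by (simp add: m_def)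
    also have "\<dots> \<le> ennreal (m * (time2 xs + \<tau> - time2 (earlier xs)))"
      using window2_le[of xs y] m_pos by (intro ennreal_leI mult_left_mono) auto
    finally show "(\<integral>\<^sup>+z. ennreal (time2 xs + \<tau>) + ennreal (real z) \<partial>measure_pmf (boarding \<alpha> (window2 xs y))) \<le>
        ennreal (time2 xs + \<tau>) + ennreal (m * (time2 xs + \<tau> - time2 (earlier xs)))"
      by (simp add: nn_integral_add add_left_mono)
  qed
  also have "\<dots> = ennreal (time2 xs + \<tau> + m * (time2 xs + \<tau> - time2 (earlier xs)))"
    using t2 w m_pos by (simp add: ennreal_plus[symmetric] del: ennreal_plus)
  finally show "(\<integral>\<^sup>+y. ennreal (time2 (y # xs)) \<partial>measure_pmf (next_stop xs)) \<le>
     ennreal (time2 xs + \<tau> + m * (time2 xs + \<tau> - time2 (earlier xs)))" .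
qed

text \<open>The mean of \<open>t\<close> satisfies the recursion of \<open>h\<close> as an
  inequality, and \<open>delayed_recursion_le\<close> compares increments. The function
  \<open>t\<close> is abstract because both buses have this property.\<close>

lemma mean_time_bound:
  fixes t :: "history \<Rightarrow> real"
  assumes t: "\<And>xs. 0 \<le> t xs" "\<And>k xs. t (drop k xs) \<le> t xs"
    and step: "\<And>xs. (\<integral>\<^sup>+y. ennreal (t (y # xs)) \<partial>measure_pmf (next_stop xs)) \<le>
      ennreal (t xs + \<tau> + m * (t xs + \<tau> - t (earlier xs)))"
  shows "integrable (measure_pmf (path n [])) t"
    and "measure_pmf.expectation (path n []) t \<le> t [] + h n"
proof -
  define e where "e n = measure_pmf.expectation (path n []) t" for n
  have e_drop: "measure_pmf.expectation (path n []) (\<lambda>xs. t (drop k xs)) = e (n - k)" if "k \<le> n" for n k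
    unfolding e_def map_drop_path[OF that, symmetric] by simp
  have int: "integrable (measure_pmf (path n [])) t" for n
  proof (induction n)
    case 0
    show ?case by (simp add: integrable_measure_pmf_finite)
  next
    case (Suc n)
    have "(\<integral>\<^sup>+xs. ennreal (t xs) \<partial>measure_pmf (path (Suc n) [])) \<le>
        (\<integral>\<^sup>+xs. ennreal (t xs + \<tau> + m * (t xs + \<tau>)) \<partial>measure_pmf (path n []))"
      unfolding path_Suc_snoc nn_integral_bind_pmf nn_integral_map_pmf
      using t m_pos by (intro nn_integral_mono order.trans[OF step] ennreal_leI) auto
    also have "\<dots> < \<infinity>"
      using Suc t \<tau> m_pos by (subst nn_integral_eq_integral) (auto simp: add_nonneg_nonneg)
    finally show ?case using t by (intro integrableI_nonneg) auto
  qed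
  then show "integrable (measure_pmf (path n [])) t" .
  have int_drop: "integrable (measure_pmf (path n [])) (\<lambda>xs. t (drop k xs))" for n k
    by (rule Bochner_Integration.integrable_bound[OF int]) (use t in auto)
  have rec: "e (Suc n) \<le> e n + \<tau> + m * (\<tau> + e n - e (n - delay n))" for n
  proof -
    let ?R = "\<lambda>xs. t xs + \<tau> + m * (t xs + \<tau> - t (drop (delay n) xs))"
    have Rint: "integrable (measure_pmf (path n [])) ?R" using int int_drop by auto
    have Rpos: "0 \<le> ?R xs" for xs using t \<tau> m_pos by (simp add: add_nonneg_nonneg add_increasing2)
    have "ennreal (e (Suc n)) = (\<integral>\<^sup>+xs. ennreal (t xs) \<partial>measure_pmf (path (Suc n) []))"
      unfolding e_def using int[of "Suc n"] t by (subst nn_integral_eq_integral) (auto simp del: path.simps)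
    also have "\<dots> \<le> (\<integral>\<^sup>+xs. ennreal (t xs + \<tau> + m * (t xs + \<tau> - t (earlier xs))) \<partial>measure_pmf (path n []))"
      unfolding path_Suc_snoc nn_integral_bind_pmf nn_integral_map_pmf
      by (intro nn_integral_mono step)
    also have "\<dots> = (\<integral>\<^sup>+xs. ennreal (?R xs) \<partial>measure_pmf (path n []))"
      by (rule nn_integral_cong_AE) (auto simp: AE_measure_pmf_iff earlier_eq length_path)
    also have "\<dots> = ennreal (measure_pmf.expectation (path n []) ?R)"
      using Rint Rpos by (intro nn_integral_eq_integral) auto
    finally have "e (Suc n) \<le> measure_pmf.expectation (path n []) ?R"
      using Rpos by (simp add: integral_nonneg_AE)
    also have "\<dots> = e n + \<tau> + m * (e n + \<tau> - e (n - delay n))"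
      using int int_drop e_drop[OF delay_le] by (simp add: e_def)
    finally show ?thesis by (simp add: algebra_simps)
  qed
  have "e n - e 0 \<le> h n - h 0"
    by (rule delayed_recursion_le[where b = "\<lambda>n. delay n", OF _ rec h_Suc]) (use m_pos in auto)
  then show "measure_pmf.expectation (path n []) t \<le> t [] + h n"
    by (simp add: e_def)
qed

lemmas time1_mean = mean_time_bound[of time1, OF time1_nonneg time1_drop_le nn_integral_time_next(1)]

lemma time2_nonneg: "0 \<le> time2 xs"
  using \<mu> \<tau> by (simp add: time2_def add_nonneg_nonneg)

lemmas time2_mean = mean_time_bound[of time2, OF time2_nonneg time2_drop_le nn_integral_time_next(2)]

text \<open>Markov's inequality. Together with \<open>h_ratio_tendsto\<close> it shows that the
  window of the first bus covers nearly its whole time of travel.\<close>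

lemma prob_earlier_gt:
  assumes "0 < a"
  shows "measure_pmf.prob (path n []) {xs. a \<le> time1 (earlier xs)} \<le> h (n - delay n) / a"
proof -
  have "measure_pmf.prob (path n []) {xs. a \<le> time1 (earlier xs)} =
      measure_pmf.prob (path n []) {xs. a \<le> time1 (drop (delay n) xs)}"
    by (rule measure_pmf.finite_measure_eq_AE) (auto simp: AE_measure_pmf_iff earlier_eq length_path)
  also have "\<dots> = measure_pmf.prob (map_pmf (drop (delay n)) (path n [])) {xs. a \<le> time1 xs}"
    by (simp add: vimage_def)
  also have "\<dots> = measure_pmf.prob (path (n - delay n) []) {xs. a \<le> time1 xs}"
    unfolding map_drop_path[OF delay_le] ..
  also have "\<dots> \<le> measure_pmf.expectation (path (n - delay n) []) time1 / a"
    using integral_Markov_inequality_measure[where A = "{}" and c = a, OF time1_mean(1)] time1_nonneg assms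
    by simp
  also have "\<dots> \<le> h (n - delay n) / a"
    using time1_mean(2)[of "n - delay n"] assms by (intro divide_right_mono) auto
  finally show ?thesis .
qed

text \<open>Once a window reaches back over \<open>D\<close> stops, \<open>h\<close> grows by a
  fixed factor at each stop; the ratio is then at most a power of its inverse with the delay as
  exponent.\<close>

lemma h_ratio_tendsto:
  assumes \<delta>: "filterlim \<delta> at_top sequentially"
  shows "(\<lambda>n. h (n - delay n) / h n) \<longlonglongrightarrow> 0"
proof -
  have delay: "filterlim (\<lambda>n. delay n) at_top sequentially"
    unfolding filterlim_at_top
  proof
    fix Z
    have "eventually (\<lambda>n. Suc Z \<le> \<delta> (Suc n)) sequentially"
      using filterlim_compose[OF \<delta> filterlim_Suc] by (simp add: filterlim_at_top)
    then show "eventually (\<lambda>n. Z \<le> delay n) sequentially" by eventually_elim simp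
  qed
  \<comment> \<open>If \<open>h\<close> has grown by the factor \<open>1 + \<eta>\<close> at
    \<open>D\<close> stops, the window carries about the fraction \<open>D * \<eta> / 2\<close> of
    \<open>h n\<close>; \<open>2 \<le> m * D\<close> reproduces the growth \<eta>.\<close>
  define D where "D = Suc (nat \<lceil>2 / m\<rceil>)"
  have "2 / m \<le> real D" unfolding D_def by linarith
  then have D: "1 \<le> D" "2 \<le> m * real D" using m_pos by (simp_all add: D_def field_simps)
  obtain n1 where n1: "\<And>n. n1 \<le> n \<Longrightarrow> D \<le> delay n"
    using delay by (auto simp: filterlim_at_top eventually_sequentially)
  \<comment> \<open>The first term gives \<open>D * \<eta> \<le> 1\<close>, the second one secures
    the growth at stations before \<open>n1\<close> by the travel time alone.\<close>
  define \<eta> where "\<eta> = min (1 / real D) (\<tau> / (h n1 + 1))"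
  have \<eta>: "0 < \<eta>" "\<eta> * real D \<le> 1" "\<eta> * (h n1 + 1) \<le> \<tau>"
  proof -
    have hn: "0 < h n1 + 1" using h_nonneg[of n1] by simp
    have le: "\<eta> \<le> 1 / real D" "\<eta> \<le> \<tau> / (h n1 + 1)" by (simp_all add: \<eta>_def)
    show "0 < \<eta>" using D \<tau> hn by (simp add: \<eta>_def)
    show "\<eta> * real D \<le> 1" using le(1) D by (simp add: pos_le_divide_eq)
    show "\<eta> * (h n1 + 1) \<le> \<tau>" using le(2) hn by (simp only: pos_le_divide_eq)
  qed
  have grow: "(1 + \<eta>) * h n \<le> h (Suc n)" for n
  proof (induction n rule: less_induct)
    case (less n)
    show ?case
    proof (cases "n < n1")
      case True
      then have "\<eta> * h n \<le> \<eta> * (h n1 + 1)" using \<eta> h_mono[of n n1] by (intro mult_left_mono) auto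
      then have "(1 + \<eta>) * h n \<le> h n + \<tau>" using \<eta>(3) by (simp add: distrib_right)
      then show ?thesis using h_increase[of n] by linarith
    next
      case False
      then have Dn: "D \<le> delay n" "D \<le> n" using n1[of n] delay_le[of n] by auto
      define H where "H = h n"
      define G where "G = h (n - D)"
      have "(1 + \<eta>) ^ k * G \<le> h (n - D + k)" if "k \<le> D" for k
        using that
      proof (induction k)
        case (Suc k)
        have "(1 + \<eta>) * ((1 + \<eta>) ^ k * G) \<le> (1 + \<eta>) * h (n - D + k)"
          using Suc \<eta> by (intro mult_left_mono) auto
        also have "\<dots> \<le> h (Suc (n - D + k))" using Suc.prems Dn by (intro less) auto
        finally show ?case by (simp only: power_Suc mult.assoc add_Suc_right)
      qed (simp add: G_def)
      from this[of D] have "(1 + \<eta>) ^ D * G \<le> H" using Dn by (simp add: H_def)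
      moreover have "(1 + real D * \<eta>) * G \<le> (1 + \<eta>) ^ D * G"
        using Bernoulli_inequality[of \<eta> D] \<eta> h_nonneg[of "n - D"] by (intro mult_right_mono) (auto simp: G_def)
      ultimately have GH: "(1 + real D * \<eta>) * G \<le> H" by linarith
      define x where "x = real D * \<eta>"
      have x: "0 \<le> x" "x \<le> 1" using \<eta> by (auto simp: x_def mult.commute)
      \<comment> \<open>Replaces division by \<open>1 + x\<close>: for \<open>x\<close> in the unit
        interval, \<open>1 / (1 + x) \<le> 1 - x / 2\<close>.\<close>
      have "G * 1 \<le> G * ((1 + x) * (1 - x / 2))"
      proof (intro mult_left_mono)
        have "x * x \<le> x * 1" using x by (intro mult_left_mono) auto
        then show "1 \<le> (1 + x) * (1 - x / 2)" by (simp add: algebra_simps)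
      qed (simp add: G_def h_nonneg)
      also have "\<dots> = (1 + x) * G * (1 - x / 2)" by (simp add: mult_ac)
      also have "\<dots> \<le> H * (1 - x / 2)" using GH x by (intro mult_right_mono) (auto simp: x_def)
      finally have "H * (x / 2) \<le> H - G" by (simp add: algebra_simps)
      also have "\<dots> \<le> h n - h (n - delay n)"
        unfolding H_def G_def using Dn by (intro diff_left_mono h_mono) auto
      finally have "m * (H * (x / 2)) \<le> m * (h n - h (n - delay n))"
        using m_pos by (intro mult_left_mono) auto
      moreover have "\<eta> * H \<le> m * (H * (x / 2))"
      proof -
        have "2 * (\<eta> * H) \<le> m * real D * (\<eta> * H)"
          using D \<eta> h_nonneg[of n] by (intro mult_right_mono) (auto simp: H_def)
        then show ?thesis by (simp add: x_def mult_ac)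
      qed
      moreover have "0 \<le> \<tau> + m * \<tau>" using \<tau> m_pos by simp
      moreover have "h (Suc n) = H + (\<tau> + m * \<tau>) + m * (h n - h (n - delay n))"
        using h_Suc[of n] by (simp only: H_def) (simp add: algebra_simps)
      moreover have "(1 + \<eta>) * h n = H + \<eta> * H" by (simp add: H_def algebra_simps)
      ultimately show ?thesis by linarith
    qed
  qed
  have iter: "(1 + \<eta>) ^ k * h n \<le> h (n + k)" for n k
  proof (induction k)
    case (Suc k)
    have "(1 + \<eta>) * ((1 + \<eta>) ^ k * h n) \<le> (1 + \<eta>) * h (n + k)"
      using Suc \<eta> by (intro mult_left_mono) auto
    also have "\<dots> \<le> h (Suc (n + k))" by (rule grow)
    finally show ?case by (simp only: power_Suc mult.assoc add_Suc_right)
  qed simp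
  have bound: "h (n - delay n) / h n \<le> (1 / (1 + \<eta>)) ^ delay n" if "1 \<le> n" for n
  proof -
    have "0 < \<tau> * real n" using that \<tau> by simp
    then have "0 < h n" using h_ge[of n] by linarith
    moreover have "(1 + \<eta>) ^ delay n * h (n - delay n) \<le> h n"
      using iter[of "delay n" "n - delay n"] delay_le[of n] by simp
    ultimately show ?thesis using \<eta>(1) by (simp add: power_one_over field_simps)
  qed
  have lim: "(\<lambda>n. (1 / (1 + \<eta>)) ^ delay n) \<longlonglongrightarrow> 0"
    by (rule filterlim_compose[OF LIMSEQ_realpow_zero delay]) (use \<eta> in auto)
  show ?thesis
  proof (rule tendsto_sandwich[OF _ _ tendsto_const lim])
    show "eventually (\<lambda>n. 0 \<le> h (n - delay n) / h n) sequentially"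
      by (rule always_eventually) (simp add: h_nonneg)
    show "eventually (\<lambda>n. h (n - delay n) / h n \<le> (1 / (1 + \<eta>)) ^ delay n) sequentially"
      using eventually_ge_at_top[of 1] by eventually_elim (rule bound)
  qed
qed

lemma path_add: "path (k + n) xs = bind_pmf (path k xs) (path n)"
  by (induction k arbitrary: xs) (simp_all add: bind_return_pmf bind_assoc_pmf)

section \<open>Lower bounds for the first bus\<close>

lemma prob_next_stop_fst:
  "measure_pmf.prob (next_stop xs) {y. P (fst y)} = measure_pmf.prob (boarding \<alpha> (window1 xs)) {y. P y}"
proof -
  have "Pair y -` {y. P (fst y)} = (if P y then UNIV else {})" for y :: nat by auto
  then have "measure_pmf.prob (next_stop xs) {y. P (fst y)} =
      measure_pmf.expectation (boarding \<alpha> (window1 xs)) (indicator {y. P y})"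
    unfolding next_stop_def prob_bind_pmf
    by (intro Bochner_Integration.integral_cong) (auto simp: indicator_def)
  then show ?thesis by simp
qed

text \<open>Allows for relative losses which are summable over the stations.\<close>

definition slack :: "nat \<Rightarrow> real \<Rightarrow> nat \<Rightarrow> real" where
  "slack n0 s n = 1 + s ^ (n - n0)"

text \<open>From station \<open>n0\<close> on, the first bus never falls much behind its conditional mean.\<close>

fun on_track :: "nat \<Rightarrow> real \<Rightarrow> history \<Rightarrow> bool" where
  "on_track n0 s [] \<longleftrightarrow> True"
| "on_track n0 s (y # xs) \<longleftrightarrow>
     (n0 \<le> length xs \<longrightarrow>
       slack n0 s (Suc (length xs)) / slack n0 s (length xs) * (\<tau> + m * window1 xs) \<le> \<tau> + real (fst y)) \<and>
     on_track n0 s xs"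

lemma on_track_drop: "on_track n0 s xs \<Longrightarrow> on_track n0 s (drop k xs)"
proof (induction xs arbitrary: k)
  case (Cons y xs)
  then show ?case by (cases k) auto
qed simp

lemma slack_props:
  assumes "0 < s" "s < 1"
  shows "1 \<le> slack n0 s n" "slack n0 s n \<le> 2" "slack n0 s (Suc n) \<le> slack n0 s n"
    "1 / 2 \<le> slack n0 s (Suc n) / slack n0 s n" "1 - s ^ (n - n0) \<le> slack n0 s (Suc n) / slack n0 s n"
    "n0 \<le> n \<Longrightarrow> slack n0 s (Suc n) / slack n0 s n \<le> 1 - s ^ (n - n0) * (1 - s) / 2"
proof -
  have p: "0 < s ^ k" "s ^ k \<le> 1" for k using assms power_le_one[of s k] by auto
  show 1: "1 \<le> slack n0 s n" and 2: "slack n0 s n \<le> 2" for n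
    using p[of "n - n0"] by (auto simp: slack_def)
  show "slack n0 s (Suc n) \<le> slack n0 s n"
    using assms by (auto simp: slack_def intro!: power_decreasing)
  show "1 / 2 \<le> slack n0 s (Suc n) / slack n0 s n"
    using frac_le[of "slack n0 s (Suc n)" 1 "slack n0 s n" 2] 1[of "Suc n"] 1[of n] 2[of n] by simp
  show "1 - s ^ (n - n0) \<le> slack n0 s (Suc n) / slack n0 s n"
  proof -
    have "(1 - s ^ (n - n0)) * slack n0 s n \<le> 1"
      by (simp add: slack_def algebra_simps)
    then show ?thesis using 1[of n] 1[of "Suc n"] by (simp add: pos_le_divide_eq)
  qed
  show "slack n0 s (Suc n) / slack n0 s n \<le> 1 - s ^ (n - n0) * (1 - s) / 2" if "n0 \<le> n"
  proof -
    define z where "z = s ^ (n - n0)"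
    have z: "0 < z" "z \<le> 1" using p by (auto simp: z_def)
    have e: "slack n0 s (Suc n) = 1 + s * z" "slack n0 s n = 1 + z"
      using that by (auto simp: slack_def z_def Suc_diff_le)
    have "z * (1 - s) * (1 + z) \<le> z * (1 - s) * 2" using z assms by (intro mult_left_mono) auto
    then have "1 + s * z \<le> (1 - z * (1 - s) / 2) * (1 + z)" by (simp add: field_simps)
    then show ?thesis unfolding e z_def[symmetric] using z by (simp add: pos_divide_le_eq)
  qed
qed

lemma time1_drop_ge:
  assumes "j \<le> length xs" "\<And>k. k < j \<Longrightarrow> c \<le> \<tau> + real (fst (xs ! k))"
  shows "real j * c \<le> time1 xs - time1 (drop j xs)"
  using assms
proof (induction j)
  case (Suc j)
  have "drop j xs = xs ! j # drop (Suc j) xs" using Suc.prems by (simp add: Cons_nth_drop_Suc)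
  then have "time1 (drop j xs) = time1 (drop (Suc j) xs) + \<tau> + real (fst (xs ! j))" by simp
  then show ?case using Suc by (simp add: algebra_simps) (smt (verit) lessI)
qed simp

lemma window1_ge_delta: "\<tau> * real (\<delta> (Suc (length xs))) \<le> window1 xs"
proof -
  have "real (delay (length xs)) * \<tau> \<le> time1 xs - time1 (drop (delay (length xs)) xs)"
    using delay_le by (intro time1_drop_ge) auto
  then show ?thesis
    using delta_bounds[of "length xs"] by (simp add: window1_def earlier_eq of_nat_diff algebra_simps)
qed

text \<open>The bound at each of the last \<open>D - 1\<close> stations is at least half the current
  one, as \<open>\<kappa> ^ D = 2\<close>. With \<open>8 \<le> m * (D - 1)\<close> the mean is then
  at least four times the current bound, of which the slack leaves half, and this is more than the
  growth \<kappa> demands.\<close>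

lemma on_track_growth:
  assumes s: "0 < s" "s < 1" and \<kappa>: "1 < \<kappa>" "\<kappa> ^ D = 2" "\<kappa> \<le> 2"
    and D: "8 \<le> m * real (D - 1)" "\<And>n. n0 \<le> n \<Longrightarrow> D \<le> \<delta> (Suc n)"
  shows "on_track n0 s xs \<Longrightarrow> k < length xs \<Longrightarrow> \<tau> * \<kappa> ^ (length xs - k - n0) \<le> \<tau> + real (fst (xs ! k))"
    and "on_track n0 s xs \<Longrightarrow> n0 \<le> length xs \<Longrightarrow> real (D - 1) * (\<tau> * \<kappa> ^ (length xs - n0) / 2) \<le> window1 xs"
proof -
  have win: "real (D - 1) * (\<tau> * \<kappa> ^ (length xs - n0) / 2) \<le> window1 xs"
    if P: "\<And>k. k < length xs \<Longrightarrow> \<tau> * \<kappa> ^ (length xs - k - n0) \<le> \<tau> + real (fst (xs ! k))" and n: "n0 \<le> length xs" for xs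
  proof -
    have D': "D - 1 \<le> delay (length xs)" "D - 1 \<le> length xs"
      using D(2)[OF n] delay_le[of "length xs"] by auto
    have "real (D - 1) * (\<tau> * \<kappa> ^ (length xs - n0) / 2) \<le> time1 xs - time1 (drop (D - 1) xs)"
    proof (rule time1_drop_ge[OF D'(2)])
      fix k assume k: "k < D - 1"
      have "\<kappa> ^ (length xs - n0) \<le> \<kappa> ^ ((length xs - k - n0) + D)"
        using k \<kappa> by (intro power_increasing) auto
      then have "\<kappa> ^ (length xs - n0) / 2 \<le> \<kappa> ^ (length xs - k - n0)" by (simp add: power_add \<kappa>(2))
      then have "\<tau> * (\<kappa> ^ (length xs - n0) / 2) \<le> \<tau> * \<kappa> ^ (length xs - k - n0)" using \<tau> by (intro mult_left_mono) auto
      also have "\<dots> \<le> \<tau> + real (fst (xs ! k))" using k D' by (intro P) auto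
      finally show "\<tau> * \<kappa> ^ (length xs - n0) / 2 \<le> \<tau> + real (fst (xs ! k))" by simp
    qed
    also have "\<dots> \<le> window1 xs"
    proof -
      have "drop (delay (length xs)) xs = drop (delay (length xs) - (D - 1)) (drop (D - 1) xs)"
        using D'(1) by (simp only: drop_drop le_add_diff_inverse2)
      then have "time1 (earlier xs) \<le> time1 (drop (D - 1) xs)"
        unfolding earlier_eq using time1_drop_le by metis
      then show ?thesis using \<tau> by (simp add: window1_def)
    qed
    finally show ?thesis .
  qed
  have P: "on_track n0 s xs \<Longrightarrow> k < length xs \<Longrightarrow> \<tau> * \<kappa> ^ (length xs - k - n0) \<le> \<tau> + real (fst (xs ! k))" for xs k
  proof (induction xs arbitrary: k)
    case (Cons y xs)
    show ?case
    proof (cases k)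
      case 0
      show ?thesis
      proof (cases "n0 \<le> length xs")
        case True
        define w where "w = window1 xs"
        define K where "K = \<kappa> ^ (length xs - n0)"
        have "real (D - 1) * (\<tau> * K / 2) \<le> w"
          unfolding K_def w_def using Cons True by (intro win) auto
        then have "m * (real (D - 1) * (\<tau> * K / 2)) \<le> m * w" using m_pos by (intro mult_left_mono) auto
        moreover have "8 * (\<tau> * K / 2) \<le> m * real (D - 1) * (\<tau> * K / 2)"
          by (rule mult_right_mono[OF D(1)]) (use \<tau> \<kappa> in \<open>simp add: K_def\<close>)
        ultimately have w: "4 * (\<tau> * K) \<le> m * w" by (simp add: mult_ac)
        have w0: "0 \<le> \<tau> + m * w" using \<tau> m_pos window1_nonneg[of xs] by (simp add: w_def add_nonneg_nonneg)
        have "\<tau> * \<kappa> ^ (length (y # xs) - k - n0) = \<kappa> * (\<tau> * K)"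
          using True 0 by (simp add: K_def Suc_diff_le mult_ac)
        also have "\<dots> \<le> 2 * (\<tau> * K)" using \<kappa> \<tau> by (intro mult_right_mono) (auto simp: K_def)
        also have "\<dots> \<le> 1 / 2 * (\<tau> + m * w)" using w \<tau> by simp
        also have "\<dots> \<le> slack n0 s (Suc (length xs)) / slack n0 s (length xs) * (\<tau> + m * w)"
          using slack_props(4)[OF s] w0 by (intro mult_right_mono) auto
        also have "\<dots> \<le> \<tau> + real (fst y)" using Cons.prems(1) True by (simp add: w_def)
        finally show ?thesis using 0 by simp
      qed (use 0 in simp)
    next
      case (Suc k')
      then show ?thesis using Cons by simp
    qed
  qed simp
  show "on_track n0 s xs \<Longrightarrow> k < length xs \<Longrightarrow> \<tau> * \<kappa> ^ (length xs - k - n0) \<le> \<tau> + real (fst (xs ! k))"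
    by (rule P)
  show "on_track n0 s xs \<Longrightarrow> n0 \<le> length xs \<Longrightarrow> real (D - 1) * (\<tau> * \<kappa> ^ (length xs - n0) / 2) \<le> window1 xs"
    by (rule win) (rule P)
qed

text \<open>On track, windows grow geometrically, so a relative loss of order \<open>s ^ k\<close>
  fails with geometrically small probability. Starting where the delay is large makes the sum of
  these probabilities small.\<close>

lemma on_track_likely:
  assumes \<delta>: "filterlim \<delta> at_top sequentially" and "0 < \<eta>"
  shows "\<exists>n0 s. 0 < s \<and> s < 1 \<and> (\<forall>n. measure_pmf.prob (path n []) {xs. \<not> on_track n0 s xs} \<le> \<eta>)"
proof -
  \<comment> \<open>The 8 is that of \<open>on_track_growth\<close>; the added 3 gives
    \<open>2 \<le> D - 1\<close>, used in the second bound of the window.\<close>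
  define D where "D = nat \<lceil>8 / m\<rceil> + 3"
  have D3: "3 \<le> D" by (simp add: D_def)
  have "8 / m \<le> real (D - 1)" unfolding D_def by linarith
  then have "8 \<le> real (D - 1) * m" using m_pos by (simp only: pos_divide_le_eq)
  then have D8: "8 \<le> m * real (D - 1)" by (simp only: mult.commute)
  \<comment> \<open>The square root of \<kappa>, since the window will be bounded below by a
    geometric mean of \<open>\<tau> * R\<^sup>2\<close> and
    \<open>\<tau> * \<kappa> ^ k\<close>.\<close>
  define q where "q = root (2 * D) 2"
  have q1: "1 < q" unfolding q_def using D3 by (simp add: real_root_gt_1_iff)
  have q2D: "q ^ (2 * D) = 2" unfolding q_def using D3 by (intro real_root_pow_pos2) auto
  define \<kappa> where "\<kappa> = q\<^sup>2"
  have \<kappa>: "1 < \<kappa>" "\<kappa> ^ D = 2" "\<kappa> \<le> 2"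
  proof -
    show "1 < \<kappa>" unfolding \<kappa>_def using q1 by (intro one_less_power) auto
    show "\<kappa> ^ D = 2" unfolding \<kappa>_def using q2D by (simp add: power_mult)
    have "q\<^sup>2 \<le> q ^ (2 * D)" using q1 D3 by (intro power_increasing) auto
    then show "\<kappa> \<le> 2" by (simp add: \<kappa>_def q2D)
  qed
  \<comment> \<open>As in the supercritical case, with the rate \<open>q\<close>: the squared loss
    times the window grows like \<open>p ^ k\<close>, where \<open>p\<close> is the square root of
    \<open>q\<close>.\<close>
  define s where "s = 1 / sqrt (sqrt q)"
  define p where "p = s\<^sup>2 * q"
  have s: "0 < s" "s < 1" using q1 by (auto simp: s_def)
  have "s\<^sup>2 = 1 / sqrt q" using q1 by (simp add: s_def power_divide)
  then have "p = sqrt q" using q1 by (simp add: p_def real_div_sqrt)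
  then have p: "1 < p" using q1 by simp
  define \<kappa>2 where "\<kappa>2 = (1 - \<alpha>)\<^sup>2 / (2 * m)"
  have \<kappa>2: "0 < \<kappa>2" using \<alpha> m_pos by (simp add: \<kappa>2_def)
  define c where "c = m\<^sup>2 * (1 - s)\<^sup>2 * \<tau> / 4"
  have c: "0 < c" using m_pos s \<tau> by (simp add: c_def)
  define C where "C = 1 / (\<kappa>2 * c) * (1 / (1 - 1 / p))"
  have C: "0 < C" using \<kappa>2 c p by (simp add: C_def)
  \<comment> \<open>The failure probabilities add up to at most \<open>C / R\<close>.\<close>
  define R where "R = max 1 (C / \<eta>)"
  have R: "1 \<le> R" "C / R \<le> \<eta>"
  proof -
    show R1: "1 \<le> R" by (simp add: R_def)
    have "C / \<eta> \<le> R" by (simp add: R_def)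
    then show "C / R \<le> \<eta>" using R1 \<open>0 < \<eta>\<close> by (simp add: field_simps)
  qed
  have "eventually (\<lambda>n. max D (nat \<lceil>R\<^sup>2\<rceil>) \<le> \<delta> (Suc n)) sequentially"
    using filterlim_compose[OF \<delta> filterlim_Suc] unfolding filterlim_at_top by blast
  then obtain n0 where n0: "\<And>n. n0 \<le> n \<Longrightarrow> max D (nat \<lceil>R\<^sup>2\<rceil>) \<le> \<delta> (Suc n)"
    by (auto simp: eventually_sequentially)
  have nD: "D \<le> \<delta> (Suc n)" if "n0 \<le> n" for n using n0[OF that] by simp
  have nR: "R\<^sup>2 \<le> real (\<delta> (Suc n))" if "n0 \<le> n" for n
  proof -
    have "R\<^sup>2 \<le> real (nat \<lceil>R\<^sup>2\<rceil>)" by (rule real_nat_ceiling_ge)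
    also have "\<dots> \<le> real (\<delta> (Suc n))" using n0[OF that] by (simp only: of_nat_le_iff max.bounded_iff)
    finally show ?thesis .
  qed
  define f where "f n = (if n0 \<le> n then 1 / (\<kappa>2 * c * R) * (1 / p) ^ (n - n0) else 0)" for n
  have f: "0 \<le> f n" for n using \<kappa>2 c R p by (simp add: f_def)
  have fail: "measure_pmf.prob (next_stop xs) {y. \<not> on_track n0 s (y # xs)} \<le> f (length xs)"
    if ot: "on_track n0 s xs" for xs
  proof (cases "n0 \<le> length xs")
    case False
    then have "{y. \<not> on_track n0 s (y # xs)} = {}" using ot by simp
    then show ?thesis using f by simp
  next
    case True
    define k where "k = length xs - n0"
    define w where "w = window1 xs"
    define e where "e = s ^ k * (1 - s) / 2"
    define t where "t = e * (m * w)"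
    have w_pos: "0 < w" using window1_ge[of xs] \<tau> by (simp add: w_def)
    have e: "0 < e" using s by (simp add: e_def)
    have t0: "0 \<le> t" using e m_pos w_pos by (simp add: t_def)
    \<comment> \<open>Two bounds are combined: the long delay makes the window large already at
      \<open>n0\<close>, and the growth makes it increase with \<open>k\<close>.\<close>
    have w_ge: "\<tau> * R * q ^ k \<le> w"
    proof (rule power2_le_imp_le)
      have "\<tau> * R\<^sup>2 \<le> \<tau> * real (\<delta> (Suc (length xs)))" using nR[OF True] \<tau> by (intro mult_left_mono) auto
      also have "\<dots> \<le> w" unfolding w_def by (rule window1_ge_delta)
      finally have w1: "\<tau> * R\<^sup>2 \<le> w" .
      have "2 * (\<tau> * \<kappa> ^ k / 2) \<le> real (D - 1) * (\<tau> * \<kappa> ^ k / 2)"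
        using D3 \<tau> \<kappa> by (intro mult_right_mono) auto
      also have "\<dots> \<le> w" unfolding k_def w_def by (rule on_track_growth(2)[OF s \<kappa> D8 nD ot True])
      finally have w2: "\<tau> * \<kappa> ^ k \<le> w" by simp
      have "(\<tau> * R * q ^ k)\<^sup>2 = (\<tau> * R\<^sup>2) * (\<tau> * \<kappa> ^ k)"
        by (simp add: \<kappa>_def power_mult_distrib power2_eq_square power_mult[symmetric] mult_ac)
      also have "\<dots> \<le> w * w" using w1 w2 w_pos \<tau> \<kappa> by (intro mult_mono) auto
      finally show "(\<tau> * R * q ^ k)\<^sup>2 \<le> w\<^sup>2" by (simp add: power2_eq_square)
    qed (use w_pos in simp)
    have "measure_pmf.prob (next_stop xs) {y. \<not> on_track n0 s (y # xs)} =
        measure_pmf.prob (boarding \<alpha> w) {y. \<not> slack n0 s (Suc (length xs)) / slack n0 s (length xs) * (\<tau> + m * w) \<le> \<tau> + real y}"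
      using prob_next_stop_fst[of xs "\<lambda>y. \<not> slack n0 s (Suc (length xs)) / slack n0 s (length xs) * (\<tau> + m * w) \<le> \<tau> + real y"] ot True
      by (simp add: w_def)
    also have "\<dots> \<le> measure_pmf.prob (boarding \<alpha> w) {y. real y \<le> m * w - t}"
    proof (rule measure_pmf.finite_measure_mono)
      have "slack n0 s (Suc (length xs)) / slack n0 s (length xs) * (\<tau> + m * w) \<le> (1 - e) * (\<tau> + m * w)"
        using slack_props(6)[OF s True] \<tau> m_pos w_pos unfolding e_def k_def by (intro mult_right_mono) auto
      also have "\<dots> \<le> \<tau> + (m * w - t)"
        using e \<tau> by (simp add: t_def algebra_simps)
      finally show "{y. \<not> slack n0 s (Suc (length xs)) / slack n0 s (length xs) * (\<tau> + m * w) \<le> \<tau> + real y} \<subseteq> {y. real y \<le> m * w - t}"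
        by auto
    qed simp
    also have "\<dots> \<le> exp (- \<kappa>2 * t\<^sup>2 / w)"
      using boarding_lower_tail[OF \<alpha> w_pos order_refl t0] unfolding \<kappa>2_def m_def .
    also have "\<dots> \<le> 1 / (\<kappa>2 * c * (R * p ^ k))"
    proof (rule deviation_bound)
      have "c * (R * p ^ k) * w = m\<^sup>2 * e\<^sup>2 * (\<tau> * R * q ^ k) * w"
        by (simp add: c_def e_def p_def power_mult_distrib power_divide power2_eq_square mult_ac)
      also have "\<dots> \<le> m\<^sup>2 * e\<^sup>2 * w * w"
        using w_ge w_pos by (intro mult_right_mono mult_left_mono) auto
      also have "\<dots> = t\<^sup>2" by (simp add: t_def power2_eq_square)
      finally show "c * (R * p ^ k) * w \<le> t\<^sup>2" .
    qed (use \<kappa>2 c R p w_pos in auto)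
    also have "\<dots> = f (length xs)" using True by (simp add: f_def k_def power_one_over)
    finally show ?thesis .
  qed
  have "measure_pmf.prob (path n []) {xs. \<not> on_track n0 s xs} \<le> (\<Sum>j<n. f j)" for n
  proof (induction n)
    case (Suc n)
    have "measure_pmf.prob (path (Suc n) []) {xs. \<not> on_track n0 s xs} =
        measure_pmf.expectation (path n []) (\<lambda>xs. measure_pmf.prob (next_stop xs) {y. \<not> on_track n0 s (y # xs)})"
      unfolding path_Suc_snoc prob_bind_pmf by (simp add: vimage_def)
    also have "\<dots> \<le> measure_pmf.expectation (path n []) (\<lambda>xs. indicator {xs. \<not> on_track n0 s xs} xs + f n)"
    proof (rule expectation_pmf_mono[where C = 1 and D = "1 + f n"])
      show "\<bar>indicator {xs. \<not> on_track n0 s xs} xs + f n\<bar> \<le> 1 + f n" for xs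
        using f[of n] by (simp add: indicator_def)
      fix xs assume "xs \<in> set_pmf (path n [])"
      then have len: "length xs = n" using length_path[of xs n "[]"] by simp
      show "measure_pmf.prob (next_stop xs) {y. \<not> on_track n0 s (y # xs)} \<le> indicator {xs. \<not> on_track n0 s xs} xs + f n"
        using fail[of xs] f[of n] len by (cases "on_track n0 s xs") (auto intro: add_increasing2)
    qed simp
    also have "\<dots> = measure_pmf.prob (path n []) {xs. \<not> on_track n0 s xs} + f n"
      by (subst Bochner_Integration.integral_add) (auto intro!: integrable_pmf_bounded[where C = 1])
    finally show ?case using Suc by simp
  qed simp
  moreover have "(\<Sum>j<n. f j) \<le> \<eta>" for n
  proof -
    have q: "0 \<le> 1 / p" "1 / p < 1" "1 / p \<noteq> 1" using p by auto
    have "(\<Sum>j<n. f j) \<le> (\<Sum>j<n0 + n. f j)" using f by (intro sum_mono2) auto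
    also have "\<dots> = (\<Sum>j=n0..<n0 + n. f j)"
      by (rule sum.mono_neutral_right) (auto simp: f_def)
    also have "\<dots> = (\<Sum>j<n. f (j + n0))"
      using sum.shift_bounds_nat_ivl[of f 0 n0 n] by (simp add: atLeast0LessThan add.commute)
    also have "\<dots> = (\<Sum>j<n. 1 / (\<kappa>2 * c * R) * (1 / p) ^ j)" by (simp add: f_def)
    also have "\<dots> = 1 / (\<kappa>2 * c * R) * ((1 - (1 / p) ^ n) / (1 - 1 / p))"
      unfolding sum_distrib_left[symmetric] sum_gp_strict using p by simp
    also have "\<dots> \<le> 1 / (\<kappa>2 * c * R) * (1 / (1 - 1 / p))"
      using q \<kappa>2 c R by (intro mult_left_mono divide_right_mono) auto
    also have "\<dots> = C / R" by (simp add: C_def)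
    finally show ?thesis using R by simp
  qed
  ultimately show ?thesis using s by (meson order.trans)
qed

text \<open>The departure times along a history on track satisfy the hypothesis of
  \<open>delayed_recursion_ge\<close>; the slack stays between 1 and 2, so comparison with
  \<open>h\<close> costs only a constant factor.\<close>

lemma on_track_time1_ge:
  assumes s: "0 < s" "s < 1"
  shows "\<exists>c>0. \<forall>xs. on_track n0 s xs \<longrightarrow> c * h (length xs) \<le> time1 xs"
proof -
  \<comment> \<open>1/2 balances the bound 2 of the slack; the other term lets the travel time alone
    settle the stations before \<open>n0\<close>.\<close>
  define c where "c = min (1 / 2) (\<tau> / (2 * (h n0 + 1)))"
  have hn: "0 < 2 * (h n0 + 1)" using h_nonneg[of n0] by simp
  have c: "0 < c" "2 * c \<le> 1" using \<tau> hn by (auto simp: c_def)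
  have "c \<le> \<tau> / (2 * (h n0 + 1))" by (simp add: c_def)
  then have c2: "c * (2 * (h n0 + 1)) \<le> \<tau>" using hn by (simp only: pos_le_divide_eq)
  have "c * h (length xs) \<le> time1 xs" if ot: "on_track n0 s xs" for xs
  proof -
    define N where "N = length xs"
    define a where "a j = time1 (drop (N - j) xs)" for j
    have drop_eq: "drop (N - Suc n) xs = xs ! (N - Suc n) # drop (N - n) xs" if "n < N" for n
      using that Cons_nth_drop_Suc[of "N - Suc n" xs] by (simp add: N_def Suc_diff_Suc)
    have a_inc: "a (Suc n) - a n = \<tau> + real (fst (xs ! (N - Suc n)))" if "n < N" for n
      using drop_eq[OF that] by (simp add: a_def)
    have inc: "c * slack n0 s (Suc n) * (h (Suc n) - h n) \<le> a (Suc n) - a n" if "n < N" for n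
    proof (rule delayed_recursion_ge[where m = m and \<tau> = \<tau> and l = "slack n0 s" and b = "\<lambda>n. delay n" and N = N and ?n0.0 = n0])
      show "h (Suc n) = h n + \<tau> + m * (\<tau> + h n - h (n - delay n))" for n by (rule h_Suc)
      show "slack n0 s (Suc n) / slack n0 s n * (\<tau> + m * (\<tau> + a n - a (n - delay n))) \<le> a (Suc n) - a n"
        if n: "n0 \<le> n" "n < N" for n
      proof -
        define ys where "ys = drop (N - n) xs"
        have len: "length ys = n" using n by (simp add: ys_def N_def)
        have "earlier ys = drop (N - (n - delay n)) xs"
        proof -
          have "delay n + (N - n) = N - (n - delay n)" using n delay_le[of n] by linarith
          then show ?thesis unfolding earlier_eq len by (simp only: ys_def drop_drop)
        qed
        then have "window1 ys = \<tau> + a n - a (n - delay n)"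
          by (simp add: window1_def a_def ys_def)
        moreover have "on_track n0 s (xs ! (N - Suc n) # ys)"
          using on_track_drop[OF ot, of "N - Suc n"] drop_eq[OF n(2)] by (simp only: ys_def)
        ultimately show ?thesis using n a_inc[OF n(2)] len by simp
      qed
      show "c * slack n0 s (Suc n) * (h (Suc n) - h n) \<le> a (Suc n) - a n" if n: "n < n0" "n < N" for n
      proof -
        have "h (Suc n) \<le> h n0" using n by (intro h_mono) simp
        then have "c * slack n0 s (Suc n) * (h (Suc n) - h n) \<le> c * 2 * (h n0 + 1)"
          using c slack_props(1,2)[OF s, of n0 "Suc n"] h_nonneg[of n] h_mono[of n "Suc n"]
          by (intro mult_mono mult_left_mono) (auto simp del: mean_time.simps)
        also have "\<dots> \<le> \<tau>" using c2 by (simp add: mult_ac)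
        finally show ?thesis unfolding a_inc[OF n(2)] by simp
      qed
      show "c * slack n0 s n \<le> 1" for n
      proof -
        have "c * slack n0 s n \<le> c * 2" using slack_props(2)[OF s] c by (intro mult_left_mono) auto
        then show ?thesis using c by linarith
      qed
      show "0 < slack n0 s n" for n using slack_props(1)[OF s, of n0 n] by simp
    qed (use m_pos \<tau> c slack_props(3)[OF s] that in auto)
    have "c * h N = (\<Sum>n<N. c * (h (Suc n) - h n))"
      by (simp only: sum_distrib_left[symmetric] sum_lessThan_telescope) simp
    also have "\<dots> \<le> (\<Sum>n<N. a (Suc n) - a n)"
    proof (rule sum_mono)
      fix n assume "n \<in> {..<N}"
      then have "n < N" by simp
      have "c * 1 * (h (Suc n) - h n) \<le> c * slack n0 s (Suc n) * (h (Suc n) - h n)"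
        using c slack_props(1)[OF s, of n0 "Suc n"] h_mono[of n "Suc n"]
        by (intro mult_right_mono mult_left_mono) (auto simp del: mean_time.simps)
      also have "\<dots> \<le> a (Suc n) - a n" by (rule inc[OF \<open>n < N\<close>])
      finally show "c * (h (Suc n) - h n) \<le> a (Suc n) - a n" by simp
    qed
    also have "\<dots> = time1 xs" by (simp only: sum_lessThan_telescope) (simp add: a_def N_def)
    finally show ?thesis by (simp add: N_def)
  qed
  then show ?thesis using c by blast
qed

text \<open>Killing at stops where the first bus gains less than \<open>v * time1 xs\<close> makes
  its time grow by a factor of at least \<open>1 + v\<close> at every surviving stop.\<close>

definition pursuit :: "real \<Rightarrow> history \<Rightarrow> history option pmf" where
  "pursuit v xs = map_pmf (\<lambda>y. if v * time1 xs \<le> real (fst y) \<and> time1 (y # xs) < time2 (y # xs)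
     then Some (y # xs) else None) (next_stop xs)"

lemma stay_pursuit_Suc:
  "stay (pursuit v) (Suc k) xs = measure_pmf.expectation (next_stop xs) (\<lambda>y.
     if v * time1 xs \<le> real (fst y) \<and> time1 (y # xs) < time2 (y # xs) then stay (pursuit v) k (y # xs) else 0)"
  by (auto simp: pursuit_def simp del: time1_simps time2_simps intro!: Bochner_Integration.integral_cong)

text \<open>Measured in units of \<open>(1 + m) ^ j\<close>, the mean distance of the buses loses at each step an amount
  comparable to the time of the first bus.\<close>

lemma stay_pursuit_le:
  assumes v: "0 \<le> v" "v \<le> m"
  defines "\<theta> \<equiv> (1 + v) / (1 + m)"
  shows "time1 xs < time2 xs \<Longrightarrow>
    v * time1 xs * (\<Sum>j<k. \<theta> ^ j) * stay (pursuit v) k xs \<le> time2 xs - time1 xs"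
proof (induction k arbitrary: xs)
  case (Suc k)
  define S where "S = time1 xs"
  define D where "D = time2 xs - time1 xs"
  define G where "G = (\<Sum>j<k. \<theta> ^ j)"
  define c where "c = v * S * (1 + \<theta> * G)"
  have \<theta>: "0 \<le> \<theta>" using v m_pos by (simp add: \<theta>_def)
  have G: "0 \<le> G" using \<theta> by (simp add: G_def sum_nonneg)
  have S: "0 \<le> S" by (simp add: S_def time1_nonneg)
  have D: "0 < D" using Suc.prems by (simp add: D_def)
  have c: "0 \<le> c" using v S \<theta> G by (simp add: c_def)
  have sum: "(\<Sum>j<Suc k. \<theta> ^ j) = 1 + \<theta> * G"
    unfolding G_def by (subst sum.lessThan_Suc_shift) (simp add: sum_distrib_left)
  define f where "f y z = (if v * S \<le> real y \<and> 0 < D + real z - real y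
    then stay (pursuit v) k ((y, z) # xs) else 0)" for y z
  have f: "0 \<le> f y z" "f y z \<le> 1" for y z by (auto simp: f_def)
  have fb: "\<bar>f y z\<bar> \<le> 1" for y z using f[of y z] by simp
  \<comment> \<open>The induction hypothesis after one stop, where the time of the first bus is at
    least \<open>(1 + v) * S\<close>. Division by \<open>1 + m\<close> produces \<theta> and shifts
    the sum by one index.\<close>
  have cf: "c * f y z \<le> v * S + (D + real z - real y) / (1 + m)" if y: "v * S \<le> real y" "0 < D + real z - real y" for y z
  proof -
    let ?st = "stay (pursuit v) k ((y, z) # xs)"
    have "v * time1 ((y, z) # xs) * G * ?st \<le> D + real z - real y"
      using Suc.IH[of "(y, z) # xs"] y(2) by (simp add: G_def D_def)
    moreover have "v * ((1 + v) * S) * G * ?st \<le> v * time1 ((y, z) # xs) * G * ?st"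
      using v G \<tau> y by (intro mult_right_mono mult_left_mono) (auto simp: S_def algebra_simps)
    ultimately have "v * ((1 + v) * S) * G * ?st \<le> D + real z - real y" by linarith
    then have "v * ((1 + v) * S) * G * ?st / (1 + m) \<le> (D + real z - real y) / (1 + m)"
      using m_pos by (intro divide_right_mono) auto
    moreover have "v * S * (\<theta> * G) * ?st = v * ((1 + v) * S) * G * ?st / (1 + m)"
      by (simp add: \<theta>_def mult_ac)
    moreover have "v * S * ?st \<le> v * S" using v S by (intro mult_left_le) auto
    ultimately show ?thesis using y by (simp add: f_def c_def distrib_left distrib_right)
  qed
  \<comment> \<open>Given \<open>y\<close>, the mean distance after the stop is at most
    \<open>(1 + m) * (D - y)\<close>, which the division reduces to \<open>D - y\<close>; the
    remaining \<open>v * S\<close> is covered by \<open>y\<close>.\<close>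
  have inner: "c * measure_pmf.expectation (boarding \<alpha> (window2 xs y)) (f y) \<le> D" for y
  proof (cases "v * S \<le> real y \<and> real y < D")
    case True
    note E = expectation_boarding_le[OF \<alpha> window2_nonneg, of xs y]
    have w: "window2 xs y \<le> D - real y" using True by (simp add: window2_def start2_def D_def)
    have "c * measure_pmf.expectation (boarding \<alpha> (window2 xs y)) (f y) =
        measure_pmf.expectation (boarding \<alpha> (window2 xs y)) (\<lambda>z. c * f y z)" by simp
    also have "\<dots> \<le> measure_pmf.expectation (boarding \<alpha> (window2 xs y)) (\<lambda>z. v * S + (D - real y) / (1 + m) + real z / (1 + m))"
    proof (rule integral_mono)
      show "integrable (measure_pmf (boarding \<alpha> (window2 xs y))) (\<lambda>z. c * f y z)"
        using integrable_pmf_bounded[of "f y" 1 "boarding \<alpha> (window2 xs y)"] fb by auto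
      show "integrable (measure_pmf (boarding \<alpha> (window2 xs y))) (\<lambda>z. v * S + (D - real y) / (1 + m) + real z / (1 + m))"
        using E(1) by auto
      show "c * f y z \<le> v * S + (D - real y) / (1 + m) + real z / (1 + m)" for z
        using cf[of y z] True by (simp add: add_divide_distrib diff_divide_distrib)
    qed
    also have "\<dots> = v * S + (D - real y) / (1 + m) + measure_pmf.expectation (boarding \<alpha> (window2 xs y)) real / (1 + m)"
      using E(1) by simp
    also have "\<dots> \<le> v * S + (D - real y) / (1 + m) + m * (D - real y) / (1 + m)"
    proof -
      have "measure_pmf.expectation (boarding \<alpha> (window2 xs y)) real \<le> m * (D - real y)"
        using E(2) mult_left_mono[OF w, of m] m_pos by (simp add: m_def)
      then show ?thesis using m_pos by (intro add_left_mono divide_right_mono) auto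
    qed
    also have "\<dots> = v * S + (D - real y)"
      using m_pos by (simp add: add_divide_distrib[symmetric] distrib_right[symmetric] field_simps)
    also have "\<dots> \<le> D" using True by simp
    finally show ?thesis .
  next
    case False
    have "measure_pmf.expectation (boarding \<alpha> (window2 xs y)) (f y) = 0"
    proof (cases "v * S \<le> real y")
      case True
      then have "D \<le> real y" using False by simp
      then have "window2 xs y = 0" by (simp add: window2_def start2_def D_def)
      then show ?thesis using \<open>D \<le> real y\<close> by (simp add: boarding_0[OF \<alpha>] f_def)
    next
      case False
      then have "f y = (\<lambda>_. 0)" by (auto simp: f_def)
      then show ?thesis by simp
    qed
    then show ?thesis using D by simp
  qed
  have "stay (pursuit v) (Suc k) xs = measure_pmf.expectation (next_stop xs) (\<lambda>(y, z). f y z)"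
    unfolding stay_pursuit_Suc
    by (intro Bochner_Integration.integral_cong) (auto simp: f_def S_def D_def algebra_simps)
  also have "\<dots> = measure_pmf.expectation (boarding \<alpha> (window1 xs)) (\<lambda>y.
      measure_pmf.expectation (boarding \<alpha> (window2 xs y)) (f y))"
    by (subst expectation_next_stop[where C = 1]) (auto simp: fb split: prod.split)
  finally have eq: "v * time1 xs * (\<Sum>j<Suc k. \<theta> ^ j) * stay (pursuit v) (Suc k) xs =
      measure_pmf.expectation (boarding \<alpha> (window1 xs)) (\<lambda>y.
      c * measure_pmf.expectation (boarding \<alpha> (window2 xs y)) (f y))"
    unfolding sum c_def S_def by simp
  have E0: "0 \<le> measure_pmf.expectation (boarding \<alpha> (window2 xs y)) (f y)" for y
    by (rule integral_nonneg_AE) (use f in auto)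
  have "measure_pmf.expectation (boarding \<alpha> (window1 xs)) (\<lambda>y.
      c * measure_pmf.expectation (boarding \<alpha> (window2 xs y)) (f y)) \<le> D"
    by (rule expectation_pmf_bounds[THEN conjunct2]) (use inner c E0 D in auto)
  then show ?case unfolding eq by (simp add: D_def)
qed simp

fun slow :: "real \<Rightarrow> nat \<Rightarrow> history \<Rightarrow> bool" where
  "slow v n [] \<longleftrightarrow> False"
| "slow v n (y # xs) \<longleftrightarrow> n \<le> length xs \<and> real (fst y) < v * time1 xs \<or> slow v n xs"

lemma slow_path: "slow v n xs \<Longrightarrow> zs \<in> set_pmf (path k xs) \<Longrightarrow> slow v n zs"
proof (induction k arbitrary: xs)
  case (Suc k)
  then obtain y where y: "zs \<in> set_pmf (path k (y # xs))" by auto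
  have "slow v n (y # xs)" using Suc.prems(1) by simp
  then show ?case using y by (rule Suc.IH)
qed simp

text \<open>Either the pursuit survives as well or some stop is slow, and a slow stop remains
  recorded in all later histories.\<close>

lemma survival_le_pursuit:
  "n \<le> length xs \<Longrightarrow> survival k xs \<le> stay (pursuit v) k xs + measure_pmf.prob (path k xs) {zs. slow v n zs}"
proof (induction k arbitrary: xs)
  case 0
  then show ?case using survival_bounds[of 0 xs] by (simp add: add_increasing2)
next
  case (Suc k)
  define f where "f y = (if v * time1 xs \<le> real (fst y) \<and> time1 (y # xs) < time2 (y # xs)
      then stay (pursuit v) k (y # xs) else 0)" for y
  have f: "0 \<le> f y" "\<bar>f y\<bar> \<le> 1" for y by (auto simp: f_def)
  define g where "g y = measure_pmf.prob (path k (y # xs)) {zs. slow v n zs}" for y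
  have g: "0 \<le> g y" "g y \<le> 1" for y by (auto simp: g_def)
  have "survival (Suc k) xs = measure_pmf.expectation (next_stop xs) (\<lambda>y. survival k (y # xs))"
    by (rule survival_Suc)
  also have "\<dots> \<le> measure_pmf.expectation (next_stop xs) (\<lambda>y. f y + g y)"
  proof (rule expectation_pmf_mono[OF survival_bounded])
    show "\<bar>f y + g y\<bar> \<le> 2" for y using f[of y] g[of y] by linarith
    show "survival k (y # xs) \<le> f y + g y" for y
    proof (cases "v * time1 xs \<le> real (fst y)")
      case False
      then have *: "slow v n (y # xs)" using Suc.prems by simp
      have "zs \<in> {zs. slow v n zs}" if "zs \<in> set_pmf (path k (y # xs))" for zs
        using slow_path[OF * that] by simp
      then have "g y = 1"
        unfolding g_def by (subst measure_pmf.prob_eq_1) (simp_all only: AE_measure_pmf_iff, auto)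
      then show ?thesis using survival_bounds[of k "y # xs"] f(1)[of y] by linarith
    next
      case True
      show ?thesis
      proof (cases "time1 (y # xs) < time2 (y # xs)")
        case True': True
        then show ?thesis using Suc.IH[of "y # xs"] Suc.prems True by (simp add: f_def g_def)
      next
        case False
        then have "\<not> alive (y # xs)" by simp
        then show ?thesis using survival_not_alive f(1)[of y] g(1)[of y] by simp
      qed
    qed
  qed
  also have "\<dots> = measure_pmf.expectation (next_stop xs) f + measure_pmf.expectation (next_stop xs) g"
    by (rule Bochner_Integration.integral_add) (use f g in \<open>auto intro!: integrable_pmf_bounded[where C = 1]\<close>)
  also have "measure_pmf.expectation (next_stop xs) f = stay (pursuit v) (Suc k) xs"
    unfolding stay_pursuit_Suc f_def ..
  also have "measure_pmf.expectation (next_stop xs) g = measure_pmf.prob (path (Suc k) xs) {zs. slow v n zs}"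
    by (simp add: g_def[abs_def] prob_bind_pmf)
  finally show ?case .
qed

text \<open>On track, a slow stop is possible only if the window opens late, at time
  \<open>b\<close> or after; this leads to a union bound over the \<open>j\<close> stops.\<close>

lemma prob_slow_le:
  assumes v: "\<And>y xs. n \<le> length xs \<Longrightarrow> on_track n0 s (y # xs) \<Longrightarrow> time1 (earlier xs) < b (length xs) \<Longrightarrow>
    v * time1 xs \<le> real (fst y)"
  shows "measure_pmf.prob (path (n + j) []) {xs. on_track n0 s xs \<and> slow v n xs} \<le>
    (\<Sum>i<j. measure_pmf.prob (path (n + i) []) {xs. b (n + i) \<le> time1 (earlier xs)})"
proof (induction j)
  case 0
  have "\<not> slow v n xs" if "length xs \<le> n" for xs
    using that by (induction xs) auto
  then have "measure_pmf.prob (path n []) {xs. on_track n0 s xs \<and> slow v n xs} = measure_pmf.prob (path n []) {}"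
    by (intro measure_pmf.finite_measure_eq_AE) (auto simp: AE_measure_pmf_iff dest!: length_path)
  then show ?case by simp
next
  case (Suc j)
  let ?A = "{xs. on_track n0 s xs \<and> slow v n xs}"
  let ?B = "{xs. b (n + j) \<le> time1 (earlier xs)}"
  have "measure_pmf.prob (path (n + Suc j) []) ?A =
      measure_pmf.expectation (path (n + j) []) (\<lambda>xs. measure_pmf.prob (next_stop xs) {y. y # xs \<in> ?A})"
    unfolding add_Suc_right path_Suc_snoc prob_bind_pmf by (simp add: vimage_def)
  also have "\<dots> \<le> measure_pmf.expectation (path (n + j) []) (\<lambda>xs. indicator ?A xs + indicator ?B xs)"
  proof (rule expectation_pmf_mono[where C = 1 and D = 2])
    fix xs assume "xs \<in> set_pmf (path (n + j) [])"
    then have len: "length xs = n + j" using length_path[of xs "n + j" "[]"] by simp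
    show "measure_pmf.prob (next_stop xs) {y. y # xs \<in> ?A} \<le> indicator ?A xs + indicator ?B xs"
    proof (cases "xs \<in> ?A \<or> xs \<in> ?B")
      case True
      then have "1 \<le> indicator ?A xs + (indicator ?B xs :: real)" by (auto simp: indicator_def)
      then show ?thesis using measure_pmf.prob_le_1[of "next_stop xs" "{y. y # xs \<in> ?A}"] by linarith
    next
      case False
      have eq: "{y. y # xs \<in> ?A} = {}"
      proof (rule equals0I)
        fix y assume "y \<in> {y. y # xs \<in> ?A}"
        then have ot: "on_track n0 s (y # xs)" and sl: "slow v n (y # xs)" by auto
        have "\<not> slow v n xs" "time1 (earlier xs) < b (n + j)" using ot False by auto
        then show False using v[OF _ ot] sl len by auto
      qed
      show ?thesis unfolding eq by simp
    qed
  qed (auto simp: indicator_def)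
  also have "\<dots> = measure_pmf.prob (path (n + j) []) ?A + measure_pmf.prob (path (n + j) []) ?B"
    by (subst Bochner_Integration.integral_add) (auto intro!: integrable_pmf_bounded[where C = 1] simp: indicator_def)
  finally show ?case using Suc by simp
qed

lemma unbounded_survival:
  assumes \<delta>: "filterlim \<delta> at_top sequentially"
  shows "(\<lambda>n. survival n []) \<longlonglongrightarrow> 0"
proof -
  have "\<exists>n. survival n [] \<le> 4 * \<eta>" if \<eta>: "0 < \<eta>" for \<eta>
  proof -
    obtain n0 s where s: "0 < s" "s < 1"
      and likely: "\<And>n. measure_pmf.prob (path n []) {xs. \<not> on_track n0 s xs} \<le> \<eta>"
      using on_track_likely[OF \<delta> \<eta>] by blast
    obtain c where c: "0 < c" "\<And>xs. on_track n0 s xs \<Longrightarrow> c * h (length xs) \<le> time1 xs"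
      using on_track_time1_ge[OF s] by blast
    \<comment> \<open>The number of stops of the pursuit; the mean of \<open>time2\<close> divided
      by the loss over these stops will be at most \<open>8 / (m * c * k)\<close>.\<close>
    define k where "k = Suc (nat \<lceil>8 / (m * c * \<eta>)\<rceil>)"
    have k: "1 \<le> real k" "8 / (m * c * \<eta>) \<le> real k" unfolding k_def by linarith+
    have k8: "8 / (m * c * real k) \<le> \<eta>"
    proof -
      have "8 \<le> real k * (m * c * \<eta>)" using k(2) m_pos c \<eta> by (simp add: pos_divide_le_eq)
      then show ?thesis using m_pos c k(1) by (simp add: pos_divide_le_eq mult_ac)
    qed
    \<comment> \<open>The slack, the part of the travel outside the window and the travel time
      \<tau> each cost a relative amount \<epsilon>, whence the 3 in \<open>v\<close>. The order
      \<open>1 / k\<close> keeps \<open>\<theta> ^ k \<ge> 1 / 2\<close> by Bernoulli's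
      inequality.\<close>
    define \<epsilon> where "\<epsilon> = 1 / (6 * real k)"
    have \<epsilon>: "0 < \<epsilon>" "3 * \<epsilon> = 1 / (2 * real k)" "3 * \<epsilon> \<le> 1 / 2" using k by (auto simp: \<epsilon>_def field_simps)
    define v where "v = m * (1 - 3 * \<epsilon>)"
    have v: "m / 2 \<le> v" "v \<le> m" "0 < v"
    proof -
      have "m * (1 / 2) \<le> v" unfolding v_def using m_pos \<epsilon> by (intro mult_left_mono) auto
      then show "m / 2 \<le> v" by simp
      then show "0 < v" using m_pos by simp
      show "v \<le> m" unfolding v_def using m_pos \<epsilon> by (simp add: mult_left_le)
    qed
    define \<theta> where "\<theta> = (1 + v) / (1 + m)"
    have \<theta>: "0 \<le> \<theta>" "\<theta> \<le> 1" "1 - 3 * \<epsilon> \<le> \<theta>"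
    proof -
      show "0 \<le> \<theta>" "\<theta> \<le> 1" using v m_pos by (auto simp: \<theta>_def)
      have "(1 - 3 * \<epsilon>) * (1 + m) \<le> 1 + v" using \<epsilon>(1) by (simp add: v_def algebra_simps)
      then show "1 - 3 * \<epsilon> \<le> \<theta>" unfolding \<theta>_def using m_pos by (simp add: pos_le_divide_eq)
    qed
    have \<theta>k: "1 / 2 \<le> \<theta> ^ k"
    proof -
      have "1 + real k * (- (3 * \<epsilon>)) \<le> (1 + (- (3 * \<epsilon>))) ^ k"
        using \<epsilon> by (intro Bernoulli_inequality) auto
      also have "\<dots> \<le> \<theta> ^ k" using \<theta> \<epsilon> by (intro power_mono) auto
      finally show ?thesis using k(1) by (simp add: \<epsilon>(2))
    qed
    have \<theta>_sum: "real k / 2 \<le> (\<Sum>j<k. \<theta> ^ j)"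
    proof -
      have "(\<Sum>j<k. 1 / 2) \<le> (\<Sum>j<k. \<theta> ^ j)"
      proof (rule sum_mono)
        fix j assume "j \<in> {..<k}"
        then have "\<theta> ^ k \<le> \<theta> ^ j" using \<theta> by (intro power_decreasing) auto
        then show "1 / 2 \<le> \<theta> ^ j" using \<theta>k by linarith
      qed
      then show ?thesis by simp
    qed
    have "eventually (\<lambda>n. s ^ n < \<epsilon>) sequentially"
      using order_tendstoD(2)[OF LIMSEQ_realpow_zero[of s] \<epsilon>(1)] s by simp
    then obtain n1 where n1: "\<And>n. n1 \<le> n \<Longrightarrow> s ^ n < \<epsilon>" by (auto simp: eventually_sequentially)
    have "eventually (\<lambda>n. h (n - delay n) / h n < \<eta> * (\<epsilon> * c) / real k) sequentially"
      using \<eta> \<epsilon> c k by (intro order_tendstoD(2)[OF h_ratio_tendsto[OF \<delta>]]) auto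
    then obtain n2 where n2: "\<And>n. n2 \<le> n \<Longrightarrow> h (n - delay n) / h n < \<eta> * (\<epsilon> * c) / real k"
      by (auto simp: eventually_sequentially)
    \<comment> \<open>From here on \<tau> is at most the share \<epsilon> of
      \<open>m * time1\<close>, the head start \<mu> is at most \<open>h n\<close>, and the
      thresholds \<open>n1\<close> and \<open>n2\<close> are passed.\<close>
    define n where "n = Suc (n0 + n1 + n2 + nat \<lceil>1 / (m * \<epsilon>)\<rceil> + nat \<lceil>\<mu> / \<tau>\<rceil>)"
    have "1 / (m * \<epsilon>) \<le> real n" "\<mu> / \<tau> \<le> real n" unfolding n_def by linarith+
    then have n: "n0 + n1 \<le> n" "n2 \<le> n" "1 \<le> n" "1 \<le> m * \<epsilon> * real n" "\<mu> \<le> \<tau> * real n"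
      using m_pos \<epsilon> \<tau> by (auto simp: n_def field_simps)
    have hn: "\<mu> \<le> h n" "0 < h n" using h_ge[of n] n \<mu> by auto
    have h_pos: "0 < h i" if "n \<le> i" for i using hn h_mono[OF that] by linarith
    have fast: "v * time1 xs \<le> real (fst y)"
      if len: "n \<le> length xs" and ot: "on_track n0 s (y # xs)" and e: "time1 (earlier xs) < \<epsilon> * (c * h (length xs))" for y xs
    proof -
      define S where "S = time1 xs"
      have "\<tau> * real n \<le> \<tau> * real (length xs)" using len \<tau> by simp
      then have S: "\<tau> * real n \<le> S" by (simp add: S_def time1_def)
      have S0: "0 \<le> S" by (simp add: S_def time1_nonneg)
      have "c * h (length xs) \<le> S" using c(2)[of xs] ot by (simp add: S_def)
      then have "\<epsilon> * (c * h (length xs)) \<le> \<epsilon> * S" using \<epsilon> by (intro mult_left_mono) auto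
      then have w: "(1 - \<epsilon>) * S \<le> window1 xs" using e \<tau> by (simp add: window1_def S_def algebra_simps)
      have sl: "1 - \<epsilon> \<le> slack n0 s (Suc (length xs)) / slack n0 s (length xs)"
      proof -
        have "s ^ (length xs - n0) < \<epsilon>" using n(1) len by (intro n1) linarith
        then show ?thesis using slack_props(5)[OF s, of "length xs" n0] by linarith
      qed
      have "(1 - \<epsilon>) * (m * ((1 - \<epsilon>) * S)) \<le>
          slack n0 s (Suc (length xs)) / slack n0 s (length xs) * (\<tau> + m * window1 xs)"
      proof (rule mult_mono[OF sl])
        have "m * ((1 - \<epsilon>) * S) \<le> m * window1 xs" using w m_pos by (intro mult_left_mono) auto
        then show "m * ((1 - \<epsilon>) * S) \<le> \<tau> + m * window1 xs" using \<tau> by linarith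
        show "0 \<le> slack n0 s (Suc (length xs)) / slack n0 s (length xs)" using sl \<epsilon> by linarith
        show "0 \<le> m * ((1 - \<epsilon>) * S)" using m_pos \<epsilon> S0 by simp
      qed
      also have "\<dots> \<le> \<tau> + real (fst y)" using ot n len by simp
      finally have 1: "(1 - \<epsilon>) * (m * ((1 - \<epsilon>) * S)) \<le> \<tau> + real (fst y)" .
      have "\<tau> * 1 \<le> \<tau> * (m * \<epsilon> * real n)" using n \<tau> by (intro mult_left_mono) auto
      also have "\<dots> = m * \<epsilon> * (\<tau> * real n)" by simp
      also have "\<dots> \<le> m * \<epsilon> * S" using S m_pos \<epsilon> by (intro mult_left_mono) auto
      finally have 2: "\<tau> \<le> m * \<epsilon> * S" by simp
      have 3: "0 \<le> \<epsilon> * (\<epsilon> * (m * S))" using \<epsilon> m_pos S0 by simp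
      have "v * S = (1 - \<epsilon>) * (m * ((1 - \<epsilon>) * S)) - m * \<epsilon> * S - \<epsilon> * (\<epsilon> * (m * S))"
        by (simp add: v_def algebra_simps)
      then show ?thesis using 1 2 3 by (simp add: S_def)
    qed
    have slow: "measure_pmf.prob (path (n + k) []) {xs. slow v n xs} \<le> 2 * \<eta>"
    proof -
      have "measure_pmf.prob (path (n + k) []) {xs. slow v n xs} \<le>
          measure_pmf.prob (path (n + k) []) ({xs. \<not> on_track n0 s xs} \<union> {xs. on_track n0 s xs \<and> slow v n xs})"
        by (rule measure_pmf.finite_measure_mono) auto
      also have "\<dots> \<le> measure_pmf.prob (path (n + k) []) {xs. \<not> on_track n0 s xs} +
          measure_pmf.prob (path (n + k) []) {xs. on_track n0 s xs \<and> slow v n xs}"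
        by (rule measure_Un_le) auto
      also have "\<dots> \<le> \<eta> + (\<Sum>i<k. measure_pmf.prob (path (n + i) []) {xs. \<epsilon> * (c * h (n + i)) \<le> time1 (earlier xs)})"
        by (intro add_mono likely prob_slow_le[where b = "\<lambda>i. \<epsilon> * (c * h i)"] fast)
      also have "\<dots> \<le> \<eta> + (\<Sum>i<k. \<eta> / real k)"
      proof (intro add_left_mono sum_mono)
        fix i
        have hp: "0 < h (n + i)" by (rule h_pos) simp
        have "measure_pmf.prob (path (n + i) []) {xs. \<epsilon> * (c * h (n + i)) \<le> time1 (earlier xs)} \<le>
            h (n + i - delay (n + i)) / (\<epsilon> * (c * h (n + i)))"
          using \<epsilon> c hp by (intro prob_earlier_gt) simp
        also have "\<dots> = h (n + i - delay (n + i)) / h (n + i) / (\<epsilon> * c)" by simp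
        also have "\<dots> \<le> \<eta> * (\<epsilon> * c) / real k / (\<epsilon> * c)"
          using n2[of "n + i"] n \<epsilon> c by (intro divide_right_mono) auto
        also have "\<dots> = \<eta> / real k" using \<epsilon> c by simp
        finally show "measure_pmf.prob (path (n + i) []) {xs. \<epsilon> * (c * h (n + i)) \<le> time1 (earlier xs)} \<le> \<eta> / real k" .
      qed
      also have "\<dots> = 2 * \<eta>" using k by simp
      finally show ?thesis .
    qed
    \<comment> \<open>By \<open>stay_pursuit_le\<close> with \<open>c * h n \<le> time1 xs\<close>
      and the sum of the powers of \<theta> at least \<open>k / 2\<close>, the pursuit survives with
      probability at most \<open>B * time2 xs\<close>.\<close>
    define B where "B = 2 / (v * (c * h n) * real k)"
    have B: "0 < B" using v c hn k by (simp add: B_def)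
    have point: "survival k xs \<le> indicator {xs. \<not> on_track n0 s xs} xs + B * time2 xs +
        measure_pmf.prob (path k xs) {zs. slow v n zs}" if len: "length xs = n" for xs
    proof -
      have Bt: "0 \<le> B * time2 xs" using B time2_nonneg by simp
      show ?thesis
      proof (cases "on_track n0 s xs \<and> alive xs")
        case False
        then have "survival k xs \<le> indicator {xs. \<not> on_track n0 s xs} xs"
          using survival_bounds[of k xs] survival_not_alive[of xs k] by (auto simp: indicator_def)
        then show ?thesis using Bt by (simp add: add_increasing2)
      next
        case True
        then have lt: "time1 xs < time2 xs" using len n by (cases xs) auto
        have S: "c * h n \<le> time1 xs" using c(2)[of xs] True len by simp
        let ?st = "stay (pursuit v) k xs"
        have "v * (c * h n) * (real k / 2) * ?st \<le> v * time1 xs * (\<Sum>j<k. \<theta> ^ j) * ?st"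
          using S \<theta>_sum v c hn time1_nonneg[of xs] by (intro mult_right_mono mult_mono) auto
        also have "\<dots> \<le> time2 xs - time1 xs"
          using stay_pursuit_le[of v xs k] v lt unfolding \<theta>_def by simp
        also have "\<dots> \<le> time2 xs" using time1_nonneg[of xs] by simp
        finally have "?st \<le> time2 xs / (v * (c * h n) * (real k / 2))"
          using v c hn k by (subst pos_le_divide_eq) (auto simp: mult_ac)
        also have "\<dots> = B * time2 xs" by (simp add: B_def)
        finally have "?st \<le> B * time2 xs" .
        moreover have "(0 :: real) \<le> indicator {xs. \<not> on_track n0 s xs} xs" by simp
        moreover have "survival k xs \<le> ?st + measure_pmf.prob (path k xs) {zs. slow v n zs}"
          using len by (intro survival_le_pursuit) simp
        ultimately show ?thesis by linarith
      qed
    qed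
    have int: "integrable (measure_pmf (path n [])) (indicator {xs. \<not> on_track n0 s xs} :: history \<Rightarrow> real)"
      "integrable (measure_pmf (path n [])) (\<lambda>xs. measure_pmf.prob (path k xs) {zs. slow v n zs})"
      by (auto intro!: integrable_pmf_bounded[where C = 1] simp: indicator_def)
    have "survival (n + k) [] = measure_pmf.expectation (path n []) (survival k)"
      by (rule survival_add)
    also have "\<dots> \<le> measure_pmf.expectation (path n []) (\<lambda>xs. indicator {xs. \<not> on_track n0 s xs} xs + B * time2 xs +
        measure_pmf.prob (path k xs) {zs. slow v n zs})"
    proof (rule integral_mono_AE)
      show "integrable (measure_pmf (path n [])) (survival k)" by (rule integrable_pmf_bounded[OF survival_bounded])
      show "integrable (measure_pmf (path n [])) (\<lambda>xs. indicator {xs. \<not> on_track n0 s xs} xs + B * time2 xs +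
          measure_pmf.prob (path k xs) {zs. slow v n zs})"
        using int time2_mean(1)[of n] by (intro Bochner_Integration.integrable_add) auto
      show "AE xs in measure_pmf (path n []). survival k xs \<le> indicator {xs. \<not> on_track n0 s xs} xs + B * time2 xs +
          measure_pmf.prob (path k xs) {zs. slow v n zs}"
        unfolding AE_measure_pmf_iff
      proof
        fix xs assume "xs \<in> set_pmf (path n [])"
        then show "survival k xs \<le> indicator {xs. \<not> on_track n0 s xs} xs + B * time2 xs +
            measure_pmf.prob (path k xs) {zs. slow v n zs}"
          using length_path[of xs n "[]"] by (intro point) simp
      qed
    qed
    also have "\<dots> = measure_pmf.prob (path n []) {xs. \<not> on_track n0 s xs} + B * measure_pmf.expectation (path n []) time2 +
        measure_pmf.prob (path (n + k) []) {zs. slow v n zs}"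
      using int time2_mean(1)[of n] by (simp add: path_add prob_bind_pmf)
    \<comment> \<open>One \<eta> for being off track at station \<open>n\<close>, one for the
      pursuit, and two for a slow stop, which includes being off track at station
      \<open>n + k\<close>.\<close>
    also have "\<dots> \<le> \<eta> + \<eta> + 2 * \<eta>"
    proof (intro add_mono likely slow)
      have "B * measure_pmf.expectation (path n []) time2 \<le> B * (2 * h n)"
        using time2_mean(2)[of n] B hn by (intro mult_left_mono) auto
      also have "\<dots> = 4 / (v * c * real k)" using hn by (simp add: B_def)
      also have "\<dots> \<le> 4 / (m / 2 * c * real k)"
        using v c k m_pos by (intro divide_left_mono mult_right_mono) auto
      also have "\<dots> = 8 / (m * c * real k)" by simp
      finally show "B * measure_pmf.expectation (path n []) time2 \<le> \<eta>" using k8 by linarith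
    qed
    finally show ?thesis by (intro exI[of _ "n + k"]) simp
  qed
  note ex = this
  show ?thesis
  proof (rule LIMSEQ_I)
    fix r :: real assume r: "0 < r"
    obtain N where N: "survival N [] \<le> 4 * (r / 8)" using ex[of "r / 8"] r by auto
    have "norm (survival n [] - 0) < r" if "N \<le> n" for n
      using decseqD[OF survival_decseq that, of "[]"] N r survival_bounds[of n "[]"] by simp
    then show "\<exists>no. \<forall>n\<ge>no. norm (survival n [] - 0) < r" by blast
  qed
qed

end


section \<open>The critical parameter\<close>

lemma poly_critical_poly: "poly (critical_poly m a) r = r ^ (a + 1) - m * (\<Sum>k\<le>a. r ^ k)"
  by (simp add: critical_poly_def poly_sum poly_monom atLeast0AtMost)

lemma largest_root_eq:
  assumes "0 < m"
  shows "0 < largest_root m a" "largest_root m a ^ (a + 1) = m * (\<Sum>k\<le>a. largest_root m a ^ k)"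
proof -
  define P where "P = critical_poly m a"
  define R where "R = {r. 0 < r \<and> poly P r = 0}"
  have "coeff P (a + 1) = 1"
    by (simp add: P_def critical_poly_def coeff_sum)
  then have "P \<noteq> 0" by auto
  then have "finite R"
    unfolding R_def by (rule finite_subset[OF _ poly_roots_finite, rotated]) auto
  moreover have "R \<noteq> {}"
  proof -
    have "poly P 0 < 0"
      using assms by (simp add: P_def poly_critical_poly power_0_left)
    \<comment> \<open>The value is 1, because \<open>m\<close> times the geometric sum of the powers
      of \<open>1 + m\<close> is \<open>(1 + m) ^ (a + 1) - 1\<close>.\<close>
    moreover have "0 < poly P (1 + m)"
    proof -
      have "m * (\<Sum>k\<le>a. (1 + m) ^ k) = (1 + m) ^ Suc a - 1"
        using power_diff_1_eq[of "1 + m" "Suc a"] by (simp add: lessThan_Suc_atMost del: power_Suc)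
      then show ?thesis by (simp add: P_def poly_critical_poly)
    qed
    ultimately obtain x where "0 < x" "poly P x = 0"
      using poly_IVT_pos[of 0 "1 + m" P] assms by auto
    then show ?thesis by (auto simp: R_def)
  qed
  ultimately have "Max R \<in> R" by (rule Max_in)
  then have "largest_root m a \<in> R" by (simp add: largest_root_def R_def P_def)
  then show "0 < largest_root m a" "largest_root m a ^ (a + 1) = m * (\<Sum>k\<le>a. largest_root m a ^ k)"
    by (auto simp: R_def P_def poly_critical_poly)
qed

text \<open>For a root below 1 each power in the sum is at least \<open>r ^ a\<close>, so the
  equation gives \<open>m * (a + 1) \<le> r\<close>. With \<open>a = d - 2\<close> this is the
  condition on the mean offspring.\<close>

lemma largest_root_less_1:
  assumes "0 < m" "largest_root m a < 1"
  shows "m * real (a + 1) < 1"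
proof -
  define r where "r = largest_root m a"
  have r: "0 < r" "r < 1" "r ^ (a + 1) = m * (\<Sum>k\<le>a. r ^ k)"
    using largest_root_eq[OF assms(1)] assms(2) by (auto simp: r_def)
  have "m * (\<Sum>k\<le>a. r ^ a) \<le> m * (\<Sum>k\<le>a. r ^ k)"
    using assms(1) r by (intro mult_left_mono sum_mono power_decreasing) auto
  then have "m * real (a + 1) * r ^ a \<le> r * r ^ a"
    using r(3) by (simp add: mult.assoc)
  then have "m * real (a + 1) \<le> r" using r(1) by (simp only: mult_le_cancel_right_pos zero_less_power)
  then show ?thesis using r(2) by simp
qed

theorem theorem7:
  fixes M :: "'a measure" and T :: "nat \<Rightarrow> nat \<Rightarrow> 'a \<Rightarrow> real"
    and \<alpha> \<tau> \<mu> m :: real and \<delta> :: "nat \<Rightarrow> nat" and d :: nat and N :: "'a \<Rightarrow> enat"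
  assumes "prob_space M"
    and "0 < \<alpha>" and "\<alpha> < 1" and "0 < \<tau>" and "0 < \<mu>"
    and "m = \<alpha> / (1 - \<alpha>)"
    and "queueing_discipline \<delta>"
    and "arrivals M \<alpha> T"
    and "\<And>\<omega>. N \<omega> = coalescence_station \<delta> \<tau> \<mu> (\<lambda>i k. T i k \<omega>)"
    and "2 \<le> d"
  shows "((\<forall>n\<ge>1. \<delta> n = min d n) \<and> largest_root m (d - 2) < 1 \<longrightarrow>
            measure M {\<omega> \<in> space M. N \<omega> < \<infinity>} = 1) \<and>
         ((\<forall>n\<ge>1. \<delta> n = min d n) \<and> largest_root m (d - 2) > 1 \<longrightarrow>
            measure M {\<omega> \<in> space M. N \<omega> = \<infinity>} > 0) \<and>
         (filterlim \<delta> at_top sequentially \<longrightarrow>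
            measure M {\<omega> \<in> space M. N \<omega> < \<infinity>} = 1)"
proof -
  interpret prob_space M by fact
  interpret two_buses_prob \<delta> \<tau> \<mu> \<alpha> M T
    by unfold_locales (use assms in auto)
  have m: "0 < m" using assms by simp
  have d: "d - 2 + 1 = d - 1" "Suc (d - 2) = d - 1" using \<open>2 \<le> d\<close> by auto
  show ?thesis
  proof (intro conjI impI; (elim conjE)?)
    assume \<delta>: "\<forall>n\<ge>1. \<delta> n = min d n" and "largest_root m (d - 2) < 1"
    then have "m * real (d - 1) < 1" using largest_root_less_1[OF m] d by metis
    then have "(\<lambda>n. survival n []) \<longlonglongrightarrow> 0"
      using \<delta> \<open>2 \<le> d\<close> \<open>m = \<alpha> / (1 - \<alpha>)\<close> by (intro subcritical_survival[of d]) auto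
    from coalescence_prob(2)[OF this assms(9)] show "measure M {\<omega> \<in> space M. N \<omega> < \<infinity>} = 1" by simp
  next
    assume \<delta>: "\<forall>n\<ge>1. \<delta> n = min d n" and r: "1 < largest_root m (d - 2)"
    have "largest_root m (d - 2) ^ (d - 1) = m * (\<Sum>k<d - 1. largest_root m (d - 2) ^ k)"
      using largest_root_eq(2)[OF m, of "d - 2"] unfolding lessThan_Suc_atMost[symmetric] d .
    then obtain c where c: "0 < c" "\<And>n. c \<le> survival n []"
      using supercritical_survival[OF \<open>2 \<le> d\<close> _ \<open>m = \<alpha> / (1 - \<alpha>)\<close> r] \<delta> by blast
    obtain p where p: "(\<lambda>n. survival n []) \<longlonglongrightarrow> p"
      using decseq_convergent[OF survival_decseq, of 0 "[]"] survival_bounds by metis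
    then have "c \<le> p" by (rule LIMSEQ_le_const) (use c in auto)
    then show "measure M {\<omega> \<in> space M. N \<omega> = \<infinity>} > 0"
      using coalescence_prob(1)[OF p assms(9)] c by simp
  next
    assume "filterlim \<delta> at_top sequentially"
    then have "(\<lambda>n. survival n []) \<longlonglongrightarrow> 0" by (rule unbounded_survival)
    from coalescence_prob(2)[OF this assms(9)] show "measure M {\<omega> \<in> space M. N \<omega> < \<infinity>} = 1" by simp
  qed
qed

end
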